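(* Let $\rho$ be a Gaussian Fermionic state of $n$ modes with correlation matrix $C$. Let $\mathrm{Ad}_C X:=CXC^\dagger=CXC$ act on $2n\times 2n$ complex matrices, and let $(\cdot)^{-1}$ denote the pseudo-inverse. Then the rescaled fidelity (Bures) metric $ds^2=8\,ds_B^2=16[1-\mathcal F(\rho,\rho+d\rho)]$ around the Gaussian Fermionic state $\rho$ specified by $C$ is $$ds^2=\operatorname{Tr}\left[dC\,(\mathbb 1-\mathrm{Ad}_C)^{-1}dC\right]=\left\|(\mathbb 1-\mathrm{Ad}_C)^{-1/2}\,dC\right\|_2^2 .$$ In particular, when $\rho$ is pure, $\mathrm{Sp}(C)=\{\pm1\}$ and this reduces to $ds^2=\tfrac12\|dC\|_2^2$. Moreover, if $C$ (and thus $\rho$) depends on parameters $\lambda=(\lambda_\mu)$, so that $dC=\sum_\mu d\lambda_\mu\,\partial_\mu C$, then $ds^2=\sum_{\mu\nu}g_{\mu\nu}\,d\lambda_\mu d\lambda_\nu$ with $$g_{\mu\nu}=\sum_{r,s:\;c_rc_s\neq 1}\frac{(\partial_\mu C)_{rs}(\partial_\nu C)_{sr}}{1-c_rc_s},$$ where $C=\sum_r c_r|r\rangle\langle r|$ is the spectral decomposition of $C$ in an orthonormal eigenbasis ($c_r\in\mathbb R$) and $(\partial_\mu C)_{rs}=\langle r|\partial_\mu C|s\rangle$.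
   Context: Majorana operators $w_1,\dots,w_{2n}$ are Hermitian operators on the $2^n$-dimensional Hilbert space of $n$ Fermion modes with $\{w_i,w_j\}=2\delta_{ij}$. A Gaussian Fermionic state is a density operator that is Gaussian in the $w_j$, i.e. of the form $\rho=\prod_{k=1}^n\frac{1-i c_k z_{2k-1}z_{2k}}{2}$, where $z_i=\sum_jQ_{ij}w_j$ for a real orthogonal matrix $Q$ and $|c_k|\le1$ (when all $|c_k|<1$ this is the same as $\rho=e^{-\frac i4\sum_{ij}G_{ij}w_iw_j}/Z$ with $G$ real antisymmetric and $Z$ the normalization). It is completely specified by its correlation matrix $C_{ij}=\frac12\operatorname{Tr}(\rho[w_i,w_j])$, a $2n\times 2n$ imaginary antisymmetric (hence Hermitian) matrix with eigenvalues $\pm c_k$. $\mathcal F(\rho,\sigma)=\operatorname{Tr}\sqrt{\sqrt\rho\,\sigma\sqrt\rho}$ is the Uhlmann fidelity, and the Bures metric is $ds_B^2=2[1-\mathcal F(\rho,\rho+d\rho)]$, understood to second order in the infinitesimal variation, where $\rho+d\rho$ is the Gaussian Fermionic state with correlation matrix $C+dC$. $\|A\|_2^2=\operatorname{Tr}(A^\dagger A)$, and $\mathrm{Sp}$ denotes the spectrum.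
   Formalization: If ρ is not of full rank, ρ+dρ is taken among Gaussian states of the same rank as ρ; for rank-increasing variations the claim fails (n=1, c=1, c+dc=1−t gives 16(1−F)≈4t, while the pseudo-inverse formula gives 0). *)

theory Defs
  imports "HOL-Analysis.Analysis" "HOL-Library.Landau_Symbols"
begin

section \<open>Complex matrices\<close>

definition scale_mat :: "complex \<Rightarrow> complex^'j^'i \<Rightarrow> complex^'j^'i"  (infixr "\<cdot>\<^sub>m" 75)
  where "a \<cdot>\<^sub>m A = (\<chi> i j. a * A $ i $ j)"

definition dagger :: "complex^'j^'i \<Rightarrow> complex^'i^'j"
  where "dagger A = (\<chi> i j. cnj (A $ j $ i))"

definition hermitian :: "complex^'i^'i \<Rightarrow> bool"
  where "hermitian A \<longleftrightarrow> dagger A = A"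

definition cinner :: "complex^'i \<Rightarrow> complex^'i \<Rightarrow> complex"
  where "cinner x y = (\<Sum>i\<in>UNIV. cnj (x $ i) * y $ i)"

definition ketbra :: "complex^'i \<Rightarrow> complex^'i \<Rightarrow> complex^'i^'i"
  where "ketbra x y = (\<chi> i j. x $ i * cnj (y $ j))"

definition psd :: "complex^'i^'i \<Rightarrow> bool"
  where "psd A \<longleftrightarrow> hermitian A \<and> (\<forall>x. 0 \<le> Re (cinner x (A *v x)))"

definition mat_sqrt :: "complex^'i^'i \<Rightarrow> complex^'i^'i"
  where "mat_sqrt A = (THE B. psd B \<and> B ** B = A)"

definition spectrum :: "complex^'i^'i \<Rightarrow> complex set"
  where "spectrum A = {z. \<exists>v. v \<noteq> 0 \<and> A *v v = z *s v}"

definition hs_inner :: "complex^'i^'i \<Rightarrow> complex^'i^'i \<Rightarrow> complex"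
  where "hs_inner A B = trace (dagger A ** B)"

definition hs_norm :: "complex^'i^'i \<Rightarrow> real"
  where "hs_norm A = sqrt (Re (hs_inner A A))"

section \<open>Linear operators on matrices (superoperators)\<close>

text \<open>Adjoints, positivity and pseudo-inverses of superoperators refer to the
  Hilbert-Schmidt inner product; the pseudo-inverse is the Moore-Penrose one.\<close>

definition clinear_op :: "(complex^'i^'i \<Rightarrow> complex^'i^'i) \<Rightarrow> bool"
  where "clinear_op T \<longleftrightarrow>
    (\<forall>A B. T (A + B) = T A + T B) \<and> (\<forall>a A. T (a \<cdot>\<^sub>m A) = a \<cdot>\<^sub>m T A)"

definition self_adjoint_op :: "(complex^'i^'i \<Rightarrow> complex^'i^'i) \<Rightarrow> bool"
  where "self_adjoint_op T \<longleftrightarrow>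
    clinear_op T \<and> (\<forall>A B. hs_inner (T A) B = hs_inner A (T B))"

definition psd_op :: "(complex^'i^'i \<Rightarrow> complex^'i^'i) \<Rightarrow> bool"
  where "psd_op T \<longleftrightarrow> self_adjoint_op T \<and> (\<forall>A. 0 \<le> Re (hs_inner A (T A)))"

definition op_sqrt :: "(complex^'i^'i \<Rightarrow> complex^'i^'i) \<Rightarrow> complex^'i^'i \<Rightarrow> complex^'i^'i"
  where "op_sqrt T = (THE S. psd_op S \<and> S \<circ> S = T)"

definition pinv_op :: "(complex^'i^'i \<Rightarrow> complex^'i^'i) \<Rightarrow> complex^'i^'i \<Rightarrow> complex^'i^'i"
  where "pinv_op T = (THE S. clinear_op S \<and> T \<circ> S \<circ> T = T \<and> S \<circ> T \<circ> S = S \<and>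
    self_adjoint_op (T \<circ> S) \<and> self_adjoint_op (S \<circ> T))"

definition Ad :: "complex^'i^'i \<Rightarrow> complex^'i^'i \<Rightarrow> complex^'i^'i"
  where "Ad C X = C ** X ** dagger C"

definition one_minus_Ad :: "complex^'i^'i \<Rightarrow> complex^'i^'i \<Rightarrow> complex^'i^'i"
  where "one_minus_Ad C X = X - Ad C X"

section \<open>Gaussian Fermionic states\<close>

text \<open>The modes are indexed by a finite type \<open>'n\<close>. The \<open>2n\<close> Majorana operators are indexed by
  \<open>'n + 'n\<close>: for the \<open>k\<close>-th mode, \<open>Inl k\<close> and \<open>Inr k\<close> stand for \<open>2k - 1\<close> and \<open>2k\<close>.\<close>

definition majorana :: "('n + 'n \<Rightarrow> complex^'d^'d) \<Rightarrow> bool"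
  where "majorana w \<longleftrightarrow> (\<forall>i. hermitian (w i)) \<and>
    (\<forall>i j. w i ** w j + w j ** w i = (if i = j then mat 2 else mat 0))"

definition rotated_majorana ::
    "('n::finite + 'n \<Rightarrow> complex^'d^'d) \<Rightarrow> real^('n + 'n)^('n + 'n) \<Rightarrow> 'n + 'n \<Rightarrow> complex^'d^'d"
  where "rotated_majorana w Q i = (\<Sum>j\<in>UNIV. complex_of_real (Q $ i $ j) \<cdot>\<^sub>m w j)"

definition gaussian_factor ::
    "('n::finite + 'n \<Rightarrow> complex^'d^'d) \<Rightarrow> real^('n + 'n)^('n + 'n) \<Rightarrow> ('n \<Rightarrow> real) \<Rightarrow> 'n \<Rightarrow> complex^'d^'d"
  where "gaussian_factor w Q c k = (1/2) \<cdot>\<^sub>m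
    (mat 1 - (\<i> * complex_of_real (c k)) \<cdot>\<^sub>m
      (rotated_majorana w Q (Inl k) ** rotated_majorana w Q (Inr k)))"

text \<open>For Majorana operators and orthogonal \<open>Q\<close> the factors commute, so that the fold is their
  product in an arbitrary order (\<open>prod\<close> is not available: \<open>*\<close> on matrices is entrywise).\<close>

definition gaussian_op ::
    "('n::finite + 'n \<Rightarrow> complex^'d^'d) \<Rightarrow> real^('n + 'n)^('n + 'n) \<Rightarrow> ('n \<Rightarrow> real) \<Rightarrow> complex^'d^'d"
  where "gaussian_op w Q c = Finite_Set.fold (\<lambda>k M. gaussian_factor w Q c k ** M) (mat 1) UNIV"

definition gaussian_state :: "('n::finite + 'n \<Rightarrow> complex^'d^'d) \<Rightarrow> complex^'d^'d \<Rightarrow> bool"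
  where "gaussian_state w \<rho> \<longleftrightarrow>
    (\<exists>Q c. orthogonal_matrix Q \<and> (\<forall>k. \<bar>c k\<bar> \<le> 1) \<and> \<rho> = gaussian_op w Q c)"

definition correlation_matrix ::
    "('n::finite + 'n \<Rightarrow> complex^'d^'d) \<Rightarrow> complex^'d^'d \<Rightarrow> complex^('n + 'n)^('n + 'n)"
  where "correlation_matrix w \<rho> = (\<chi> i j. (1/2) * trace (\<rho> ** (w i ** w j - w j ** w i)))"

definition state_of ::
    "('n::finite + 'n \<Rightarrow> complex^'d^'d) \<Rightarrow> complex^('n + 'n)^('n + 'n) \<Rightarrow> complex^'d^'d"
  where "state_of w C = (THE \<rho>. gaussian_state w \<rho> \<and> correlation_matrix w \<rho> = C)"

definition pure_state :: "complex^'d^'d \<Rightarrow> bool"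
  where "pure_state \<rho> \<longleftrightarrow> (\<exists>\<psi>. cinner \<psi> \<psi> = 1 \<and> \<rho> = ketbra \<psi> \<psi>)"

definition imaginary_antisymmetric :: "complex^'i^'i \<Rightarrow> bool"
  where "imaginary_antisymmetric D \<longleftrightarrow> transpose D = - D \<and> (\<forall>i j. Re (D $ i $ j) = 0)"

section \<open>Fidelity and Bures metric\<close>

definition fidelity :: "complex^'d^'d \<Rightarrow> complex^'d^'d \<Rightarrow> real"
  where "fidelity \<rho> \<sigma> = Re (trace (mat_sqrt (mat_sqrt \<rho> ** \<sigma> ** mat_sqrt \<rho>)))"

definition bures_sq :: "complex^'d^'d \<Rightarrow> complex^'d^'d \<Rightarrow> real"
  where "bures_sq \<rho> \<sigma> = 2 * (1 - fidelity \<rho> \<sigma>)"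

text \<open>The correlation matrices \<open>C + dC\<close> at which the metric around \<open>\<rho>\<close> is expanded. All Gaussian
  states are admitted if \<open>\<rho>\<close> has full rank. Otherwise the rank has to be kept: at the boundary of
  the set of states the fidelity is not quadratic in \<open>dC\<close> for rank-increasing variations. For
  instance, for one mode, \<open>c = 1\<close> and \<open>c + dc = 1 - t^2\<close> one has \<open>dC = O(t^2)\<close>, while
  \<open>16 (1 - F) = 4 t^2 + O(t^4)\<close>.\<close>

definition variations ::
    "('n::finite + 'n \<Rightarrow> complex^'d^'d) \<Rightarrow> complex^'d^'d \<Rightarrow> (complex^('n + 'n)^('n + 'n)) set"
  where "variations w \<rho> = {correlation_matrix w \<rho>' | \<rho>'. gaussian_state w \<rho>' \<and>
    (rank \<rho> < CARD('d) \<longrightarrow> rank \<rho>' = rank \<rho>)}"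

definition orthonormal_eigenbasis ::
    "complex^'i^'i \<Rightarrow> ('i \<Rightarrow> real) \<Rightarrow> ('i \<Rightarrow> complex^'i) \<Rightarrow> bool"
  where "orthonormal_eigenbasis C c b \<longleftrightarrow>
    (\<forall>r s. cinner (b r) (b s) = (if r = s then 1 else 0)) \<and>
    C = (\<Sum>r\<in>UNIV. complex_of_real (c r) \<cdot>\<^sub>m ketbra (b r) (b r))"

text \<open>\<open>A\<close> and \<open>B\<close> stand for two partial derivatives of \<open>C\<close>.\<close>

definition metric_coeff ::
    "('i \<Rightarrow> real) \<Rightarrow> ('i \<Rightarrow> complex^'i) \<Rightarrow> complex^'i^'i \<Rightarrow> complex^'i^'i \<Rightarrow> complex"
  where "metric_coeff c b A B = (\<Sum>(r, s) | c r * c s \<noteq> 1.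
    cinner (b r) (A *v b s) * cinner (b s) (B *v b r) / complex_of_real (1 - c r * c s))"

end

theory Submission
  imports Defs
begin

text \<open>A Gaussian state \<open>\<rho>\<close> is the only operator of trace one that satisfies
  \<open>[w\<^sub>i, \<rho>] + (\<Sum>j. C\<^sub>i\<^sub>j {w\<^sub>j, \<rho>}) = 0\<close> for all \<open>i\<close>. This relation is affine in \<open>C\<close> and can be solved to first
  order in \<open>dC\<close>: if \<open>K\<close> is antisymmetric with \<open>K - C K C = - dC / 2\<close> and \<open>m\<close> is \<open>(\<Sum>i j. K\<^sub>i\<^sub>j w\<^sub>i w\<^sub>j) / 2\<close> up to
  a constant, then \<open>d\<rho> = m \<rho> + \<rho> m\<close> up to second order. For every such \<open>m\<close>, and as long as the rank
  does not increase, \<open>2 (1 - F(\<rho>, \<rho> + d\<rho>)) = tr (m \<rho> m)\<close> up to third order, and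
  \<open>8 tr (m \<rho> m) = - 2 tr (K dC) = tr (dC (1 - Ad\<^sub>C)\<^sup>-\<^sup>1 dC)\<close>.

  All of this requires that \<open>dC\<close> lies in the range of \<open>1 - Ad\<^sub>C\<close>. Its component in the kernel
  consists of expectation values of operators \<open>X Y\<^sup>\<dagger>\<close> with \<open>X\<^sup>\<dagger> \<rho> = Y\<^sup>\<dagger> \<rho> = 0\<close>, which are of second order
  because the rank is constant.\<close>

section \<open>Matrix algebra\<close>

text \<open>The parameters \<open>Q\<close>, \<open>c\<close> of a Gaussian state are not unique and
  cannot in general be chosen smoothly in \<open>C\<close> where eigenvalues coincide, so nothing is
  differentiated along them. The relation takes their place: on traceless operators it defines an
  injective linear map, which is bounded below in finite dimension, and estimates on states are
  checked after applying that map. In the same spirit the matrix square root is never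
  differentiated, since it is not differentiable at singular operators: its increment solves a
  quadratic equation, and the trace of that equation against the increment bounds it. Constants:
  \<open>K - C K C\<close> enters the relation of \<open>m \<rho> + \<rho> m\<close> with a factor
  2, while \<open>d\<rho>\<close> asks for \<open>- dC\<close>; hence the \<open>- dC / 2\<close>.
  The 8 is 2, from \<open>tr (m d\<rho>) = 2 tr (m \<rho> m)\<close>, times 4, from writing a
  quadratic expression with coefficients \<open>K / 2\<close> through commutators. Errors are
  counted in powers of the norm of \<open>dC\<close> along an arbitrary filter, so that one
  expansion covers all variations as well as parametrized families.\<close>

lemma matrix_diff_ldistrib: "A ** (B - C) = A ** B - A ** (C :: 'a::ring_1^'n^'m)"
  by (simp add: vec_eq_iff matrix_matrix_mult_def sum_subtractf right_diff_distrib)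

lemma matrix_diff_rdistrib: "(A - B) ** C = A ** C - B ** (C :: 'a::ring_1^'n^'m)"
  by (simp add: vec_eq_iff matrix_matrix_mult_def sum_subtractf left_diff_distrib)

lemma matrix_minus_left: "(- A) ** B = - (A ** (B :: 'a::ring_1^'n^'m))"
  by (simp add: vec_eq_iff matrix_matrix_mult_def sum_negf)

lemma matrix_minus_right: "A ** (- B) = - (A ** (B :: 'a::ring_1^'n^'m))"
  by (simp add: vec_eq_iff matrix_matrix_mult_def sum_negf)

lemma matrix_add_rdistrib: "(A + B) ** C = A ** C + B ** (C :: 'a::ring_1^'n^'m)"
  by (simp add: vec_eq_iff matrix_matrix_mult_def sum.distrib distrib_right)

lemma matrix_zero_left: "0 ** B = (0 :: 'a::ring_1^'n^'m)"
  by (simp add: vec_eq_iff matrix_matrix_mult_def)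

lemma matrix_zero_right: "A ** 0 = (0 :: 'a::ring_1^'n^'m)"
  by (simp add: vec_eq_iff matrix_matrix_mult_def)

lemma matrix_sum_left: "(\<Sum>i\<in>I. f i) ** B = (\<Sum>i\<in>I. f i ** (B :: 'a::ring_1^'n^'m))"
  by (induction I rule: infinite_finite_induct) (auto simp: matrix_add_rdistrib matrix_zero_left)

lemma matrix_sum_right: "A ** (\<Sum>i\<in>I. f i) = (\<Sum>i\<in>I. A ** (f i :: 'a::ring_1^'n^'m))"
  by (induction I rule: infinite_finite_induct) (auto simp: matrix_add_ldistrib matrix_zero_right)

lemma scale_mat_mult_left: "(a \<cdot>\<^sub>m A) ** B = a \<cdot>\<^sub>m (A ** B)"
  by (simp add: scale_mat_def vec_eq_iff matrix_matrix_mult_def sum_distrib_left mult.assoc)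

lemma scale_mat_mult_right: "A ** (a \<cdot>\<^sub>m B) = a \<cdot>\<^sub>m (A ** B)"
  by (simp add: scale_mat_def vec_eq_iff matrix_matrix_mult_def sum_distrib_left algebra_simps)

lemma scale_mat_add_right: "a \<cdot>\<^sub>m (A + B) = a \<cdot>\<^sub>m A + a \<cdot>\<^sub>m B"
  by (simp add: scale_mat_def vec_eq_iff algebra_simps)

lemma scale_mat_diff_right: "a \<cdot>\<^sub>m (A - B) = a \<cdot>\<^sub>m A - a \<cdot>\<^sub>m B"
  by (simp add: scale_mat_def vec_eq_iff algebra_simps)

lemma scale_mat_minus_right: "a \<cdot>\<^sub>m (- A) = - (a \<cdot>\<^sub>m A)"
  by (simp add: scale_mat_def vec_eq_iff)

lemma scale_mat_sum_right: "a \<cdot>\<^sub>m (\<Sum>i\<in>I. f i) = (\<Sum>i\<in>I. a \<cdot>\<^sub>m f i)"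
  by (simp add: scale_mat_def vec_eq_iff sum_distrib_left)

lemma scale_mat_add_left: "(a + b) \<cdot>\<^sub>m A = a \<cdot>\<^sub>m A + b \<cdot>\<^sub>m A"
  by (simp add: scale_mat_def vec_eq_iff algebra_simps)

lemma scale_mat_diff_left: "(a - b) \<cdot>\<^sub>m A = a \<cdot>\<^sub>m A - b \<cdot>\<^sub>m A"
  by (simp add: scale_mat_def vec_eq_iff algebra_simps)

lemma scale_mat_minus_left: "(- a) \<cdot>\<^sub>m A = - (a \<cdot>\<^sub>m A)"
  by (simp add: scale_mat_def vec_eq_iff)

lemma scale_mat_sum_left: "(\<Sum>i\<in>I. f i) \<cdot>\<^sub>m A = (\<Sum>i\<in>I. f i \<cdot>\<^sub>m A)"
  by (simp add: scale_mat_def vec_eq_iff sum_distrib_right)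

lemma scale_mat_smult: "a \<cdot>\<^sub>m b \<cdot>\<^sub>m A = (a * b) \<cdot>\<^sub>m A"
  by (simp add: scale_mat_def vec_eq_iff mult.assoc)

lemma scale_mat_one [simp]: "1 \<cdot>\<^sub>m A = A"
  by (simp add: scale_mat_def vec_eq_iff)

lemma scale_mat_zero_left [simp]: "0 \<cdot>\<^sub>m A = 0"
  by (simp add: scale_mat_def vec_eq_iff)

lemma scale_mat_zero_right [simp]: "a \<cdot>\<^sub>m 0 = 0"
  by (simp add: scale_mat_def vec_eq_iff)

lemma scaleR_eq_smult: "(r *\<^sub>R A :: complex^'n^'m) = complex_of_real r \<cdot>\<^sub>m A"
  by (simp add: scale_mat_def vec_eq_iff) (simp add: scaleR_conv_of_real)

lemma scale_mat_entry: "(a \<cdot>\<^sub>m A) $ i $ j = a * A $ i $ j"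
  by (simp add: scale_mat_def)

lemmas matrix_ring = matrix_add_ldistrib matrix_add_rdistrib matrix_diff_ldistrib
  matrix_diff_rdistrib matrix_minus_left matrix_minus_right matrix_zero_left matrix_zero_right
  matrix_mul_assoc

lemmas matrix_sum_alg = matrix_sum_left matrix_sum_right scale_mat_mult_left scale_mat_mult_right

lemmas matrix_alg = matrix_ring scale_mat_mult_left scale_mat_mult_right scale_mat_add_right
  scale_mat_diff_right scale_mat_minus_right scale_mat_smult

lemma dagger_mult: "dagger (A ** B) = dagger B ** dagger A"
  by (simp add: dagger_def vec_eq_iff matrix_matrix_mult_def mult.commute)

lemma dagger_dagger [simp]: "dagger (dagger A) = A"
  by (simp add: dagger_def vec_eq_iff)

lemma dagger_add: "dagger (A + B) = dagger A + dagger B"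
  by (simp add: dagger_def vec_eq_iff)

lemma dagger_diff: "dagger (A - B) = dagger A - dagger B"
  by (simp add: dagger_def vec_eq_iff)

lemma dagger_smult: "dagger (a \<cdot>\<^sub>m A) = cnj a \<cdot>\<^sub>m dagger A"
  by (simp add: dagger_def scale_mat_def vec_eq_iff)

lemma dagger_sum: "dagger (\<Sum>i\<in>I. f i) = (\<Sum>i\<in>I. dagger (f i))"
  by (simp add: dagger_def vec_eq_iff)

lemma dagger_one [simp]: "dagger (mat 1) = mat 1"
  by (simp add: dagger_def vec_eq_iff mat_def)

lemma dagger_zero [simp]: "dagger 0 = 0"
  by (simp add: dagger_def vec_eq_iff)

lemma dagger_entry: "dagger A $ i $ j = cnj (A $ j $ i)"
  by (simp add: dagger_def)

lemma hermitianD: "hermitian A \<Longrightarrow> dagger A = A"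
  by (simp add: hermitian_def)

lemma trace_smult: "trace (a \<cdot>\<^sub>m A) = a * trace A"
  by (simp add: trace_def scale_mat_def sum_distrib_left)

lemma trace_minus: "trace (- A) = - trace (A :: complex^'n^'n)"
  by (simp add: trace_def sum_negf)

lemma trace_zero [simp]: "trace (0 :: complex^'n^'n) = 0"
  by (simp add: trace_def)

lemma trace_sum: "trace (\<Sum>i\<in>I. f i) = (\<Sum>i\<in>I. trace (f i :: complex^'n^'n))"
  by (induction I rule: infinite_finite_induct) (auto simp: trace_add)

lemma trace_dagger: "trace (dagger A) = cnj (trace A)"
  by (simp add: trace_def dagger_def)

lemmas trace_alg = trace_add trace_sub trace_minus trace_smult

section \<open>The Hilbert-Schmidt inner product and its norm\<close>

lemma trace_mult_entries: "trace (A ** B) = (\<Sum>i\<in>UNIV. \<Sum>j\<in>UNIV. A $ i $ j * B $ j $ i)"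
  by (simp add: trace_def matrix_matrix_mult_def)

lemma hs_inner_entries: "hs_inner A B = (\<Sum>i\<in>UNIV. \<Sum>j\<in>UNIV. cnj (A $ i $ j) * B $ i $ j)"
  unfolding hs_inner_def trace_mult_entries dagger_entry by (rule sum.swap)

lemma inner_matrix: "inner A B = Re (hs_inner A B)"
  by (simp add: hs_inner_entries inner_vec_def inner_complex_def)

text \<open>The norm that the vector types carry is the Hilbert-Schmidt norm, so limits and
  boundedness from analysis apply to matrices as they are.\<close>

lemma hs_norm_eq: "hs_norm A = norm A"
  by (simp add: hs_norm_def norm_eq_sqrt_inner inner_matrix)

lemma norm_matrix_sq: "(norm A)\<^sup>2 = Re (trace (dagger A ** (A :: complex^'n^'n)))"
  by (simp add: power2_norm_eq_inner inner_matrix hs_inner_def)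

lemma norm_matrix_sq_entries: "(norm (A :: complex^'n^'n))\<^sup>2 = (\<Sum>i\<in>UNIV. \<Sum>j\<in>UNIV. (cmod (A $ i $ j))\<^sup>2)"
  by (simp add: norm_vec_def L2_set_def sum_nonneg)

lemma norm_dagger [simp]: "norm (dagger A) = norm (A :: complex^'n^'n)"
proof -
  have "(norm (dagger A))\<^sup>2 = (norm A)\<^sup>2"
    unfolding norm_matrix_sq_entries dagger_entry complex_mod_cnj by (rule sum.swap)
  then show ?thesis by simp
qed

lemma cnj_mult_self: "cnj z * z = (complex_of_real (cmod z))\<^sup>2"
  by (metis complex_norm_square mult.commute of_real_power)

lemma hs_inner_norm: "hs_inner A A = complex_of_real ((norm A)\<^sup>2)"
  by (simp add: norm_matrix_sq_entries hs_inner_entries cnj_mult_self)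

lemma abs_Re_trace_le: "\<bar>Re (trace (A ** B))\<bar> \<le> norm A * norm (B :: complex^'n^'n)"
  using Cauchy_Schwarz_ineq2[of "dagger A" B] by (simp add: inner_matrix hs_inner_def)

text \<open>Cauchy-Schwarz between row \<open>i\<close> of \<open>A\<close> and column
  \<open>j\<close> of \<open>B\<close> bounds each entry, and the sum of the squared bounds
  factorizes.\<close>

lemma norm_matrix_mult:
  fixes A B :: "complex^'n^'n"
  shows "norm (A ** B) \<le> norm A * norm B"
proof -
  have *: "(cmod ((A ** B) $ i $ j))\<^sup>2 \<le> (norm (A $ i))\<^sup>2 * (norm (column j B))\<^sup>2" for i j
  proof -
    have "cmod ((A ** B) $ i $ j) \<le> (\<Sum>k\<in>UNIV. cmod (A $ i $ k) * cmod (B $ k $ j))"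
      unfolding matrix_matrix_mult_def by (auto simp: norm_mult intro!: sum_norm_le)
    also have "\<dots> \<le> norm (A $ i) * norm (column j B)"
      using L2_set_mult_ineq[of "\<lambda>k. cmod (A $ i $ k)" "\<lambda>k. cmod (B $ k $ j)" UNIV]
      by (simp add: norm_vec_def column_def)
    finally show ?thesis
      by (metis norm_ge_zero power_mono power_mult_distrib)
  qed
  have "(norm (A ** B))\<^sup>2 \<le> (\<Sum>i\<in>UNIV. \<Sum>j\<in>UNIV. (norm (A $ i))\<^sup>2 * (norm (column j B))\<^sup>2)"
    unfolding norm_matrix_sq_entries by (intro sum_mono *)
  also have "\<dots> = (\<Sum>i\<in>UNIV. (norm (A $ i))\<^sup>2) * (\<Sum>j\<in>UNIV. (norm (column j B))\<^sup>2)"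
    by (simp add: sum_product)
  also have "(\<Sum>j\<in>UNIV. (norm (column j B))\<^sup>2) = (norm B)\<^sup>2"
    unfolding norm_matrix_sq_entries
    by (subst sum.swap) (simp add: norm_vec_def L2_set_def sum_nonneg column_def)
  also have "(\<Sum>i\<in>UNIV. (norm (A $ i))\<^sup>2) = (norm A)\<^sup>2"
    by (simp add: norm_matrix_sq_entries norm_vec_def L2_set_def sum_nonneg)
  finally have "(norm (A ** B))\<^sup>2 \<le> (norm A * norm B)\<^sup>2"
    by (simp add: power_mult_distrib)
  then show ?thesis
    by (rule power2_le_imp_le) simp
qed

lemma bounded_linear_trace: "bounded_linear (trace :: complex^'n^'n \<Rightarrow> complex)"
  unfolding linear_conv_bounded_linear[symmetric]
  by (rule linearI) (simp_all add: trace_add scaleR_eq_smult trace_smult scaleR_conv_of_real)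

section \<open>Positive semidefinite matrices\<close>

lemma cinner_mult_right: "cinner x (A *v y) = cinner (dagger A *v x) y"
proof -
  have "cinner x (A *v y) = (\<Sum>i\<in>UNIV. \<Sum>j\<in>UNIV. cnj (x $ i) * (A $ i $ j * y $ j))"
    by (simp add: cinner_def matrix_vector_mult_def sum_distrib_left)
  also have "\<dots> = (\<Sum>j\<in>UNIV. \<Sum>i\<in>UNIV. cnj (x $ i) * (A $ i $ j * y $ j))"
    by (rule sum.swap)
  also have "\<dots> = cinner (dagger A *v x) y"
    by (simp add: cinner_def matrix_vector_mult_def sum_distrib_left dagger_def algebra_simps)
  finally show ?thesis .
qed

lemma cinner_self: "cinner x x = complex_of_real ((norm x)\<^sup>2)"
  by (simp add: cinner_def norm_vec_def L2_set_def sum_nonneg cnj_mult_self)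

lemma cinner_smult_right: "cinner x (a *s y) = a * cinner x y"
  by (simp add: cinner_def sum_distrib_left algebra_simps)

lemma cinner_smult_left: "cinner (a *s x) y = cnj a * cinner x y"
  by (simp add: cinner_def sum_distrib_left algebra_simps)

lemma cinner_add_right: "cinner x (y + z) = cinner x y + cinner x z"
  by (simp add: cinner_def sum.distrib algebra_simps)

lemma cnj_cinner: "cnj (cinner x y) = cinner y x"
  by (simp add: cinner_def mult.commute)

lemma inner_eq_cinner: "inner x y = Re (cinner x y)"
  by (simp add: cinner_def inner_vec_def inner_complex_def)

lemma psd_hermitian: "psd A \<Longrightarrow> hermitian A"
  by (simp add: psd_def)

lemma psd_conj: assumes "psd A" shows "psd (dagger X ** A ** X)"
proof -
  have "cinner x (dagger X ** A ** X *v x) = cinner (X *v x) (A *v (X *v x))" for x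
    by (simp add: cinner_mult_right[of x "dagger X"] matrix_vector_mul_assoc[symmetric])
  then show ?thesis
    using assms by (simp add: psd_def hermitian_def dagger_mult matrix_mul_assoc)
qed

lemma psd_one: "psd (mat 1)"
  by (simp add: psd_def hermitian_def cinner_self)

lemma psd_dagger_mult: "psd (dagger X ** X)"
  using psd_conj[OF psd_one, of X] by simp

lemma psd_square: "hermitian X \<Longrightarrow> psd (X ** X)"
  using psd_dagger_mult[of X] by (simp add: hermitian_def)

lemma cinner_axis: "cinner (axis i 1) y = y $ i"
proof -
  have "cnj (axis i 1 $ j) * y $ j = (if j = i then y $ j else 0)" for j
    by (simp add: axis_def)
  then show ?thesis by (simp add: cinner_def)
qed

lemma psd_trace: assumes "psd A" shows "0 \<le> Re (trace A)"
proof -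
  have "0 \<le> Re (A $ i $ i)" for i
  proof -
    have "A $ i $ j * axis i 1 $ j = (if j = i then A $ i $ j else 0)" for j
      by (simp add: axis_def)
    then have "cinner (axis i 1) (A *v axis i 1) = A $ i $ i"
      by (simp add: cinner_axis matrix_vector_mult_def)
    then show ?thesis using assms unfolding psd_def by metis
  qed
  then show ?thesis by (simp add: trace_def sum_nonneg)
qed

lemma psd_trace_sandwich: "psd A \<Longrightarrow> hermitian N \<Longrightarrow> 0 \<le> Re (trace (N ** A ** N))"
  using psd_trace[OF psd_conj, of A N] by (simp add: hermitian_def)

section \<open>The spectral theorem\<close>

definition diag :: "('i \<Rightarrow> complex) \<Rightarrow> complex^'i^'i"
  where "diag f = (\<chi> i j. if i = j then f i else 0)"

definition unitary :: "complex^'i^'i \<Rightarrow> bool"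
  where "unitary U \<longleftrightarrow> dagger U ** U = mat 1"

definition spectral_fun :: "complex^'i^'i \<Rightarrow> ('i \<Rightarrow> real) \<Rightarrow> complex^'i^'i"
  where "spectral_fun U f = U ** diag (\<lambda>r. complex_of_real (f r)) ** dagger U"

lemma unitaryD: assumes "unitary U" shows "dagger U ** U = mat 1" "U ** dagger U = mat 1"
  using assms matrix_left_right_inverse[of "dagger U" U] by (simp_all add: unitary_def)

lemma diag_mult: "diag f ** diag g = diag (\<lambda>r. f r * g r)"
proof -
  have "(if i = k then f i else 0) * (if k = j then g k else 0)
    = (if k = i then if i = j then f i * g i else 0 else 0)" for i j k by auto
  then show ?thesis by (simp add: diag_def vec_eq_iff matrix_matrix_mult_def)
qed

lemma spectral_fun_mult:
  assumes "unitary U"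
  shows "spectral_fun U f ** spectral_fun U g = spectral_fun U (\<lambda>r. f r * g r)"
proof -
  have "spectral_fun U f ** spectral_fun U g
    = U ** diag (\<lambda>r. complex_of_real (f r)) ** (dagger U ** U) ** diag (\<lambda>r. complex_of_real (g r)) ** dagger U"
    by (simp add: spectral_fun_def matrix_mul_assoc)
  also have "\<dots> = U ** (diag (\<lambda>r. complex_of_real (f r)) ** diag (\<lambda>r. complex_of_real (g r))) ** dagger U"
    by (simp add: unitaryD[OF assms] matrix_mul_assoc)
  finally show ?thesis by (simp add: spectral_fun_def diag_mult)
qed

lemma spectral_fun_hermitian: "hermitian (spectral_fun U f)"
proof -
  have "dagger (diag (\<lambda>r. complex_of_real (f r))) = diag (\<lambda>r. complex_of_real (f r))"
    by (auto simp: dagger_def diag_def vec_eq_iff)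
  then show ?thesis by (simp add: hermitian_def spectral_fun_def dagger_mult matrix_mul_assoc)
qed

lemma spectral_fun_psd:
  assumes "unitary U" "\<And>r. 0 \<le> f r"
  shows "psd (spectral_fun U f)"
proof -
  have "spectral_fun U f = spectral_fun U (\<lambda>r. sqrt (f r)) ** spectral_fun U (\<lambda>r. sqrt (f r))"
    by (simp add: spectral_fun_mult assms)
  then show ?thesis by (simp add: psd_square spectral_fun_hermitian)
qed

lemma matrix_vector_mul_scaleR: "A *v (r *\<^sub>R x) = r *\<^sub>R (A *v (x :: complex^'n))"
  by (rule linear_cmul) simp

text \<open>The invariant subspace drives the later induction, where it is the orthogonal complement
  of the eigenvectors found so far. It is a subspace over the reals, since the argument scales
  vectors by reals only.\<close>

lemma hermitian_eigenvector:
  fixes A :: "complex^'i^'i"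
  assumes A: "hermitian A" and U: "subspace U" "\<And>x. x \<in> U \<Longrightarrow> A *v x \<in> U" "x0 \<in> U" "x0 \<noteq> 0"
  shows "\<exists>v\<in>U. norm v = 1 \<and> (\<exists>c. A *v v = complex_of_real c *s v)"
proof -
  have sym: "inner x (A *v y) = inner (A *v x) y" for x y
    using A by (simp add: inner_eq_cinner cinner_mult_right hermitian_def)
  have "compact (sphere 0 1 \<inter> U)"
    using closed_subspace[OF U(1)] by (rule compact_Int_closed[OF compact_sphere])
  moreover have "sgn x0 \<in> sphere 0 1 \<inter> U"
    using U by (simp add: norm_sgn sgn_div_norm subspace_scale)
  moreover have lin: "linear (\<lambda>x. A *v x)" by simp
  then have "continuous_on (sphere 0 1 \<inter> U) (\<lambda>x. inner x (A *v x))"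
    by (intro continuous_intros linear_continuous_on) (simp add: linear_linear)
  \<comment> \<open>The maximizer of the Rayleigh quotient is an eigenvector: the form of \<open>c - A\<close> is positive on
    \<open>U\<close> and vanishes at \<open>v\<close>.\<close>
  ultimately obtain v where v: "v \<in> sphere 0 1 \<inter> U"
    and max: "\<And>y. y \<in> sphere 0 1 \<inter> U \<Longrightarrow> inner y (A *v y) \<le> inner v (A *v v)"
    using continuous_attains_sup[of "sphere 0 1 \<inter> U" "\<lambda>x. inner x (A *v x)"] by blast
  define c where "c = inner v (A *v v)"
  define B where "B x = c *\<^sub>R x - A *v x" for x
  have Bpos: "0 \<le> inner y (B y)" if "y \<in> U" for y
  proof (cases "y = 0")
    case False
    have "inner (sgn y) (A *v sgn y) \<le> c"
      unfolding c_def using that False U(1) by (intro max) (auto simp: norm_sgn sgn_div_norm subspace_scale)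
    then have "inner y (A *v y) \<le> c * (norm y)\<^sup>2"
      using False by (simp add: sgn_div_norm matrix_vector_mul_scaleR divide_simps power2_eq_square)
    then show ?thesis by (simp add: B_def inner_diff_right power2_norm_eq_inner)
  qed (simp add: B_def)
  have Bsym: "inner x (B y) = inner (B x) y" for x y
    by (simp add: B_def inner_diff_right inner_diff_left sym)
  have Badd: "B (x + y) = B x + B y" and Bsc: "B (t *\<^sub>R x) = t *\<^sub>R B x" for x y t
    by (simp_all add: B_def algebra_simps matrix_vector_mul_scaleR)
  have vv: "inner v v = 1" using v by (simp add: norm_eq_1)
  have Bv0: "inner v (B v) = 0" by (simp add: B_def inner_diff_right vv c_def)
  have BvU: "B v \<in> U" using v U by (auto simp: B_def intro!: subspace_diff subspace_scale)
  define a where "a = inner (B v) (B v)"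
  define \<beta> where "\<beta> = inner (B v) (B (B v))"
  have \<beta>: "0 \<le> \<beta>" unfolding \<beta>_def by (rule Bpos[OF BvU])
  \<comment> \<open>Positivity of the form of \<open>B\<close> at
    \<open>v + t *\<^sub>R B v\<close>. The constant term \<open>inner v (B v)\<close> is zero, so a
    nonzero linear coefficient \<open>a\<close> would make the form negative for small
    \<open>t\<close> of the opposite sign.\<close>
  have q: "0 \<le> 2 * t * a + t\<^sup>2 * \<beta>" for t
  proof -
    have "v + t *\<^sub>R B v \<in> U" using v BvU U(1) by (auto intro!: subspace_add subspace_scale)
    from Bpos[OF this] show ?thesis
      by (simp add: Badd Bsc inner_add_left inner_add_right Bv0 Bsym[of v "B v"] a_def \<beta>_def
          power2_eq_square algebra_simps)
  qed
  have "a = 0"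
  proof (rule ccontr)
    assume "a \<noteq> 0"
    have "2 * (- a / (\<beta> + 1)) * a + (- a / (\<beta> + 1))\<^sup>2 * \<beta> = - (a\<^sup>2 * (\<beta> + 2)) / (\<beta> + 1)\<^sup>2"
      using \<beta> by (simp add: divide_simps power2_eq_square) (simp add: algebra_simps)
    also have "\<dots> < 0" using \<beta> \<open>a \<noteq> 0\<close> by simp
    finally show False using q[of "- a / (\<beta> + 1)"] by linarith
  qed
  moreover have "c *\<^sub>R v = complex_of_real c *s v"
    by (simp add: vec_eq_iff) (simp add: scaleR_conv_of_real)
  ultimately have "A *v v = complex_of_real c *s v"
    by (simp add: a_def B_def)
  then show ?thesis using v by auto
qed

text \<open>The square matrix with rows \<open>cnj (b s)\<close> for \<open>s \<in> S\<close> and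
  zero rows elsewhere is singular, and its kernel vectors are orthogonal to the family.\<close>

lemma exists_orthogonal_to_family:
  fixes b :: "'i \<Rightarrow> complex^'i"
  assumes "r \<notin> S"
  shows "\<exists>x. x \<noteq> 0 \<and> (\<forall>s\<in>S. cinner (b s) x = 0)"
proof -
  define N :: "complex^'i^'i" where "N = (\<chi> s i. if s \<in> S then cnj (b s $ i) else 0)"
  have "det N = 0"
    by (rule det_zero_row[of r]) (simp add: N_def row_def vec_eq_iff assms)
  then have "\<not> (\<exists>B. B ** N = mat 1)"
    using invertible_det_nz[of N] matrix_left_right_inverse unfolding invertible_def by blast
  then obtain x where x: "N *v x = 0" "x \<noteq> 0"
    unfolding matrix_left_invertible_ker by blast
  have "cinner (b s) x = (N *v x) $ s" if "s \<in> S" for s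
    using that by (simp add: N_def cinner_def matrix_vector_mult_def)
  then show ?thesis using x by auto
qed

text \<open>Induction on the index set: the next eigenvector is taken from the orthogonal complement
  of the previous ones, which a hermitian \<open>A\<close> preserves and which is nonzero as long as
  an index is left.\<close>

lemma hermitian_orthonormal_eigenvectors:
  fixes A :: "complex^'i^'i"
  assumes A: "hermitian A"
  shows "finite (S :: 'i set) \<Longrightarrow> \<exists>b c. (\<forall>r\<in>S. \<forall>s\<in>S. cinner (b r) (b s) = (if r = s then 1 else 0)) \<and>
    (\<forall>r\<in>S. A *v b r = complex_of_real (c r) *s b r)"
proof (induction S rule: finite_induct)
  case (insert r S)
  then obtain b c where b: "\<And>r s. r \<in> S \<Longrightarrow> s \<in> S \<Longrightarrow> cinner (b r) (b s) = (if r = s then 1 else 0)"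
    and c: "\<And>r. r \<in> S \<Longrightarrow> A *v b r = complex_of_real (c r) *s b r" by blast
  define U where "U = {x. \<forall>s\<in>S. cinner (b s) x = 0}"
  have "subspace U"
    by (auto simp: U_def subspace_def cinner_add_right cinner_smult_right scaleR_vec_def
        simp flip: scalar_mult_eq_scaleR) (simp_all add: cinner_def scaleR_conv_of_real sum_distrib_left[symmetric] mult.left_commute)
  moreover have "A *v x \<in> U" if "x \<in> U" for x
    using that A by (auto simp: U_def cinner_mult_right hermitian_def c cinner_smult_left)
  moreover obtain x0 where "x0 \<in> U" "x0 \<noteq> 0"
    using exists_orthogonal_to_family[OF insert.hyps(2), of b] by (auto simp: U_def)
  ultimately obtain v d where v: "v \<in> U" "norm v = 1" "A *v v = complex_of_real d *s v"
    using hermitian_eigenvector[OF A] by metis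
  have "cinner v (b s) = 0" if "s \<in> S" for s
    using v(1) that cnj_cinner[of "b s" v] by (auto simp: U_def)
  moreover have "cinner v v = 1" using v(2) by (simp add: cinner_self)
  ultimately show ?case
    using v b c insert.hyps
    by (intro exI[of _ "b(r := v)"] exI[of _ "c(r := d)"]) (auto simp: U_def)
qed simp

definition basis_matrix :: "('i \<Rightarrow> complex^'i) \<Rightarrow> complex^'i^'i"
  where "basis_matrix b = (\<chi> i r. b r $ i)"

lemma orthonormal_eigenbasis_iff:
  "orthonormal_eigenbasis A c b \<longleftrightarrow> unitary (basis_matrix b) \<and> A = spectral_fun (basis_matrix b) c"
proof -
  have 1: "dagger (basis_matrix b) ** basis_matrix b = (\<chi> r s. cinner (b r) (b s))"
    by (simp add: basis_matrix_def dagger_def matrix_matrix_mult_def cinner_def)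
  have 2: "spectral_fun (basis_matrix b) c = (\<Sum>r\<in>UNIV. complex_of_real (c r) \<cdot>\<^sub>m ketbra (b r) (b r))"
    by (simp add: spectral_fun_def basis_matrix_def dagger_def matrix_matrix_mult_def diag_def
        scale_mat_def ketbra_def vec_eq_iff if_distrib if_distribR mult.commute mult.left_commute cong: if_cong)
  show ?thesis
    unfolding orthonormal_eigenbasis_def unitary_def 1 2 by (auto simp: vec_eq_iff mat_def)
qed

lemma unitary_conj_entry:
  "(dagger (basis_matrix b) ** X ** basis_matrix b) $ r $ s = cinner (b r) (X *v b s)"
  by (simp add: cinner_mult_right)
     (simp add: basis_matrix_def dagger_def matrix_matrix_mult_def cinner_def matrix_vector_mult_def mult.commute)

theorem spectral_theorem:
  fixes A :: "complex^'i^'i"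
  assumes "hermitian A"
  shows "\<exists>c b. orthonormal_eigenbasis A c b"
proof -
  obtain b :: "'i \<Rightarrow> complex^'i" and c where b: "\<And>r s. cinner (b r) (b s) = (if r = s then 1 else 0)"
    and c: "\<And>r. A *v b r = complex_of_real (c r) *s b r"
    using hermitian_orthonormal_eigenvectors[OF assms finite_class.finite_UNIV] by (metis UNIV_I)
  let ?U = "basis_matrix b"
  have u: "unitary ?U"
    by (simp add: unitary_def basis_matrix_def dagger_def matrix_matrix_mult_def vec_eq_iff mat_def
        b[unfolded cinner_def])
  have "A ** ?U = ?U ** diag (\<lambda>r. complex_of_real (c r))"
    using c by (simp add: vec_eq_iff basis_matrix_def matrix_matrix_mult_def matrix_vector_mult_def
        diag_def if_distrib if_distribR mult.commute cong: if_cong)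
  then have "A ** (?U ** dagger ?U) = spectral_fun ?U c"
    by (simp add: spectral_fun_def matrix_mul_assoc)
  then show ?thesis
    using u by (auto simp: orthonormal_eigenbasis_iff unitaryD)
qed

lemma psd_eigenvalues:
  assumes "psd A" "orthonormal_eigenbasis A c b"
  shows "0 \<le> c r"
proof -
  let ?U = "basis_matrix b"
  have u: "unitary ?U" and A: "A = spectral_fun ?U c"
    using assms(2) by (auto simp: orthonormal_eigenbasis_iff)
  have "dagger ?U ** A ** ?U = (dagger ?U ** ?U) ** diag (\<lambda>r. complex_of_real (c r)) ** (dagger ?U ** ?U)"
    by (simp add: A spectral_fun_def matrix_mul_assoc)
  then have "cinner (b r) (A *v b r) = complex_of_real (c r)"
    by (simp add: unitaryD[OF u] diag_def flip: unitary_conj_entry)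
  then show ?thesis using assms(1) unfolding psd_def by (metis Re_complex_of_real)
qed

section \<open>Square roots\<close>

text \<open>\<open>V\<close> is the Moore-Penrose inverse of the root \<open>T\<close>. These
  identities stand in for the eigendecomposition of a possibly singular density matrix:
  \<open>T ** V\<close> is its support projection and \<open>V ** V\<close> its
  pseudo-inverse.\<close>

lemma psd_root_and_pinv:
  assumes "psd A"
  shows "\<exists>T V. psd T \<and> hermitian V \<and> T ** T = A \<and> T ** V = V ** T \<and> T ** V ** T = T \<and> V ** T ** V = V"
proof -
  obtain c b where cb: "orthonormal_eigenbasis A c b"
    using spectral_theorem psd_hermitian assms by blast
  let ?U = "basis_matrix b"
  have u: "unitary ?U" and A: "A = spectral_fun ?U c"
    using cb by (auto simp: orthonormal_eigenbasis_iff)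
  have c: "0 \<le> c r" for r using psd_eigenvalues[OF assms cb] .
  define T where "T = spectral_fun ?U (\<lambda>r. sqrt (c r))"
  \<comment> \<open>The convention \<open>inverse 0 = 0\<close> turns this into the
    pseudo-inverse.\<close>
  define V where "V = spectral_fun ?U (\<lambda>r. inverse (sqrt (c r)))"
  have "T ** T = A" by (simp add: T_def A spectral_fun_mult[OF u] c)
  moreover have "T ** V = V ** T"
    by (simp add: T_def V_def spectral_fun_mult[OF u] mult.commute)
  moreover have "T ** V ** T = T"
    unfolding T_def V_def spectral_fun_mult[OF u]
    by (rule arg_cong[of _ _ "spectral_fun ?U"]) (auto simp: fun_eq_iff field_simps)
  moreover have "V ** T ** V = V"
    unfolding T_def V_def spectral_fun_mult[OF u]
    by (rule arg_cong[of _ _ "spectral_fun ?U"]) (auto simp: fun_eq_iff field_simps)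
  moreover have "psd T" "hermitian V"
    by (simp_all add: T_def V_def spectral_fun_psd[OF u] spectral_fun_hermitian c)
  ultimately show ?thesis by blast
qed

lemma norm_eq_0_of_trace: "Re (trace (dagger X ** X)) = 0 \<Longrightarrow> X = (0 :: complex^'n^'n)"
  by (simp flip: norm_matrix_sq)

text \<open>Through the root \<open>T\<close> of \<open>B\<close> the trace is the squared norm of
  \<open>T ** N\<close>.\<close>

lemma psd_sandwich_zero:
  assumes B: "psd B" and N: "hermitian N" and 0: "Re (trace (N ** B ** N)) = 0"
  shows "B ** N = 0"
proof -
  obtain T where T: "psd T" "T ** T = B" using psd_root_and_pinv[OF B] by blast
  have "N ** B ** N = dagger (T ** N) ** (T ** N)"
    using N psd_hermitian[OF T(1)] by (simp add: hermitian_def dagger_mult matrix_mul_assoc T(2)[symmetric])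
  with 0 have "T ** N = 0" by (intro norm_eq_0_of_trace) simp
  then show ?thesis by (simp add: T(2)[symmetric] matrix_zero_right flip: matrix_mul_assoc)
qed

text \<open>For \<open>N = B - B'\<close> the nonnegative numbers \<open>tr (N B N)\<close> and
  \<open>tr (N B' N)\<close> add up to \<open>tr (N (B B - B' B')) = 0\<close>. Hence
  \<open>B N = B' N = 0\<close>, and \<open>N N = 0\<close> by subtraction.\<close>

lemma psd_root_unique:
  assumes B: "psd B" "psd B'" and eq: "B ** B = B' ** B'"
  shows "B = B'"
proof -
  let ?N = "B - B'"
  have N: "hermitian ?N" using B by (auto simp: psd_def hermitian_def dagger_diff)
  have "trace (?N ** B ** ?N) + trace (?N ** B' ** ?N) = trace (?N ** (B ** B - B' ** B'))"
    using trace_mul_sym[of "B ** B'" B] trace_mul_sym[of "B'" "B' ** B"]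
    by (simp add: matrix_ring trace_alg)
  then have sum: "Re (trace (?N ** B ** ?N)) + Re (trace (?N ** B' ** ?N)) = 0"
    by (metis eq diff_self matrix_zero_right plus_complex.sel(1) trace_zero zero_complex.sel(1))
  have "Re (trace (?N ** B ** ?N)) = 0" "Re (trace (?N ** B' ** ?N)) = 0"
    using sum psd_trace_sandwich[OF B(1) N] psd_trace_sandwich[OF B(2) N] by linarith+
  then have "B ** ?N = 0" "B' ** ?N = 0"
    using psd_sandwich_zero B N by blast+
  then have "dagger ?N ** ?N = 0" using N by (simp add: hermitian_def matrix_diff_rdistrib)
  then have "?N = 0" by (intro norm_eq_0_of_trace) simp
  then show ?thesis by simp
qed

lemma mat_sqrt_eqI: "psd B \<Longrightarrow> B ** B = A \<Longrightarrow> mat_sqrt A = B"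
  unfolding mat_sqrt_def by (rule the_equality) (auto intro: psd_root_unique)

lemma mat_sqrt_psd:
  assumes "psd A"
  shows "psd (mat_sqrt A)" "mat_sqrt A ** mat_sqrt A = A"
proof -
  obtain T where T: "psd T" "T ** T = A" using psd_root_and_pinv[OF assms] by blast
  then show "psd (mat_sqrt A)" "mat_sqrt A ** mat_sqrt A = A"
    using mat_sqrt_eqI[OF T] by simp_all
qed

section \<open>Error terms\<close>

text \<open>\<open>X = O(\<epsilon>^k)\<close> along \<open>G\<close>, for values in any normed
  space. Order 0 means eventually bounded.\<close>

definition vanishes :: "'a filter \<Rightarrow> ('a \<Rightarrow> real) \<Rightarrow> nat \<Rightarrow> ('a \<Rightarrow> 'v::real_normed_vector) \<Rightarrow> bool"
  where "vanishes G \<epsilon> k X \<longleftrightarrow> (\<exists>K\<ge>0. \<forall>\<^sub>F x in G. norm (X x) \<le> K * \<epsilon> x ^ k)"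

locale small_parameter =
  fixes G :: "'a filter" and \<epsilon> :: "'a \<Rightarrow> real"
  assumes eps_nonneg: "\<And>x. 0 \<le> \<epsilon> x" and eps_tendsto: "(\<epsilon> \<longlongrightarrow> 0) G"
begin

abbreviation ord :: "nat \<Rightarrow> ('a \<Rightarrow> 'v::real_normed_vector) \<Rightarrow> bool"
  where "ord \<equiv> vanishes G \<epsilon>"

lemma ordI: "0 \<le> K \<Longrightarrow> \<forall>\<^sub>F x in G. norm (X x) \<le> K * \<epsilon> x ^ k \<Longrightarrow> ord k X"
  by (auto simp: vanishes_def)

lemma ordE:
  assumes "ord k X"
  obtains K where "0 \<le> K" "\<forall>\<^sub>F x in G. norm (X x) \<le> K * \<epsilon> x ^ k"
  using assms by (auto simp: vanishes_def)

lemma ord_bound: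
  assumes "ord k X" "0 \<le> K" "\<forall>\<^sub>F x in G. norm (Y x) \<le> K * norm (X x)"
  shows "ord k Y"
proof -
  obtain L where L: "0 \<le> L" "\<forall>\<^sub>F x in G. norm (X x) \<le> L * \<epsilon> x ^ k"
    using ordE[OF assms(1)] by blast
  have "\<forall>\<^sub>F x in G. norm (Y x) \<le> (K * L) * \<epsilon> x ^ k"
    using L(2) assms(3)
  proof eventually_elim
    case (elim x)
    then show ?case using mult_left_mono[OF elim(1) \<open>0 \<le> K\<close>] by (simp add: mult.assoc)
  qed
  then show ?thesis using L assms(2) by (intro ordI[of "K * L"]) auto
qed

lemma ord_cong: "ord k X \<Longrightarrow> \<forall>\<^sub>F x in G. Y x = X x \<Longrightarrow> ord k Y"
  by (rule ord_bound[of _ X 1]) (auto elim: eventually_mono)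

lemma ord_add:
  assumes "ord k X" "ord k Y"
  shows "ord k (\<lambda>x. X x + Y x)"
proof -
  obtain K where K: "0 \<le> K" "\<forall>\<^sub>F x in G. norm (X x) \<le> K * \<epsilon> x ^ k" using ordE[OF assms(1)] by blast
  obtain L where L: "0 \<le> L" "\<forall>\<^sub>F x in G. norm (Y x) \<le> L * \<epsilon> x ^ k" using ordE[OF assms(2)] by blast
  show ?thesis
  proof (rule ordI[of "K + L"])
    show "\<forall>\<^sub>F x in G. norm (X x + Y x) \<le> (K + L) * \<epsilon> x ^ k"
      using K(2) L(2)
      by eventually_elim (metis add_mono distrib_right norm_triangle_le)
  qed (use K L in auto)
qed

lemma ord_minus: "ord k X \<Longrightarrow> ord k (\<lambda>x. - X x)"
  by (simp add: vanishes_def)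

lemma ord_diff: "ord k X \<Longrightarrow> ord k Y \<Longrightarrow> ord k (\<lambda>x. X x - Y x)"
  using ord_add[OF _ ord_minus, of k X Y] by simp

lemma ord_const: "ord 0 (\<lambda>x. A)"
  by (rule ordI[of "norm A"]) auto

lemma ord_zero: "ord k (\<lambda>x. 0)"
  by (rule ordI[of 0]) auto

lemma ord_mult:
  fixes X Y :: "'a \<Rightarrow> complex^'d^'d"
  assumes "ord k X" "ord l Y" "k + l = m"
  shows "ord m (\<lambda>x. X x ** Y x)"
proof -
  obtain K where K: "0 \<le> K" "\<forall>\<^sub>F x in G. norm (X x) \<le> K * \<epsilon> x ^ k" using ordE[OF assms(1)] by blast
  obtain L where L: "0 \<le> L" "\<forall>\<^sub>F x in G. norm (Y x) \<le> L * \<epsilon> x ^ l" using ordE[OF assms(2)] by blast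
  show ?thesis
  proof (rule ordI[of "K * L"])
    show "\<forall>\<^sub>F x in G. norm (X x ** Y x) \<le> (K * L) * \<epsilon> x ^ m"
      using K(2) L(2)
    proof eventually_elim
      case (elim x)
      have "norm (X x ** Y x) \<le> (K * \<epsilon> x ^ k) * (L * \<epsilon> x ^ l)"
        using norm_matrix_mult[of "X x" "Y x"] mult_mono[OF elim] K(1) eps_nonneg[of x]
        by (smt (verit) mult_nonneg_nonneg norm_ge_zero zero_le_power)
      then show ?case by (simp add: assms(3)[symmetric] power_add algebra_simps)
    qed
  qed (use K L in auto)
qed

lemma ord_mult_const_left:
  fixes A :: "complex^'d^'d" and X :: "'a \<Rightarrow> complex^'d^'d"
  shows "ord k X \<Longrightarrow> ord k (\<lambda>x. A ** X x)"
  by (rule ord_mult[OF ord_const]) auto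

lemma ord_mult_const_right:
  fixes A :: "complex^'d^'d" and X :: "'a \<Rightarrow> complex^'d^'d"
  shows "ord k X \<Longrightarrow> ord k (\<lambda>x. X x ** A)"
  by (rule ord_mult[OF _ ord_const]) auto

lemma ord_bounded_linear:
  assumes "bounded_linear h" "ord k X"
  shows "ord k (\<lambda>x. h (X x))"
proof -
  obtain K where "0 \<le> K" "\<And>x. norm (h x) \<le> norm x * K"
    using bounded_linear.nonneg_bounded[OF assms(1)] by blast
  then show ?thesis
    by (intro ord_bound[OF assms(2), of K]) (auto simp: mult.commute)
qed

lemma ord_Re_trace: "ord k X \<Longrightarrow> ord k (\<lambda>x. Re (trace (X x :: complex^'d^'d)))"
  by (rule ord_bounded_linear[OF bounded_linear_compose[OF bounded_linear_Re bounded_linear_trace]])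

lemma ord_tendsto:
  assumes "ord k X" "0 < k"
  shows "(X \<longlongrightarrow> 0) G"
proof -
  obtain K where K: "0 \<le> K" "\<forall>\<^sub>F x in G. norm (X x) \<le> K * \<epsilon> x ^ k" using ordE[OF assms(1)] by blast
  have "((\<lambda>x. K * \<epsilon> x ^ k) \<longlongrightarrow> K * 0 ^ k) G"
    by (intro tendsto_intros eps_tendsto)
  then have "((\<lambda>x. K * \<epsilon> x ^ k) \<longlongrightarrow> 0) G" using assms(2) by (simp add: zero_power)
  then show ?thesis using K(2) by (rule Lim_null_comparison[rotated])
qed

lemma ord_eventually_less:
  assumes "ord k X" "0 < k" "0 < e"
  shows "\<forall>\<^sub>F x in G. norm (X x) < e"
  using tendstoD[OF ord_tendsto[OF assms(1,2)] assms(3)] by simp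

text \<open>A small multiple of \<open>Y\<close> on the right is absorbed on the left once
  \<open>norm (Z x) < 1/2\<close>, which doubles the constant.\<close>

lemma ord_absorb:
  fixes Y :: "'a \<Rightarrow> 'v::real_normed_vector" and Z :: "'a \<Rightarrow> 'w::real_normed_vector"
  assumes "ord k X" "ord 1 Z" "0 \<le> K" "\<forall>\<^sub>F x in G. norm (Y x) \<le> K * norm (X x) + norm (Z x) * norm (Y x)"
  shows "ord k Y"
proof (rule ord_bound[OF assms(1), of "2 * K"])
  have "\<forall>\<^sub>F x in G. norm (Z x) < 1/2" using ord_eventually_less[OF assms(2), of "1/2"] by simp
  then show "\<forall>\<^sub>F x in G. norm (Y x) \<le> 2 * K * norm (X x)"
    using assms(4)
  proof eventually_elim
    case (elim x)
    then have "norm (Z x) * norm (Y x) \<le> 1/2 * norm (Y x)" by (intro mult_right_mono) auto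
    with elim show ?case by linarith
  qed
qed (use assms in auto)

text \<open>The form in which energy estimates arrive: an equation for \<open>Y\<close> paired with
  \<open>Y\<close> itself gives a quadratic bound, and one factor \<open>norm (Y x)\<close>
  cancels.\<close>

lemma ord_quadratic:
  assumes "ord k X" "0 \<le> K" "\<forall>\<^sub>F x in G. (norm (Y x))\<^sup>2 \<le> K * (norm (Y x) * norm (X x))"
  shows "ord k Y"
proof (rule ord_bound[OF assms(1,2)])
  show "\<forall>\<^sub>F x in G. norm (Y x) \<le> K * norm (X x)"
    using assms(3)
  proof eventually_elim
    case (elim x)
    show ?case
    proof (cases "norm (Y x) = 0")
      case False
      then show ?thesis using elim by (simp add: power2_eq_square mult.left_commute)
    qed (use assms(2) in simp)
  qed
qed

end

section \<open>Factorization of matrices of bounded rank\<close>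

lemma norm_matrix_vector:
  fixes A :: "complex^'n^'n"
  shows "norm (A *v x) \<le> norm A * norm x"
proof -
  have *: "(cmod ((A *v x) $ i))\<^sup>2 \<le> (norm (A $ i))\<^sup>2 * (norm x)\<^sup>2" for i
  proof -
    have "cmod ((A *v x) $ i) \<le> (\<Sum>k\<in>UNIV. cmod (A $ i $ k) * cmod (x $ k))"
      unfolding matrix_vector_mult_def by (auto simp: norm_mult intro!: sum_norm_le)
    also have "\<dots> \<le> norm (A $ i) * norm x"
      using L2_set_mult_ineq[of "\<lambda>k. cmod (A $ i $ k)" "\<lambda>k. cmod (x $ k)" UNIV]
      by (simp add: norm_vec_def)
    finally show ?thesis by (metis norm_ge_zero power_mono power_mult_distrib)
  qed
  have "(norm (A *v x))\<^sup>2 = (\<Sum>i\<in>UNIV. (cmod ((A *v x) $ i))\<^sup>2)"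
    by (simp add: norm_vec_def L2_set_def sum_nonneg)
  also have "\<dots> \<le> (\<Sum>i\<in>UNIV. (norm (A $ i))\<^sup>2 * (norm x)\<^sup>2)"
    by (intro sum_mono *)
  also have "\<dots> = (norm A * norm x)\<^sup>2"
    by (simp add: norm_vec_def[of A] L2_set_def sum_nonneg power_mult_distrib flip: sum_distrib_right)
  finally show ?thesis by (rule power2_le_imp_le) simp
qed

text \<open>\<open>rank\<close> is the dimension of the row space over the complex numbers, that is,
  of the column space of the transpose.\<close>

lemma rank_eq_dim_range_transpose:
  fixes A :: "complex^'n^'n"
  shows "rank A = vec.dim (range ((*v) (transpose A)))"
proof -
  have sub: "vec.subspace (range ((*v) (transpose A)))"
    by (rule vec.subspace_image) (simp add: vec.subspace_UNIV)
  have "column j (transpose A) \<in> range ((*v) (transpose A))" for j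
  proof -
    have "transpose A $ i $ k * axis j 1 $ k = (if k = j then transpose A $ i $ k else 0)" for i k
      by (simp add: axis_def)
    then have "transpose A *v axis j 1 = column j (transpose A)"
      by (simp add: vec_eq_iff matrix_vector_mult_def column_def)
    then show ?thesis by (metis rangeI)
  qed
  then have "vec.span (columns (transpose A)) \<subseteq> range ((*v) (transpose A))"
    by (intro vec.span_minimal sub) (auto simp: columns_def)
  moreover have "range ((*v) (transpose A)) \<subseteq> vec.span (columns (transpose A))"
    using matrix_vector_mult_in_columnspace_gen[of "transpose A"] by blast
  ultimately have "vec.span (columns (transpose A)) = range ((*v) (transpose A))" by simp
  then show ?thesis
    unfolding row_rank_def_gen by (metis columns_transpose vec.dim_span)
qed

lemma dim_range_mult_le:
  fixes A :: "complex^'n^'n"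
  shows "vec.dim (range ((*v) (S ** A ** S'))) \<le> vec.dim (range ((*v) A))"
proof -
  have "range ((*v) (S ** A ** S')) \<subseteq> (*v) S ` range ((*v) A)"
    by (auto simp flip: matrix_vector_mul_assoc)
  then have "vec.dim (range ((*v) (S ** A ** S'))) \<le> vec.dim ((*v) S ` range ((*v) A))"
    by (rule vec.dim_subset)
  also have "\<dots> \<le> vec.dim (range ((*v) A))"
    by (rule vec.dim_image_le[OF matrix_vector_mul_linear_gen])
  finally show ?thesis .
qed

text \<open>A unitary diagonalizes \<open>A\<close>, and diagonal matrices are symmetric. So
  \<open>A\<close> and its transpose are two-sided multiples of each other, and neither range can
  have the larger dimension.\<close>

lemma rank_hermitian:
  assumes "hermitian A"
  shows "rank A = vec.dim (range ((*v) A))"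
proof -
  obtain c b where "orthonormal_eigenbasis A c b" using spectral_theorem[OF assms] by blast
  define U where "U = basis_matrix b"
  have u: "unitary U" and A: "A = U ** diag (\<lambda>r. complex_of_real (c r)) ** dagger U"
    using \<open>orthonormal_eigenbasis A c b\<close> by (auto simp: orthonormal_eigenbasis_iff spectral_fun_def U_def)
  let ?D = "diag (\<lambda>r. complex_of_real (c r))" and ?W = "transpose (dagger U)"
  have D: "transpose ?D = ?D" by (auto simp: transpose_def diag_def vec_eq_iff)
  have tA: "transpose A = ?W ** ?D ** transpose U"
    by (simp add: A matrix_transpose_mul D matrix_mul_assoc)
  have WU: "transpose U ** ?W = mat 1"
    using u by (simp add: unitary_def transpose_mat flip: matrix_transpose_mul)
  have "(?W ** dagger U) ** A ** (U ** transpose U)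
      = ?W ** (dagger U ** U) ** ?D ** (dagger U ** U) ** transpose U"
    by (simp add: A matrix_mul_assoc)
  also have "\<dots> = transpose A" by (simp add: unitaryD[OF u] tA)
  finally have 1: "transpose A = (?W ** dagger U) ** A ** (U ** transpose U)" ..
  have "(U ** transpose U) ** transpose A ** (?W ** dagger U)
      = U ** (transpose U ** ?W) ** ?D ** (transpose U ** ?W) ** dagger U"
    by (simp add: tA matrix_mul_assoc)
  also have "\<dots> = A" by (simp add: WU A)
  finally have 2: "A = (U ** transpose U) ** transpose A ** (?W ** dagger U)" ..
  have "vec.dim (range ((*v) (transpose A))) \<le> vec.dim (range ((*v) A))"
    by (subst 1) (rule dim_range_mult_le)
  moreover have "vec.dim (range ((*v) A)) \<le> vec.dim (range ((*v) (transpose A)))"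
    by (subst 2) (rule dim_range_mult_le)
  ultimately show ?thesis by (simp add: rank_eq_dim_range_transpose)
qed

text \<open>By injectivity \<open>A\<close> maps the range of \<open>P\<close> onto a space of
  dimension \<open>rank P\<close>, which is at least \<open>rank A\<close>; this is therefore the
  whole range of \<open>A\<close>. So each column of \<open>A ** X\<close> has a preimage in the
  range of \<open>P\<close>.\<close>

lemma bounded_rank_factor:
  fixes A P :: "complex^'n^'n"
  assumes A: "hermitian A" and P: "hermitian P" "P ** P = P" and rank: "rank A \<le> rank P"
    and inj: "\<And>y. P *v y = y \<Longrightarrow> A *v y = 0 \<Longrightarrow> y = 0"
  shows "\<exists>Y. P ** Y = Y \<and> A ** X = A ** Y"
proof -
  let ?R = "range ((*v) P)"
  have R: "P *v y = y" if "y \<in> ?R" for y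
    using that P(2) by (auto simp: matrix_vector_mul_assoc)
  have subR: "vec.subspace ?R" and subA: "vec.subspace (range ((*v) A))"
    by (rule vec.subspace_image[OF vec.subspace_UNIV])+
  have "inj_on ((*v) A) ?R"
  proof (rule inj_onI)
    fix x y assume "x \<in> ?R" "y \<in> ?R" "A *v x = A *v y"
    then have "P *v (x - y) = x - y" "A *v (x - y) = 0"
      by (simp_all only: matrix_vector_mult_diff_distrib R diff_self)
    from inj[OF this] show "x = y" by simp
  qed
  then have "vec.dim ((*v) A ` ?R) = vec.dim ?R"    by (intro vec.dim_image_eq[OF matrix_vector_mul_linear_gen])
      (simp add: vec.span_eq_iff[THEN iffD2, OF subR])
  moreover have "(*v) A ` ?R \<subseteq> range ((*v) A)" by auto
  ultimately have "(*v) A ` ?R = range ((*v) A)"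
    using rank rank_hermitian[OF A] rank_hermitian[OF P(1)]
    by (intro vec.subspace_dim_equal subA vec.subspace_image subR) simp_all
  then have "A *v column j X \<in> (*v) A ` ?R" for j by simp
  then have "\<exists>y. y \<in> ?R \<and> A *v column j X = A *v y" for j by (auto elim: imageE)
  then obtain y where y: "y j \<in> ?R" "A *v column j X = A *v y j" for j by metis
  define Y where "Y = (\<chi> i j. y j $ i)"
  have col: "(B ** Y) $ i $ j = (B *v y j) $ i" "(B ** X) $ i $ j = (B *v column j X) $ i"
    for B :: "complex^'n^'n" and i j
    by (simp_all add: Y_def matrix_matrix_mult_def matrix_vector_mult_def column_def)
  have "(P ** Y) $ i $ j = Y $ i $ j" for i j
    unfolding col R[OF y(1)] by (simp add: Y_def)
  moreover have "(A ** X) $ i $ j = (A ** Y) $ i $ j" for i j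
    unfolding col y(2) ..
  ultimately show ?thesis by (auto simp: vec_eq_iff)
qed

section \<open>Expansion of the fidelity\<close>

lemma trace_cyclic3: "trace (A ** B ** C) = trace (B ** C ** (A :: complex^'n^'n))"
  for B C :: "complex^'n^'n"
  by (metis matrix_mul_assoc trace_mul_sym)

lemma norm_sq_hermitian: "hermitian N \<Longrightarrow> (norm N)\<^sup>2 = Re (trace (N ** N))"
  by (simp add: norm_matrix_sq hermitian_def)

lemma hermitian_trace_sandwich:
  assumes "hermitian T" "hermitian N"
  shows "Re (trace (N ** (T ** T) ** N)) = (norm (T ** N))\<^sup>2"
  using assms by (simp add: norm_matrix_sq hermitian_def dagger_mult matrix_mul_assoc)

text \<open>\<open>T\<close> is the root of a density matrix \<open>\<rho>\<close> that may be
  singular, and \<open>V\<close> is the pseudo-inverse of \<open>T\<close>. The projections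
  \<open>P\<close> and \<open>R\<close> below are those onto the support and onto the kernel of
  \<open>\<rho>\<close>.\<close>

locale density_root =
  fixes \<rho> T V :: "complex^'d^'d"
  assumes T: "psd T" and V: "hermitian V" and TT: "T ** T = \<rho>" and TV: "T ** V = V ** T"
    and TVT: "T ** V ** T = T" and VTV: "V ** T ** V = V"
begin

definition P where "P = T ** V"
definition R where "R = mat 1 - P"

lemma hermT: "dagger T = T" and hermV: "dagger V = V"
  using T V by (auto simp: psd_def hermitian_def)

lemma hermP: "hermitian P"
  by (simp add: hermitian_def P_def dagger_mult hermT hermV TV)

lemma PT: "P ** T = T" "T ** P = T" "P ** V = V" "V ** P = V" "P ** P = P" "V ** T = P"
proof -
  show 1: "P ** T = T" "V ** P = V" by (simp_all add: P_def TVT VTV matrix_mul_assoc)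
  have P': "P = V ** T" by (simp add: P_def TV)
  then show "V ** T = P" ..
  show "T ** P = T" "P ** V = V" by (simp_all only: P' matrix_mul_assoc TVT VTV)
  have "P ** P = (T ** V ** T) ** V" by (simp add: P_def matrix_mul_assoc)
  then show "P ** P = P" by (simp add: TVT P_def)
qed

lemma P\<rho>: "P ** \<rho> = \<rho>" "\<rho> ** P = \<rho>"
  by (simp add: TT[symmetric] matrix_mul_assoc PT) (simp add: TT[symmetric] PT flip: matrix_mul_assoc)

lemma R\<rho>: "R ** \<rho> = 0" "\<rho> ** R = 0" "R ** T = 0" "T ** R = 0" "R ** R = R" "R ** P = 0" "P ** R = 0"
  by (simp_all add: R_def matrix_ring P\<rho> PT)

lemma VV\<rho>: "V ** V ** \<rho> = P" "\<rho> ** V ** V = P"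
proof -
  have "V ** V ** \<rho> = V ** (V ** T) ** T" by (simp add: TT[symmetric] matrix_mul_assoc)
  then show "V ** V ** \<rho> = P" by (simp add: PT)
  have "\<rho> ** V ** V = T ** (T ** V) ** V" by (simp add: TT[symmetric] matrix_mul_assoc)
  then show "\<rho> ** V ** V = P" by (simp add: PT flip: P_def)
qed

lemma hermR: "hermitian R"
  using hermP by (simp add: hermitian_def R_def dagger_diff)

lemma herm\<rho>: "dagger \<rho> = \<rho>"
  using hermT TT by (metis dagger_mult)

lemma rank_P: "rank P = rank \<rho>"
proof -
  have "range ((*v) P) = range ((*v) \<rho>)"
  proof
    show "range ((*v) P) \<subseteq> range ((*v) \<rho>)"
    proof
      fix z assume "z \<in> range ((*v) P)"
      then obtain y where "z = P *v y" by auto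
      then have "z = \<rho> *v (V ** V *v y)" by (simp add: matrix_vector_mul_assoc VV\<rho> matrix_mul_assoc)
      then show "z \<in> range ((*v) \<rho>)" by blast
    qed
    show "range ((*v) \<rho>) \<subseteq> range ((*v) P)"
    proof
      fix z assume "z \<in> range ((*v) \<rho>)"
      then obtain y where "z = \<rho> *v y" by auto
      then have "z = P *v (\<rho> *v y)" by (simp add: matrix_vector_mul_assoc P\<rho>)
      then show "z \<in> range ((*v) P)" by blast
    qed
  qed
  then show ?thesis
    using rank_hermitian[OF hermP] rank_hermitian[of \<rho>] herm\<rho> by (simp add: hermitian_def)
qed

text \<open>\<open>V ** T = P\<close>, so \<open>T\<close> is bounded below on the support. This
  converts bounds on \<open>T ** N\<close> into bounds on \<open>N\<close>.\<close>

lemma bound_left: fixes N :: "complex^'d^'d" assumes "P ** N = N" shows "norm N \<le> norm V * norm (T ** N)"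
  using norm_matrix_mult[of V "T ** N"] assms PT(6) by (simp add: matrix_mul_assoc)

end

locale perturbed_density = small_parameter G \<epsilon> + density_root \<rho> T V
  for G :: "'a filter" and \<epsilon> and \<rho> T V :: "complex^'d^'d" +
  fixes \<delta> :: "'a \<Rightarrow> complex^'d^'d"
  assumes psd': "\<forall>\<^sub>F x in G. psd (\<rho> + \<delta> x)" and rank': "\<forall>\<^sub>F x in G. rank (\<rho> + \<delta> x) \<le> rank \<rho>"
    and ord\<delta>: "ord 1 \<delta>"
begin

text \<open>As the rank does not increase, the block of \<open>\<delta>\<close> on the kernel of \<open>\<rho>\<close> is a Schur complement of
  the other blocks, hence of second order.\<close>

lemma complement_block: "ord 3 (\<lambda>x. R ** \<delta> x ** R - R ** \<delta> x ** (V ** V) ** \<delta> x ** R)"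
  and complement_block_ord2: "ord 2 (\<lambda>x. R ** \<delta> x ** R)"
proof -
  \<comment> \<open>A perturbation this small keeps \<open>\<rho> + \<delta> x\<close> injective on
    the support, since \<open>V ** V ** \<rho> = P\<close> is the identity there.\<close>
  have small: "\<forall>\<^sub>F x in G. norm (V ** V ** \<delta> x) < 1"
    using ord_eventually_less[OF ord_mult_const_left[OF ord\<delta>, of "V ** V"]] by simp
  have "\<forall>\<^sub>F x in G. \<exists>Y. P ** Y = Y \<and> (\<rho> + \<delta> x) ** R = (\<rho> + \<delta> x) ** Y"
    using small psd' rank'
  proof eventually_elim
    case (elim x)
    show ?case
    proof (rule bounded_rank_factor[OF psd_hermitian[OF elim(2)] hermP PT(5)])
      show "rank (\<rho> + \<delta> x) \<le> rank P" using elim(3) rank_P by simp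
      fix y assume y: "P *v y = y" "(\<rho> + \<delta> x) *v y = 0"
      have "y = V ** V ** \<rho> *v y" using y(1) by (simp add: VV\<rho>)
      also have "V ** V ** \<rho> = V ** V ** (\<rho> + \<delta> x) - V ** V ** \<delta> x" by (simp add: matrix_ring)
      also have "\<dots> *v y = - (V ** V ** \<delta> x *v y)"
        using y(2) by (simp add: matrix_vector_mult_diff_rdistrib flip: matrix_vector_mul_assoc)
      finally have "norm y \<le> norm (V ** V ** \<delta> x) * norm y"
        by (metis norm_matrix_vector norm_minus_cancel)
      then show "y = 0" using elim(1) by (metis mult_le_cancel_right1 norm_le_zero_iff not_le)
    qed
  qed
  then obtain Y where Y: "\<forall>\<^sub>F x in G. P ** Y x = Y x \<and> (\<rho> + \<delta> x) ** R = (\<rho> + \<delta> x) ** Y x"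
    using eventually_ex[of "\<lambda>x Y. P ** Y = Y \<and> (\<rho> + \<delta> x) ** R = (\<rho> + \<delta> x) ** Y" G] by auto
  \<comment> \<open>The pseudo-inverse \<open>V ** V\<close> of \<open>\<rho>\<close> gives a fixed
    point equation, which makes \<open>Y\<close> of first order and equal to
    \<open>V ** V ** \<delta> x ** R\<close> up to second order.\<close>
  have YV: "\<forall>\<^sub>F x in G. Y x = V ** V ** \<delta> x ** R - V ** V ** \<delta> x ** Y x"
    using Y
  proof eventually_elim
    case (elim x)
    then have "V ** V ** (\<delta> x ** R) = V ** V ** ((\<rho> + \<delta> x) ** Y x)"
      by (metis (no_types) R\<rho>(2) add_0 matrix_add_rdistrib)
    also have "\<dots> = P ** Y x + V ** V ** \<delta> x ** Y x"
      by (simp add: matrix_ring VV\<rho>)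
    finally show ?case using elim by (simp add: matrix_mul_assoc)
  qed
  have V\<delta>R: "ord 1 (\<lambda>x. V ** V ** \<delta> x ** R)"
    by (intro ord_mult_const_right ord_mult_const_left ord\<delta>)
  have V\<delta>: "ord 1 (\<lambda>x. V ** V ** \<delta> x)"
    by (intro ord_mult_const_right ord_mult_const_left ord\<delta>)
  have ordY: "ord 1 Y"
  proof (rule ord_absorb[OF V\<delta>R V\<delta>, of 1])
    show "\<forall>\<^sub>F x in G. norm (Y x) \<le> 1 * norm (V ** V ** \<delta> x ** R) + norm (V ** V ** \<delta> x) * norm (Y x)"
      using YV
    proof eventually_elim
      case (elim x)
      show ?case
        using norm_triangle_ineq4[of "V ** V ** \<delta> x ** R" "V ** V ** \<delta> x ** Y x"]
          norm_matrix_mult[of "V ** V ** \<delta> x" "Y x"] by (simp flip: elim)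
    qed
  qed simp
  \<comment> \<open>The rows in the kernel: \<open>R\<close> annihilates \<open>\<rho>\<close> from
    the left, which leaves only \<open>\<delta>\<close> on both sides.\<close>
  have RR: "\<forall>\<^sub>F x in G. R ** \<delta> x ** R = R ** \<delta> x ** Y x"
    using Y
  proof eventually_elim
    case (elim x)
    have "R ** ((\<rho> + \<delta> x) ** R) = R ** ((\<rho> + \<delta> x) ** Y x)" using elim by simp
    then show ?case by (simp add: matrix_ring R\<rho>)
  qed
  have RdY: "ord 2 (\<lambda>x. R ** \<delta> x ** Y x)"
    by (rule ord_mult[OF ord_mult_const_left[OF ord\<delta>] ordY]) simp
  show "ord 2 (\<lambda>x. R ** \<delta> x ** R)"
    by (rule ord_cong[OF RdY RR])
  have "ord 3 (\<lambda>x. R ** \<delta> x ** (V ** V ** \<delta> x ** Y x))"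
    by (rule ord_mult[OF ord_mult_const_left[OF ord\<delta>] ord_mult[OF V\<delta> ordY refl]]) simp
  then have "ord 3 (\<lambda>x. - (R ** \<delta> x ** (V ** V ** \<delta> x ** Y x)))" by (rule ord_minus)
  moreover have "\<forall>\<^sub>F x in G. R ** \<delta> x ** R - R ** \<delta> x ** (V ** V) ** \<delta> x ** R
      = - (R ** \<delta> x ** (V ** V ** \<delta> x ** Y x))"
    using RR YV
  proof eventually_elim
    case (elim x)
    have "R ** \<delta> x ** Y x = R ** \<delta> x ** (V ** V ** \<delta> x ** R - V ** V ** \<delta> x ** Y x)"
      by (simp flip: elim(2))
    then show ?case by (simp add: elim(1) matrix_ring)
  qed
  ultimately show "ord 3 (\<lambda>x. R ** \<delta> x ** R - R ** \<delta> x ** (V ** V) ** \<delta> x ** R)"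
    by (rule ord_cong)
qed

definition Z where "Z x = mat_sqrt (T ** (\<rho> + \<delta> x) ** T)"
text \<open>The increment of the root: for \<open>\<delta> x = 0\<close> the root is
  \<open>\<rho>\<close> itself, because \<open>T ** \<rho> ** T = \<rho> ** \<rho>\<close>.\<close>

definition N where "N x = Z x - \<rho>"

lemma mat_sqrt_\<rho>: "mat_sqrt \<rho> = T"
  by (rule mat_sqrt_eqI[OF T TT])

lemma N_props:
  assumes "psd (\<rho> + \<delta> x)"
  shows "psd (Z x)" "hermitian (N x)" "P ** N x = N x" "N x ** P = N x"
    "\<rho> ** N x + N x ** \<rho> + N x ** N x = T ** \<delta> x ** T"
    "Z x ** N x + N x ** \<rho> = T ** \<delta> x ** T"
proof -
  have "psd (T ** (\<rho> + \<delta> x) ** T)" using psd_conj[OF assms, of T] by (simp add: hermT)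
  from mat_sqrt_psd[OF this] have Z: "psd (Z x)" "Z x ** Z x = T ** (\<rho> + \<delta> x) ** T"
    by (simp_all add: Z_def)
  show "psd (Z x)" by fact
  have hZ: "dagger (Z x) = Z x" using Z(1) by (simp add: psd_def hermitian_def)
  show h: "hermitian (N x)" by (simp add: hermitian_def N_def dagger_diff hZ herm\<rho>)
  \<comment> \<open>\<open>Z x ** Z x\<close> annihilates the kernel of \<open>\<rho>\<close>, and
    so does its root.\<close>
  have "dagger (Z x ** R) ** (Z x ** R) = R ** (Z x ** Z x) ** R"
    using hermR by (simp add: dagger_mult hermitian_def hZ matrix_mul_assoc)
  also have "\<dots> = 0" by (simp add: Z(2) matrix_mul_assoc R\<rho> matrix_zero_left)
  finally have ZR: "Z x ** R = 0" by (intro norm_eq_0_of_trace) simp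
  then have ZP: "Z x ** P = Z x" by (simp add: R_def matrix_ring)
  then show NP: "N x ** P = N x" by (simp add: N_def matrix_ring P\<rho>)
  show "P ** N x = N x" using NP h hermP by (metis dagger_mult hermitian_def)
  have "T ** \<delta> x ** T = Z x ** Z x - \<rho> ** \<rho>"
    by (simp add: Z(2) matrix_ring) (simp add: TT[symmetric] matrix_mul_assoc)
  then show "\<rho> ** N x + N x ** \<rho> + N x ** N x = T ** \<delta> x ** T"
    "Z x ** N x + N x ** \<rho> = T ** \<delta> x ** T"
    by (simp_all add: N_def matrix_ring)
qed

text \<open>The equation \<open>Z N + N \<rho> = T \<delta> T\<close> has positive coefficients. Its
  trace against \<open>N\<close> is \<open>tr (N Z N) + tr (N \<rho> N)\<close>, which dominates the
  square of \<open>norm (T ** N)\<close>, and \<open>T\<close> is bounded below where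
  \<open>N\<close> lives. The resulting bound is linear in \<open>\<delta>\<close> even if
  \<open>\<rho>\<close> is singular.\<close>

lemma ord_N: "ord 1 N"
proof (rule ord_quadratic[of 1 "\<lambda>x. T ** \<delta> x ** T" "(norm V)\<^sup>2"])
  show "ord 1 (\<lambda>x. T ** \<delta> x ** T)" by (intro ord_mult_const_right ord_mult_const_left ord\<delta>)
  show "\<forall>\<^sub>F x in G. (norm (N x))\<^sup>2 \<le> (norm V)\<^sup>2 * (norm (N x) * norm (T ** \<delta> x ** T))"
    using psd'
  proof eventually_elim
    case (elim x)
    note N = N_props[OF elim]
    have "(norm (T ** N x))\<^sup>2 = Re (trace (N x ** \<rho> ** N x))"
      using hermitian_trace_sandwich[OF psd_hermitian[OF T] N(2)] by (simp add: TT)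
    also have "\<dots> \<le> Re (trace (N x ** Z x ** N x)) + Re (trace (N x ** \<rho> ** N x))"
      using psd_trace_sandwich[OF N(1,2)] by simp
    also have "\<dots> = Re (trace (N x ** (Z x ** N x + N x ** \<rho>)))"
      using trace_cyclic3[of "N x" "N x" \<rho>] trace_cyclic3[of "N x" \<rho> "N x"]
      by (simp add: matrix_ring trace_add trace_mul_sym[of \<rho> "N x ** N x"])
    also have "\<dots> \<le> norm (N x) * norm (T ** \<delta> x ** T)"
      unfolding N(6) using abs_Re_trace_le[of "N x" "T ** \<delta> x ** T"] by linarith
    finally have *: "(norm (T ** N x))\<^sup>2 \<le> norm (N x) * norm (T ** \<delta> x ** T)" .
    have "(norm (N x))\<^sup>2 \<le> (norm V * norm (T ** N x))\<^sup>2"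
      by (intro power_mono bound_left N) simp
    also have "\<dots> \<le> (norm V)\<^sup>2 * (norm (N x) * norm (T ** \<delta> x ** T))"
      unfolding power_mult_distrib by (intro mult_left_mono *) simp
    finally show ?case .
  qed
qed simp

text \<open>The trace of \<open>\<rho> N + N \<rho> + N N = T \<delta> T\<close> against
  \<open>V V\<close> gives \<open>tr (P \<delta>) = 2 tr N + tr (V V N N)\<close>. As
  \<open>1 - F = - tr N\<close> and \<open>tr \<delta> = 0\<close>, this means
  \<open>2 (1 - F) = tr (V V N N) + tr (R \<delta>)\<close>, up to real parts. To leading order
  \<open>N = T m T\<close>, so the first term is \<open>tr (P m \<rho> m)\<close>; the Schur
  complement makes the second one \<open>tr (R m \<rho> m)\<close>.\<close>

theorem fidelity_expansion:
  assumes tr\<rho>: "trace \<rho> = 1" and tr\<delta>: "\<forall>\<^sub>F x in G. trace (\<delta> x) = 0"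
    and m: "ord 1 m" "\<And>x. hermitian (m x)"
    and m\<delta>: "ord 2 (\<lambda>x. \<delta> x - (m x ** \<rho> + \<rho> ** m x))"
  shows "ord 3 (\<lambda>x. 2 * (1 - fidelity \<rho> (\<rho> + \<delta> x)) - Re (trace (m x ** \<rho> ** m x)))"
proof -
  define D where "D x = m x ** \<rho> + \<rho> ** m x" for x
  define M where "M x = T ** m x ** T" for x
  have ordM: "ord 1 M" unfolding M_def by (intro ord_mult_const_right ord_mult_const_left m)
  have ordD: "ord 1 D" unfolding D_def by (intro ord_add ord_mult_const_right ord_mult_const_left m)
  have hm: "dagger (m x) = m x" for x using m(2) by (simp add: hermitian_def)
  have d: "ord 2 (\<lambda>x. \<delta> x - D x)" using m\<delta> by (simp add: D_def)
  \<comment> \<open>\<open>T ** m x ** T\<close> solves the linearized equation for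
    \<open>N\<close>; the difference is bounded by the same pairing as in
    \<open>ord_N\<close>.\<close>
  have NM: "ord 2 (\<lambda>x. N x - M x)"
  proof (rule ord_quadratic[of 2 "\<lambda>x. T ** (\<delta> x - D x) ** T - N x ** N x" "(norm V)\<^sup>2"])
    show "ord 2 (\<lambda>x. T ** (\<delta> x - D x) ** T - N x ** N x)"
      by (rule ord_diff[OF ord_mult_const_right[OF ord_mult_const_left[OF d]] ord_mult[OF ord_N ord_N]]) simp
    show "\<forall>\<^sub>F x in G. (norm (N x - M x))\<^sup>2
        \<le> (norm V)\<^sup>2 * (norm (N x - M x) * norm (T ** (\<delta> x - D x) ** T - N x ** N x))"
      using psd'
    proof eventually_elim
      case (elim x)
      note N = N_props[OF elim]
      define L where "L = N x - M x"
      have hL: "hermitian L"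
        using N(2) by (simp add: L_def M_def hermitian_def dagger_diff dagger_mult hm hermT matrix_mul_assoc)
      have PL: "P ** L = L" by (simp add: L_def M_def matrix_ring N PT)
      have eq: "\<rho> ** L + L ** \<rho> = T ** (\<delta> x - D x) ** T - N x ** N x"
      proof -
        have "T ** (\<delta> x - D x) ** T = (\<rho> ** N x + N x ** \<rho> + N x ** N x) - T ** D x ** T"
          unfolding N(5) by (simp add: matrix_ring)
        moreover have "T ** D x ** T = \<rho> ** M x + M x ** \<rho>"
          by (simp add: D_def M_def matrix_ring) (simp add: TT[symmetric] matrix_mul_assoc)
        ultimately show ?thesis by (simp add: L_def matrix_ring)
      qed
      have "2 * (norm (T ** L))\<^sup>2 = 2 * Re (trace (L ** \<rho> ** L))"
        using hermitian_trace_sandwich[OF psd_hermitian[OF T] hL] by (simp add: TT)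
      also have "\<dots> = Re (trace (L ** (\<rho> ** L + L ** \<rho>)))"
        using trace_cyclic3[of L \<rho> L] trace_mul_sym[of \<rho> "L ** L"]
        by (simp add: matrix_ring trace_add)
      also have "\<dots> \<le> norm L * norm (\<rho> ** L + L ** \<rho>)"
        using abs_Re_trace_le[of L "\<rho> ** L + L ** \<rho>"] by linarith
      finally have *: "(norm (T ** L))\<^sup>2 \<le> norm L * norm (\<rho> ** L + L ** \<rho>)"
        by (smt (verit) zero_le_power2)
      have "(norm L)\<^sup>2 \<le> (norm V * norm (T ** L))\<^sup>2"
        by (intro power_mono bound_left PL) simp
      also have "\<dots> \<le> (norm V)\<^sup>2 * (norm L * norm (\<rho> ** L + L ** \<rho>))"
        unfolding power_mult_distrib by (intro mult_left_mono *) simp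
      finally show ?case unfolding eq by (simp add: L_def)
    qed
  qed simp
  have VN: "ord 3 (\<lambda>x. Re (trace (V ** V ** (N x ** N x) - V ** V ** (M x ** M x))))"
  proof (rule ord_Re_trace)
    have "ord 3 (\<lambda>x. V ** V ** ((N x - M x) ** N x + M x ** (N x - M x)))"
      by (intro ord_add ord_mult_const_left ord_mult[OF NM ord_N] ord_mult[OF ordM NM]) simp_all
    then show "ord 3 (\<lambda>x. V ** V ** (N x ** N x) - V ** V ** (M x ** M x))"
      by (simp add: matrix_ring)
  qed
  have VM: "trace (V ** V ** (M x ** M x)) = trace (P ** m x ** \<rho> ** m x)" for x
  proof -
    have "trace (V ** V ** (M x ** M x)) = trace (V ** V ** T ** m x ** \<rho> ** m x ** T)"
      by (simp add: M_def TT[symmetric] matrix_mul_assoc)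
    also have "\<dots> = trace ((T ** V) ** (V ** T) ** m x ** \<rho> ** m x)"
      using trace_mul_sym[of T "V ** V ** T ** m x ** \<rho> ** m x"] by (simp add: matrix_mul_assoc)
    also have "(T ** V) ** (V ** T) = P" by (simp add: PT P_def[symmetric])
    finally show ?thesis .
  qed
  have Rblock: "ord 3 (\<lambda>x. Re (trace (R ** \<delta> x)) - Re (trace (R ** m x ** \<rho> ** m x)))"
  proof -
    have 1: "ord 3 (\<lambda>x. R ** \<delta> x ** (V ** V) ** \<delta> x ** R - R ** D x ** (V ** V) ** D x ** R)"
    proof -
      have "ord 3 (\<lambda>x. R ** (\<delta> x - D x) ** (V ** V) ** \<delta> x ** R + R ** D x ** (V ** V) ** (\<delta> x - D x) ** R)"
        by (rule ord_add; rule ord_mult_const_right, rule ord_mult, rule ord_mult_const_right,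
            rule ord_mult_const_left) (rule d ord\<delta> ordD | simp)+
      then show ?thesis by (simp add: matrix_ring)
    qed
    \<comment> \<open>Next to \<open>R\<close> only one of the two terms of \<open>D\<close>
      survives, and the inner \<open>\<rho> ** V ** V\<close> collapses to \<open>P\<close>.\<close>
    have 2: "R ** D x ** (V ** V) ** D x ** R = R ** m x ** \<rho> ** m x ** R" for x
    proof -
      have "R ** D x = R ** m x ** \<rho>" "D x ** R = \<rho> ** m x ** R"
        by (simp_all add: D_def matrix_ring R\<rho>) (simp add: R\<rho> matrix_zero_right flip: matrix_mul_assoc)
      then have "R ** D x ** (V ** V) ** D x ** R = R ** m x ** (\<rho> ** V ** V) ** \<rho> ** m x ** R"
        by (metis matrix_mul_assoc)
      also have "\<dots> = R ** m x ** (P ** \<rho>) ** m x ** R" by (simp add: VV\<rho> matrix_mul_assoc)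
      finally show ?thesis by (simp add: P\<rho>)
    qed
    have "ord 3 (\<lambda>x. R ** \<delta> x ** R - R ** m x ** \<rho> ** m x ** R)"
      using ord_add[OF complement_block 1] by (simp add: 2)
    then have "ord 3 (\<lambda>x. Re (trace (R ** \<delta> x ** R - R ** m x ** \<rho> ** m x ** R)))"
      by (rule ord_Re_trace)
    moreover have "trace (R ** X ** R) = trace (R ** X)" for X
      using trace_cyclic3[of R X R] by (metis R\<rho>(5) matrix_mul_assoc trace_mul_sym)
    then have "trace (R ** \<delta> x ** R - R ** m x ** \<rho> ** m x ** R) = trace (R ** \<delta> x) - trace (R ** m x ** \<rho> ** m x)" for x
      by (metis matrix_mul_assoc trace_sub)
    ultimately show ?thesis by simp
  qed
  have "\<forall>\<^sub>F x in G. 2 * (1 - fidelity \<rho> (\<rho> + \<delta> x)) - Re (trace (m x ** \<rho> ** m x))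
      = Re (trace (V ** V ** (N x ** N x) - V ** V ** (M x ** M x)))
        + (Re (trace (R ** \<delta> x)) - Re (trace (R ** m x ** \<rho> ** m x)))"
    using psd' tr\<delta>
  proof eventually_elim
    case (elim x)
    note N = N_props[OF elim(1)]
    have "fidelity \<rho> (\<rho> + \<delta> x) = Re (trace (Z x))"
      by (simp add: fidelity_def mat_sqrt_\<rho> Z_def)
    then have F: "fidelity \<rho> (\<rho> + \<delta> x) = 1 + Re (trace (N x))"
      by (simp add: N_def trace_sub tr\<rho>)
    have "trace (V ** V ** (T ** \<delta> x ** T)) = trace (P ** \<delta> x)"
    proof -
      have "trace (V ** V ** (T ** \<delta> x ** T)) = trace (T ** V ** (V ** T) ** \<delta> x)"
        using trace_mul_sym[of T "V ** V ** T ** \<delta> x"] by (simp add: matrix_mul_assoc)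
      also have "T ** V ** (V ** T) = P" by (simp add: PT P_def[symmetric])
      finally show ?thesis .
    qed
    moreover have "trace (V ** V ** (\<rho> ** N x + N x ** \<rho> + N x ** N x))
        = 2 * trace (N x) + trace (V ** V ** (N x ** N x))"
    proof -
      have "V ** V ** (\<rho> ** N x) = N x" by (simp add: matrix_mul_assoc VV\<rho> N)
      moreover have "trace (V ** V ** (N x ** \<rho>)) = trace (N x)"
        using trace_mul_sym[of "V ** V ** N x" \<rho>] by (simp add: matrix_mul_assoc VV\<rho> N)
      ultimately show ?thesis by (simp add: matrix_add_ldistrib trace_add)
    qed
    ultimately have 1: "trace (P ** \<delta> x) = 2 * trace (N x) + trace (V ** V ** (N x ** N x))"
      unfolding N(5) by simp
    have 2: "trace (P ** \<delta> x) = - trace (R ** \<delta> x)"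
      by (simp add: R_def matrix_ring trace_sub elim)
    have 3: "trace (R ** m x ** \<rho> ** m x) = trace (m x ** \<rho> ** m x) - trace (P ** m x ** \<rho> ** m x)"
      by (simp add: R_def matrix_ring trace_sub)
    show ?case
      using arg_cong[OF 1, of Re] arg_cong[OF 2, of Re] arg_cong[OF 3, of Re]
      by (simp add: F trace_sub VM)
  qed
  from ord_cong[OF ord_add[OF VN Rblock] this] show ?thesis .
qed

end

section \<open>Products of commuting matrices\<close>

text \<open>The fold of \<open>gaussian_op\<close> over a set of modes, which makes induction over
  the modes possible.\<close>

definition mprod :: "('n \<Rightarrow> complex^'d^'d) \<Rightarrow> 'n set \<Rightarrow> complex^'d^'d"
  where "mprod f F = Finite_Set.fold (\<lambda>k M. f k ** M) (mat 1) F"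

definition commuting :: "('n \<Rightarrow> complex^'d^'d) \<Rightarrow> bool"
  where "commuting f \<longleftrightarrow> (\<forall>j k. f j ** f k = f k ** f j)"

lemma mprod_empty [simp]: "mprod f {} = mat 1"
  by (simp add: mprod_def)

lemma mprod_insert:
  assumes "commuting f" "finite F" "k \<notin> F"
  shows "mprod f (insert k F) = f k ** mprod f F"
proof -
  interpret comp_fun_commute_on UNIV "\<lambda>k M. f k ** M"
    using assms(1) by unfold_locales (auto simp: fun_eq_iff commuting_def matrix_mul_assoc)
  show ?thesis unfolding mprod_def using assms by (intro fold_insert) auto
qed

lemma mprod_cong:
  assumes "commuting f" "commuting g" "finite F" "\<And>k. k \<in> F \<Longrightarrow> f k = g k"
  shows "mprod f F = mprod g F"
  using assms(3,4) by (induction F rule: finite_induct) (auto simp: mprod_insert assms(1,2))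

lemma mprod_commute:
  assumes "commuting f" "finite F" "\<And>k. k \<in> F \<Longrightarrow> Y ** f k = f k ** Y"
  shows "Y ** mprod f F = mprod f F ** Y"
  using assms(2,3)
proof (induction F rule: finite_induct)
  case (insert k F)
  have "Y ** (f k ** mprod f F) = f k ** (Y ** mprod f F)"
    using insert.prems[of k] by (simp add: matrix_mul_assoc)
  then show ?case using insert by (simp add: mprod_insert assms(1) matrix_mul_assoc)
qed simp

lemma mprod_mult:
  assumes "commuting f" "commuting g" "commuting h" "\<And>j k. f j ** g k = g k ** f j"
    "\<And>k. h k = f k ** g k" "finite F"
  shows "mprod f F ** mprod g F = mprod h F"
  using assms(6)
proof (induction F rule: finite_induct)
  case (insert k F)
  have "mprod f F ** g k = g k ** mprod f F"
    using mprod_commute[OF assms(1) insert.hyps(1), of "g k"] assms(4) by simp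
  then have "f k ** mprod f F ** (g k ** mprod g F) = f k ** g k ** (mprod f F ** mprod g F)"
    by (metis matrix_mul_assoc)
  then show ?case
    using insert
    by (simp add: mprod_insert[OF assms(1)] mprod_insert[OF assms(2)] mprod_insert[OF assms(3)]
      flip: assms(5))
qed simp

lemma mprod_hermitian:
  assumes "commuting f" "\<And>k. hermitian (f k)" "finite F"
  shows "hermitian (mprod f F)"
  using assms(3)
proof (induction F rule: finite_induct)
  case (insert k F)
  then show ?case
    using mprod_commute[OF assms(1) insert.hyps(1), of "f k"] assms(1,2)
    by (simp add: mprod_insert hermitian_def dagger_mult commuting_def)
qed (simp add: hermitian_def)

section \<open>Projections of trace one\<close>

lemma ketbra_mult: "ketbra a b ** ketbra c d = cinner b c \<cdot>\<^sub>m ketbra a d"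
proof -
  have "(ketbra a b ** ketbra c d) $ i $ j = (a $ i * cnj (d $ j)) * cinner b c" for i j
    by (simp add: ketbra_def matrix_matrix_mult_def cinner_def sum_distrib_left mult_ac)
  then show ?thesis by (simp add: vec_eq_iff scale_mat_def) (simp add: ketbra_def mult_ac)
qed

text \<open>A unit vector \<open>\<psi>\<close> in the range of \<open>E\<close> gives a projection
  \<open>ketbra \<psi> \<psi>\<close> below \<open>E\<close>. The difference is again a projection,
  of trace zero, so it vanishes.\<close>

lemma rank_one_projection:
  assumes E: "hermitian E" "E ** E = E" "trace E = 1"
  shows "E ** Y ** E = trace (E ** Y) \<cdot>\<^sub>m E"
proof -
  have "E \<noteq> 0" using E(3) by auto
  then obtain v where v: "E *v v \<noteq> 0" by (metis matrix_eq matrix_vector_mult_0)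
  define \<psi> where "\<psi> = complex_of_real (1 / norm (E *v v)) *s (E *v v)"
  have \<psi>1: "cinner \<psi> \<psi> = 1"
    using v by (simp add: \<psi>_def cinner_smult_left cinner_smult_right cinner_self[of "E *v v"]
      power2_eq_square)
  have E\<psi>: "E *v \<psi> = \<psi>"
    by (simp add: \<psi>_def vec.scale matrix_vector_mul_assoc E)
  let ?K = "ketbra \<psi> \<psi>"
  have mk: "A ** ?K = ketbra (A *v \<psi>) \<psi>" for A
    by (simp add: ketbra_def vec_eq_iff matrix_matrix_mult_def matrix_vector_mult_def sum_distrib_right mult.assoc)
  have hK: "dagger ?K = ?K" by (simp add: ketbra_def dagger_def vec_eq_iff mult.commute)
  have EK: "E ** ?K = ?K" by (simp add: mk E\<psi>)
  then have KE: "?K ** E = ?K" using hK E(1) by (metis dagger_mult hermitian_def)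
  have KK: "?K ** ?K = ?K" by (simp add: ketbra_mult \<psi>1)
  have trK: "trace (ketbra x \<psi>) = cinner \<psi> x" for x
    by (simp add: trace_def ketbra_def cinner_def mult.commute)
  have "dagger (E - ?K) ** (E - ?K) = E - ?K"
    using E(1) by (simp add: dagger_diff hK hermitian_def matrix_ring E(2) EK KE KK)
  then have "E - ?K = 0"
    by (intro norm_eq_0_of_trace) (simp add: trace_sub E trK \<psi>1)
  then have EK: "E = ?K" by simp
  have "?K ** (Y ** ?K) = cinner \<psi> (Y *v \<psi>) \<cdot>\<^sub>m ?K"
    by (simp add: mk ketbra_mult)
  moreover have "trace (?K ** Y) = cinner \<psi> (Y *v \<psi>)"
    by (simp add: trace_mul_sym[of ?K] mk trK)
  ultimately show ?thesis by (simp add: EK matrix_mul_assoc)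
qed

section \<open>Majorana operators\<close>

lemma majorana_square:
  assumes "majorana w"
  shows "w i ** w i = mat 1"
proof -
  have "w i ** w i + w i ** w i = mat 2" using assms by (simp add: majorana_def)
  then have "2 * (w i ** w i) $ a $ b = mat 2 $ a $ b" for a b
    by (metis mult_2 vector_add_component)
  then show ?thesis
    by (simp add: vec_eq_iff mat_def) (metis (no_types, lifting) mult_cancel_left1 mult_eq_0_iff zero_neq_numeral)
qed

lemma majorana_anticommute: "majorana w \<Longrightarrow> i \<noteq> j \<Longrightarrow> w i ** w j = - (w j ** w i)"
  by (simp add: majorana_def eq_neg_iff_add_eq_0 mat_def vec_eq_iff)

lemma trace_anticommutator:
  fixes w :: "'n + 'n \<Rightarrow> complex^'d^'d"
  assumes "majorana w"
  shows "trace (X ** (w i ** w j + w j ** w i)) = (if i = j then 2 * trace X else 0)"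
proof -
  have "(mat 2 :: complex^'d^'d) = 2 \<cdot>\<^sub>m mat 1" by (simp add: mat_def scale_mat_def vec_eq_iff)
  moreover have "(mat 0 :: complex^'d^'d) = 0" by (simp add: mat_def vec_eq_iff)
  ultimately show ?thesis
    using assms by (simp add: majorana_def scale_mat_mult_right trace_smult matrix_zero_right)
qed

locale majorana_modes =
  fixes z :: "'n::finite + 'n \<Rightarrow> complex^'d::finite^'d"
  assumes maj: "majorana z"
begin

text \<open>The hermitian involution (parity) of mode \<open>k\<close>. These involutions commute
  with each other, and the \<open>k\<close>-th factor of a Gaussian state is
  \<open>(1 - c k x k) / 2\<close>.\<close>

definition x where "x k = \<i> \<cdot>\<^sub>m (z (Inl k) ** z (Inr k))"

lemma sq: "z i ** z i = mat 1" and sq': "A ** z i ** z i = A"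
  using majorana_square[OF maj] by (simp_all flip: matrix_mul_assoc)

lemma ac: "i \<noteq> j \<Longrightarrow> z i ** z j = - (z j ** z i)"
  by (rule majorana_anticommute[OF maj])

lemma z_hermitian: "dagger (z i) = z i"
  using maj by (simp add: majorana_def hermitian_def)

lemma z_triple: "a \<noteq> b \<Longrightarrow> a \<noteq> c \<Longrightarrow> z a ** (z b ** z c) = z b ** z c ** z a"
proof -
  assume ab: "a \<noteq> b" and acc: "a \<noteq> c"
  have "z a ** (z b ** z c) = - (z b ** (z a ** z c))"
    by (simp add: matrix_mul_assoc ac[OF ab] matrix_minus_left)
  also have "\<dots> = z b ** z c ** z a" by (simp add: ac[OF acc] matrix_minus_right matrix_mul_assoc)
  finally show ?thesis .
qed

lemma x_commute_z: "a \<noteq> Inl k \<Longrightarrow> a \<noteq> Inr k \<Longrightarrow> z a ** x k = x k ** z a"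
  by (simp add: x_def scale_mat_mult_left scale_mat_mult_right z_triple)

lemma zx: "z (Inl k) ** x k = \<i> \<cdot>\<^sub>m z (Inr k)" "x k ** z (Inl k) = - (\<i> \<cdot>\<^sub>m z (Inr k))"
  "z (Inr k) ** x k = - (\<i> \<cdot>\<^sub>m z (Inl k))" "x k ** z (Inr k) = \<i> \<cdot>\<^sub>m z (Inl k)"
proof -
  have a: "z (Inr k) ** z (Inl k) = - (z (Inl k) ** z (Inr k))" by (rule ac) simp
  show "z (Inl k) ** x k = \<i> \<cdot>\<^sub>m z (Inr k)"
    by (simp add: x_def scale_mat_mult_right matrix_mul_assoc sq)
  show "x k ** z (Inr k) = \<i> \<cdot>\<^sub>m z (Inl k)"
    by (simp add: x_def scale_mat_mult_left sq')
  have "z (Inl k) ** z (Inr k) ** z (Inl k) = - (z (Inl k) ** z (Inl k) ** z (Inr k))"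
    by (simp add: a matrix_minus_right flip: matrix_mul_assoc)
  then show "x k ** z (Inl k) = - (\<i> \<cdot>\<^sub>m z (Inr k))"
    by (simp add: x_def scale_mat_mult_left sq scale_mat_minus_right)
  have "z (Inr k) ** (z (Inl k) ** z (Inr k)) = - z (Inl k)"
    by (simp add: matrix_mul_assoc a matrix_minus_left sq')
  then show "z (Inr k) ** x k = - (\<i> \<cdot>\<^sub>m z (Inl k))"
    by (simp add: x_def scale_mat_mult_right scale_mat_minus_right)
qed

lemma x_square: "x k ** x k = mat 1"
proof -
  have "x k ** x k = \<i> \<cdot>\<^sub>m (x k ** z (Inl k) ** z (Inr k))"
    by (subst (2) x_def) (simp add: scale_mat_mult_right matrix_mul_assoc)
  then show ?thesis by (simp add: zx matrix_minus_left scale_mat_mult_left sq scale_mat_smult scale_mat_minus_right)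
      (simp add: scale_mat_def vec_eq_iff)
qed

lemma x_commute: "x j ** x k = x k ** x j"
proof (cases "j = k")
  case False
  have "x j ** x k = \<i> \<cdot>\<^sub>m (z (Inl j) ** (z (Inr j) ** x k))"
    by (simp add: x_def[of j] scale_mat_mult_left matrix_mul_assoc)
  also have "\<dots> = \<i> \<cdot>\<^sub>m (z (Inl j) ** x k ** z (Inr j))"
    using False by (simp add: x_commute_z matrix_mul_assoc)
  also have "\<dots> = x k ** x j"
    using False by (simp add: x_commute_z x_def[of j] scale_mat_mult_right matrix_mul_assoc)
  finally show ?thesis .
qed simp

lemma x_hermitian: "dagger (x k) = x k"
proof -
  have "z (Inr k) ** z (Inl k) = - (z (Inl k) ** z (Inr k))" by (rule ac) simp
  then show ?thesis
    by (simp add: x_def dagger_smult dagger_mult z_hermitian scale_mat_minus_right scale_mat_minus_left)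
qed

text \<open>As every \<open>x k\<close> squares to one, products of such factors multiply mode by
  mode and stay in the family. Gaussian states, their square roots and the joint spectral
  projections of the \<open>x k\<close> are all of this form.\<close>

definition fac :: "('n \<Rightarrow> complex) \<Rightarrow> ('n \<Rightarrow> complex) \<Rightarrow> 'n \<Rightarrow> complex^'d^'d"
  where "fac a b k = a k \<cdot>\<^sub>m mat 1 - b k \<cdot>\<^sub>m x k"

lemma fac_commute: "fac a b j ** fac a' b' k = fac a' b' k ** fac a b j"
  by (simp add: fac_def matrix_alg x_commute[of j k] mult.commute algebra_simps)

lemma fac_commuting: "commuting (fac a b)"
  by (simp add: commuting_def fac_commute)

lemma fac_mult:
  "fac a b k ** fac a' b' k = fac (\<lambda>k. a k * a' k + b k * b' k) (\<lambda>k. a k * b' k + b k * a' k) k"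
  by (simp add: fac_def matrix_alg x_square scale_mat_add_left algebra_simps)

lemma fac_commute_z: "a' \<noteq> Inl k \<Longrightarrow> a' \<noteq> Inr k \<Longrightarrow> z a' ** fac a b k = fac a b k ** z a'"
  by (simp add: fac_def matrix_alg x_commute_z)

lemmas fac_insert = mprod_insert[OF fac_commuting]

lemma fac_product: "mprod (fac a b) F ** mprod (fac a' b') F
    = mprod (fac (\<lambda>k. a k * a' k + b k * b' k) (\<lambda>k. a k * b' k + b k * a' k)) F"
  by (rule mprod_mult) (auto simp: fac_commuting fac_commute fac_mult)

lemma fac_product_commute: "fac a b k ** mprod (fac a' b') F = mprod (fac a' b') F ** fac a b k"
  by (rule mprod_commute) (auto simp: fac_commuting fac_commute)

lemma fac_product_commute_z:
  assumes "k \<notin> F" shows "z (Inl k) ** mprod (fac a b) F = mprod (fac a b) F ** z (Inl k)"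
    and "z (Inr k) ** mprod (fac a b) F = mprod (fac a b) F ** z (Inr k)"
  using assms by (auto intro!: mprod_commute fac_commuting fac_commute_z)

lemma fac_product_hermitian:
  "hermitian (mprod (fac (\<lambda>k. complex_of_real (a k)) (\<lambda>k. complex_of_real (b k))) F)"
  by (rule mprod_hermitian) (auto simp: fac_commuting hermitian_def fac_def dagger_diff dagger_smult x_hermitian)

lemma fac_product_remove: "mprod (fac a b) UNIV = fac a b k ** mprod (fac a b) (UNIV - {k})"
  using fac_insert[of "UNIV - {k}" k a b] by (simp add: insert_UNIV)

text \<open>In \<open>tr (x k g)\<close>, with \<open>g\<close> made of other modes,
  \<open>z (Inl k)\<close> can be moved around the trace: it commutes with \<open>g\<close> but
  anticommutes with \<open>z (Inr k)\<close>, so the trace vanishes. Only the scalar parts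
  \<open>a k\<close> contribute.\<close>

lemma trace_fac_product: "trace (mprod (fac a b) F) = of_nat (CARD('d)) * (\<Prod>k\<in>F. a k)"
proof (induction F rule: infinite_finite_induct)
  case (insert k F)
  let ?G = "mprod (fac a b) F"
  have zz: "z (Inr k) ** z (Inl k) = - (z (Inl k) ** z (Inr k))" by (rule ac) simp
  have "trace (z (Inl k) ** z (Inr k) ** ?G) = trace (z (Inr k) ** (?G ** z (Inl k)))"
    using trace_mul_sym[of "z (Inl k)" "z (Inr k) ** ?G"] by (simp add: matrix_mul_assoc)
  also have "\<dots> = trace (z (Inr k) ** z (Inl k) ** ?G)"
    using insert by (simp add: fac_product_commute_z matrix_mul_assoc flip: fac_product_commute_z)
  also have "\<dots> = - trace (z (Inl k) ** z (Inr k) ** ?G)"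
    by (simp add: zz matrix_minus_left trace_minus)
  finally have "trace (z (Inl k) ** z (Inr k) ** ?G) = 0" by simp
  then have "trace (x k ** ?G) = 0" by (simp add: x_def scale_mat_mult_left trace_smult)
  then show ?case
    using insert by (simp add: fac_insert) (simp add: fac_def matrix_alg trace_sub trace_smult)
qed (simp_all add: trace_I mprod_def)

section \<open>The normal form of a Gaussian state\<close>

definition partner :: "'n + 'n \<Rightarrow> 'n + 'n"
  where "partner = case_sum Inr Inl"

text \<open>In the rotated basis, row \<open>a\<close> of the correlation matrix has
  \<open>signed c a\<close> in column \<open>partner a\<close> and zeros elsewhere.\<close>

definition signed :: "('n \<Rightarrow> real) \<Rightarrow> 'n + 'n \<Rightarrow> complex"
  where "signed c = case_sum (\<lambda>k. \<i> * c k) (\<lambda>k. - \<i> * c k)"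

definition normal_state :: "('n \<Rightarrow> real) \<Rightarrow> complex^'d^'d"
  where "normal_state c = mprod (fac (\<lambda>k. complex_of_real (1/2)) (\<lambda>k. complex_of_real (c k / 2))) UNIV"

text \<open>All factors but one commute with \<open>z a\<close>. This leaves the single-mode
  identities \<open>[z1, f] = - i c z2\<close> and \<open>{z1, f} = z1\<close> for
  \<open>f = (1 - c x) / 2\<close>, and their counterparts for \<open>z2\<close>.\<close>

lemma normal_state_relation:
  "z a ** normal_state c - normal_state c ** z a
    + signed c a \<cdot>\<^sub>m (z (partner a) ** normal_state c + normal_state c ** z (partner a)) = 0"
proof -
  define k where "k = case_sum id id a"
  define f where "f = fac (\<lambda>k. complex_of_real (1/2)) (\<lambda>k. complex_of_real (c k / 2)) k"
  define g where "g = mprod (fac (\<lambda>k. complex_of_real (1/2)) (\<lambda>k. complex_of_real (c k / 2))) (UNIV - {k})"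
  have n: "normal_state c = f ** g"
    by (simp add: normal_state_def f_def g_def fac_product_remove[of _ _ k])
  have gz: "g ** z (Inl k) = z (Inl k) ** g" "g ** z (Inr k) = z (Inr k) ** g"
    by (simp_all add: g_def fac_product_commute_z)
  have r: "Y ** (f ** g) - f ** g ** Y = (Y ** f - f ** Y) ** g"
      "Y ** (f ** g) + f ** g ** Y = (Y ** f + f ** Y) ** g" if "g ** Y = Y ** g" for Y
    using that by (simp_all add: matrix_ring) (simp_all add: that flip: matrix_mul_assoc)
  have f: "z (Inl k) ** f - f ** z (Inl k) = - ((\<i> * c k) \<cdot>\<^sub>m z (Inr k))"
    "z (Inr k) ** f - f ** z (Inr k) = (\<i> * c k) \<cdot>\<^sub>m z (Inl k)"
    "z (Inl k) ** f + f ** z (Inl k) = z (Inl k)" "z (Inr k) ** f + f ** z (Inr k) = z (Inr k)"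
    by (simp_all add: f_def fac_def matrix_alg zx) (simp_all add: scale_mat_def vec_eq_iff)
  show ?thesis
  proof (cases a)
    case (Inl l)
    then have "a = Inl k" by (simp add: k_def)
    then show ?thesis
      by (simp add: n r gz f partner_def signed_def matrix_minus_left scale_mat_mult_left)
  next
    case (Inr l)
    then have "a = Inr k" by (simp add: k_def)
    then show ?thesis
      by (simp add: n r gz f partner_def signed_def matrix_minus_left scale_mat_mult_left scale_mat_minus_left)
  qed
qed

lemma normal_state_psd:
  assumes "\<And>k. \<bar>c k\<bar> \<le> 1"
  shows "psd (normal_state c)"
proof -
  \<comment> \<open>The eigenvalues of the root for \<open>x k = - 1\<close> and for
    \<open>x k = 1\<close>, where the factor itself has \<open>(1 + c k) / 2\<close> and
    \<open>(1 - c k) / 2\<close>.\<close>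
  define p q where "p k = sqrt ((1 + c k) / 2)" and "q k = sqrt ((1 - c k) / 2)" for k
  have pq: "p k * p k = (1 + c k) / 2" "q k * q k = (1 - c k) / 2" for k
    using assms[of k] by (auto simp: p_def q_def)
  define S where "S = mprod (fac (\<lambda>k. complex_of_real ((p k + q k) / 2)) (\<lambda>k. complex_of_real ((p k - q k) / 2))) UNIV"
  have 1: "(p k + q k) / 2 * ((p k + q k) / 2) + (p k - q k) / 2 * ((p k - q k) / 2) = 1/2" for k
  proof -
    have "(p k + q k) / 2 * ((p k + q k) / 2) + (p k - q k) / 2 * ((p k - q k) / 2) = (p k * p k + q k * q k) / 2"
      by (simp add: field_simps)
    then show ?thesis by (simp add: pq field_simps)
  qed
  have 2: "(p k + q k) / 2 * ((p k - q k) / 2) + (p k - q k) / 2 * ((p k + q k) / 2) = c k / 2" for k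
  proof -
    have "(p k + q k) / 2 * ((p k - q k) / 2) + (p k - q k) / 2 * ((p k + q k) / 2) = (p k * p k - q k * q k) / 2"
      by (simp add: field_simps)
    then show ?thesis by (simp add: pq field_simps)
  qed
  have "S ** S = normal_state c"
    unfolding S_def fac_product normal_state_def
    by (simp only: 1 2 flip: of_real_mult of_real_add)
  moreover have "hermitian S" unfolding S_def by (rule fac_product_hermitian)
  ultimately show ?thesis using psd_square[of S] by simp
qed

section \<open>Joint spectral projections of the mode involutions, for prescribed signs\<close>

definition proj :: "('n \<Rightarrow> real) \<Rightarrow> 'n set \<Rightarrow> complex^'d^'d"
  where "proj \<sigma> F = mprod (fac (\<lambda>k. complex_of_real (1/2)) (\<lambda>k. complex_of_real (- \<sigma> k / 2))) F"

lemma proj_hermitian: "hermitian (proj \<sigma> F)"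
  unfolding proj_def by (rule fac_product_hermitian)

lemma proj_idem:
  assumes "\<And>k. \<sigma> k * \<sigma> k = 1"
  shows "proj \<sigma> F ** proj \<sigma> F = proj \<sigma> F"
proof -
  have 1: "1/2 * (1/2) + (- \<sigma> k / 2) * (- \<sigma> k / 2) = 1/2" "1/2 * (- \<sigma> k / 2) + (- \<sigma> k / 2) * (1/2) = - \<sigma> k / 2" for k
    using assms[of k] by (simp_all add: field_simps)
  show ?thesis
    unfolding proj_def fac_product by (simp only: 1 flip: of_real_mult of_real_add)
qed

lemma proj_insert:
  "finite F \<Longrightarrow> k \<notin> F \<Longrightarrow> proj \<sigma> (insert k F) = (1/2) \<cdot>\<^sub>m (proj \<sigma> F + (\<sigma> k) \<cdot>\<^sub>m (x k ** proj \<sigma> F))"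
  unfolding proj_def
  by (simp add: fac_insert) (simp add: fac_def matrix_alg scale_mat_minus_left)

lemma proj_cong: "finite F \<Longrightarrow> (\<And>k. k \<in> F \<Longrightarrow> \<sigma> k = \<tau> k) \<Longrightarrow> proj \<sigma> F = proj \<tau> F"
  unfolding proj_def by (rule mprod_cong) (auto simp: fac_commuting fac_def)

lemma x_proj:
  assumes "\<And>k. \<sigma> k * \<sigma> k = 1" "finite F" "k \<notin> F"
  shows "x k ** proj \<sigma> (insert k F) = \<sigma> k \<cdot>\<^sub>m proj \<sigma> (insert k F)"
    "proj \<sigma> (insert k F) ** x k = \<sigma> k \<cdot>\<^sub>m proj \<sigma> (insert k F)"
proof -
  have "complex_of_real (\<sigma> k) * complex_of_real (\<sigma> k) = 1" using assms(1)[of k] by (metis of_real_1 of_real_mult)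
  then show "x k ** proj \<sigma> (insert k F) = \<sigma> k \<cdot>\<^sub>m proj \<sigma> (insert k F)"
    by (simp add: proj_insert assms matrix_alg x_square mult.left_commute)
  moreover have "x k = fac (\<lambda>_. 0) (\<lambda>_. - 1) k" by (simp add: fac_def scale_mat_minus_left)
  then have "proj \<sigma> (insert k F) ** x k = x k ** proj \<sigma> (insert k F)"
    by (simp add: proj_def fac_product_commute)
  ultimately show "proj \<sigma> (insert k F) ** x k = \<sigma> k \<cdot>\<^sub>m proj \<sigma> (insert k F)" by simp
qed

text \<open>\<open>z (Inl k)\<close> anticommutes with \<open>x k\<close> and commutes with the
  factors of the other modes.\<close>

lemma proj_flip:
  assumes "finite F" "k \<notin> F"
  shows "z (Inl k) ** proj \<sigma> (insert k F) ** z (Inl k) = proj (\<sigma>(k := - \<sigma> k)) (insert k F)"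
proof -
  let ?G = "proj \<sigma> F"
  have G: "?G ** z (Inl k) = z (Inl k) ** ?G" by (simp add: proj_def fac_product_commute_z assms)
  have "proj (\<sigma>(k := - \<sigma> k)) F = ?G" using assms by (intro proj_cong) auto
  moreover have "z (Inl k) ** ?G ** z (Inl k) = ?G"
    by (simp add: G sq flip: matrix_mul_assoc) (simp add: matrix_mul_assoc sq)
  moreover have "z (Inl k) ** (x k ** ?G) ** z (Inl k) = - (x k ** ?G)"
  proof -
    have "z (Inl k) ** (x k ** ?G) ** z (Inl k) = z (Inl k) ** x k ** z (Inl k) ** ?G"
      by (simp add: G flip: matrix_mul_assoc)
    also have "z (Inl k) ** x k ** z (Inl k) = \<i> \<cdot>\<^sub>m (z (Inr k) ** z (Inl k))"
      by (simp add: zx scale_mat_mult_left)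
    also have "\<dots> = - x k"
      by (simp add: ac[of "Inr k" "Inl k"] scale_mat_minus_right x_def)
    finally show ?thesis by (simp add: matrix_minus_left)
  qed
  ultimately show ?thesis
    by (simp add: proj_insert assms matrix_alg scale_mat_minus_left)
qed

lemma proj_add_flip:
  assumes "finite F" "k \<notin> F"
  shows "proj \<sigma> (insert k F) + proj (\<sigma>(k := - \<sigma> k)) (insert k F) = proj \<sigma> F"
proof -
  have "proj (\<sigma>(k := - \<sigma> k)) F = proj \<sigma> F" using assms by (intro proj_cong) auto
  then show ?thesis
    using assms by (simp add: proj_insert scale_mat_minus_left scale_mat_add_right scale_mat_minus_right)
      (simp add: scale_mat_def vec_eq_iff field_simps)
qed

text \<open>The relation forces \<open>X\<close> to commute with every \<open>x k\<close> and \<open>tr (X E)\<close> not to change when one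
  sign of the joint spectral projection \<open>E\<close> of the \<open>x k\<close>, \<open>k \<in> F\<close>, is flipped. So these traces
  vanish along with \<open>tr X\<close>. For \<open>F = UNIV\<close> the projections have rank one, as \<open>d = 2^n\<close>.\<close>

lemma relation_kernel:
  assumes dim: "CARD('d) = 2 ^ CARD('n)"
    and rel: "\<And>a. z a ** X - X ** z a + signed c a \<cdot>\<^sub>m (z (partner a) ** X + X ** z (partner a)) = 0"
    and tr: "trace X = 0"
  shows "X = 0"
proof -
  have r1: "z (Inl k) ** X - X ** z (Inl k) = - ((\<i> * c k) \<cdot>\<^sub>m (z (Inr k) ** X + X ** z (Inr k)))" for k
    using rel[of "Inl k"] by (simp add: signed_def partner_def eq_neg_iff_add_eq_0)
  have r2: "z (Inr k) ** X - X ** z (Inr k) = (\<i> * c k) \<cdot>\<^sub>m (z (Inl k) ** X + X ** z (Inl k))" for k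
    using rel[of "Inr k"] by (simp add: signed_def partner_def scale_mat_minus_left)
  \<comment> \<open>The commutator is computed twice, from \<open>x k = i a b\<close> and from
    \<open>x k = - i b a\<close>. The relation gives results of opposite sign, so it
    vanishes.\<close>
  have xX: "x k ** X = X ** x k" for k
  proof -
    let ?a = "z (Inl k)" and ?b = "z (Inr k)"
    have ba: "?b ** ?a = - (?a ** ?b)" by (rule ac) simp
    have "x k ** X - X ** x k = \<i> \<cdot>\<^sub>m (?a ** (?b ** X - X ** ?b) + (?a ** X - X ** ?a) ** ?b)"
      by (simp add: x_def matrix_alg)
    also have "\<dots> = - (complex_of_real (c k) \<cdot>\<^sub>m (?a ** X ** ?a - ?b ** X ** ?b))"
      unfolding r1 r2 by (simp add: matrix_alg sq sq' scale_mat_minus_left)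
    finally have e1: "x k ** X - X ** x k = - (complex_of_real (c k) \<cdot>\<^sub>m (?a ** X ** ?a - ?b ** X ** ?b))" .
    have xb: "x k = - (\<i> \<cdot>\<^sub>m (?b ** ?a))" by (simp add: x_def ba scale_mat_minus_right)
    have "x k ** X - X ** x k = - (\<i> \<cdot>\<^sub>m (?b ** (?a ** X - X ** ?a) + (?b ** X - X ** ?b) ** ?a))"
      by (simp add: xb matrix_alg)
    also have "\<dots> = complex_of_real (c k) \<cdot>\<^sub>m (?a ** X ** ?a - ?b ** X ** ?b)"
      unfolding r1 r2 by (simp add: matrix_alg sq sq' scale_mat_minus_left)
    finally have e2: "x k ** X - X ** x k = complex_of_real (c k) \<cdot>\<^sub>m (?a ** X ** ?a - ?b ** X ** ?b)" .
    from e1 e2 have "x k ** X - X ** x k = - (x k ** X - X ** x k)" by simp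
    then show ?thesis by (simp add: vec_eq_iff eq_neg_iff_add_eq_0)
  qed
  have Xa: "X - z (Inl k) ** X ** z (Inl k)
      = - (complex_of_real (c k) \<cdot>\<^sub>m (x k ** X + z (Inl k) ** X ** z (Inl k) ** x k))" for k
  proof -
    let ?a = "z (Inl k)" and ?b = "z (Inr k)"
    have "X - ?a ** X ** ?a = ?a ** (?a ** X - X ** ?a)"
      by (simp add: matrix_ring sq)
    also have "\<dots> = - ((\<i> * c k) \<cdot>\<^sub>m (?a ** ?b ** X + ?a ** X ** ?b))"
      unfolding r1 by (simp add: matrix_alg)
    also have "\<dots> = - (complex_of_real (c k) \<cdot>\<^sub>m (x k ** X + ?a ** X ** ?a ** x k))"
      by (simp add: x_def matrix_alg sq' mult.commute)
    finally show ?thesis .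
  qed
  have tr0: "trace (X ** proj \<sigma> F) = 0" if "\<And>k. \<sigma> k * \<sigma> k = 1" "finite F" for \<sigma> F
    using that(2,1)
  proof (induction F arbitrary: \<sigma> rule: finite_induct)
    case empty
    then show ?case by (simp add: proj_def tr)
  next
    case (insert k F)
    let ?a = "z (Inl k)" and ?E = "proj \<sigma> (insert k F)" and ?\<sigma>' = "\<sigma>(k := - \<sigma> k)"
    let ?E' = "proj ?\<sigma>' (insert k F)"
    have "?E + ?E' = proj \<sigma> F" using insert.hyps by (rule proj_add_flip)
    then have 1: "trace (X ** ?E) + trace (X ** ?E') = 0"
      using insert.IH[OF insert.prems] by (simp flip: trace_add matrix_add_ldistrib)
    have flip: "trace (?a ** X ** ?a ** ?E) = trace (X ** ?E')"
      using trace_mul_sym[of ?a "X ** ?a ** ?E"]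
      by (simp add: matrix_mul_assoc flip: proj_flip[OF insert.hyps(1,2), of \<sigma>])
    \<comment> \<open>On \<open>?E\<close> the involution \<open>x k\<close> is the number
      \<open>\<sigma> k\<close>. So the right-hand side depends on the traces for \<open>?E\<close>
      and \<open>?E'\<close> only through their sum, which is zero by the induction
      hypothesis.\<close>
    have "trace ((X - ?a ** X ** ?a) ** ?E)
        = - (complex_of_real (c k) * (trace (x k ** X ** ?E) + trace (?a ** X ** ?a ** (x k ** ?E))))"
      by (simp add: Xa matrix_alg trace_alg distrib_left)
    also have "trace (x k ** X ** ?E) = \<sigma> k * trace (X ** ?E)"
      using trace_mul_sym[of "x k" "X ** ?E"] x_proj(2)[OF insert.prems insert.hyps(1,2)]
      by (simp add: scale_mat_mult_right trace_smult flip: matrix_mul_assoc)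
    also have "trace (?a ** X ** ?a ** (x k ** ?E)) = \<sigma> k * trace (X ** ?E')"
      by (simp add: x_proj(1)[OF insert.prems insert.hyps(1,2)] scale_mat_mult_right trace_smult flip)
    finally have "trace (X ** ?E) - trace (X ** ?E')
        = - (complex_of_real (c k) * (\<sigma> k * (trace (X ** ?E) + trace (X ** ?E'))))"
      by (simp add: matrix_ring trace_sub flip distrib_left)
    then show ?case using 1 by (simp add: eq_neg_iff_add_eq_0)
  qed
  have XE: "X ** proj \<sigma> UNIV = 0" if s: "\<And>k. \<sigma> k * \<sigma> k = 1" for \<sigma>
  proof -
    let ?E = "proj \<sigma> UNIV"
    \<comment> \<open>The dimension enters here: each mode contributes a factor 1/2 to the trace of
      a full joint projection, and the identity has trace \<open>2 ^ n\<close>.\<close>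
    have "trace ?E = 1"
      by (simp add: proj_def trace_fac_product dim power_one_over)
    then have EXE: "?E ** X ** ?E = trace (?E ** X) \<cdot>\<^sub>m ?E"
      by (intro rank_one_projection proj_hermitian proj_idem s)
    have comm: "X ** ?E = ?E ** X"
      unfolding proj_def by (rule mprod_commute) (auto simp: fac_commuting fac_def matrix_alg xX)
    have "X ** ?E = X ** (?E ** ?E)" by (simp add: proj_idem s)
    also have "\<dots> = ?E ** X ** ?E" by (simp add: matrix_mul_assoc comm)
    finally have "X ** ?E = ?E ** X ** ?E" .
    then show ?thesis
      using EXE tr0[of \<sigma> UNIV, OF s] by (simp add: trace_mul_sym[of ?E])
  qed
  \<comment> \<open>Dropping the signs one at a time adds the projections up to the identity, which
    is \<open>proj\<close> of the empty set.\<close>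
  have "(\<forall>\<sigma>. (\<forall>k. \<sigma> k * \<sigma> k = (1::real)) \<longrightarrow> X ** proj \<sigma> F = 0) \<longrightarrow> X = 0" if "finite F" for F
    using that
  proof (induction F rule: finite_induct)
    case empty
    show ?case by (auto simp: proj_def intro: exI[of _ "\<lambda>_. 1"])
  next
    case (insert k F)
    have "X ** proj \<sigma> F = 0"
      if h: "\<forall>\<sigma>. (\<forall>k. \<sigma> k * \<sigma> k = (1::real)) \<longrightarrow> X ** proj \<sigma> (insert k F) = 0"
        and s: "\<forall>k. \<sigma> k * \<sigma> k = 1" for \<sigma>
    proof -
      let ?\<sigma>' = "\<sigma>(k := - \<sigma> k)"
      have sum: "proj \<sigma> (insert k F) + proj ?\<sigma>' (insert k F) = proj \<sigma> F"
        using insert.hyps by (rule proj_add_flip)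
      have "X ** proj \<sigma> (insert k F) = 0" "X ** proj ?\<sigma>' (insert k F) = 0"
        using h s by auto
      then show ?thesis by (simp add: matrix_add_ldistrib flip: sum)
    qed
    then show ?case using insert.IH by blast
  qed
  then show ?thesis using XE by (metis finite_class.finite_UNIV)
qed

end

section \<open>The linear relation characterizing Gaussian states\<close>

definition twisted_commutator ::
    "('i \<Rightarrow> complex^'d^'d) \<Rightarrow> complex^'i^'i \<Rightarrow> complex^'d^'d \<Rightarrow> (complex^'d^'d)^'i"
  where "twisted_commutator w C X =
    (\<chi> i. w i ** X - X ** w i + (\<Sum>j\<in>UNIV. C $ i $ j \<cdot>\<^sub>m (w j ** X + X ** w j)))"

lemma twisted_commutator_component:
  assumes "twisted_commutator w C X = Y"
  shows "w i ** X - X ** w i = Y $ i - (\<Sum>j\<in>UNIV. C $ i $ j \<cdot>\<^sub>m (w j ** X + X ** w j))"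
  unfolding assms[symmetric] twisted_commutator_def by simp

text \<open>What a change \<open>A\<close> of the correlation matrix adds to the relation: bilinear,
  while \<open>twisted_commutator\<close> is affine in \<open>C\<close>.\<close>

definition anticommutator_sum ::
    "('i::finite \<Rightarrow> complex^'d^'d) \<Rightarrow> complex^'i^'i \<Rightarrow> complex^'d^'d \<Rightarrow> (complex^'d^'d)^'i"
  where "anticommutator_sum w A X = (\<chi> i. \<Sum>j\<in>UNIV. A $ i $ j \<cdot>\<^sub>m (w j ** X + X ** w j))"

lemma anticommutator_sum_component:
  "anticommutator_sum w A X $ i = (\<Sum>j\<in>UNIV. A $ i $ j \<cdot>\<^sub>m (w j ** X + X ** w j))"
  by (simp add: anticommutator_sum_def)

lemma trace_anticommutator_product:
  fixes w :: "'n::finite + 'n \<Rightarrow> complex^'d^'d"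
  assumes "majorana w"
  shows "trace (anticommutator_sum w A X $ i ** w j) = 2 * trace X * A $ i $ j"
proof -
  have ac: "trace ((w k ** X + X ** w k) ** w j) = (if k = j then 2 * trace X else 0)" for k
    using trace_mul_sym[of "w k" "X ** w j"] trace_anticommutator[OF assms, of X j k]
    by (simp add: matrix_ring trace_add split: if_splits)
  have "trace (anticommutator_sum w A X $ i ** w j) = (\<Sum>k\<in>UNIV. A $ i $ k * trace ((w k ** X + X ** w k) ** w j))"
    by (simp only: anticommutator_sum_component matrix_sum_left trace_sum scale_mat_mult_left trace_smult)
  also have "\<dots> = 2 * trace X * A $ i $ j"
    unfolding ac by (simp add: if_distrib[of "\<lambda>y. _ * y"] cong: if_cong)
  finally show ?thesis .
qed

text \<open>Component \<open>i\<close> multiplied by \<open>w j\<close> isolates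
  \<open>C $ i $ j\<close> under the trace, because \<open>{w k, X}\<close> against
  \<open>w j\<close> leaves \<open>2 tr X\<close> for \<open>k = j\<close> only.\<close>

lemma trace_commutator_product:
  fixes w :: "'n::finite + 'n \<Rightarrow> complex^'d^'d"
  assumes w: "majorana w" and eq: "twisted_commutator w C X = Y"
  shows "trace (X ** (w i ** w j - w j ** w i)) = 2 * trace X * C $ i $ j - trace (Y $ i ** w j)"
proof -
  have "trace ((w i ** X - X ** w i) ** w j) = trace (X ** (w j ** w i - w i ** w j))"
    using trace_mul_sym[of "w i" "X ** w j"] by (simp add: matrix_ring trace_sub)
  moreover have "trace ((w i ** X - X ** w i) ** w j) = trace (Y $ i ** w j) - 2 * trace X * C $ i $ j"
    unfolding twisted_commutator_component[OF eq] anticommutator_sum_component[symmetric]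
    by (simp add: matrix_diff_rdistrib trace_sub trace_anticommutator_product[OF w])
  ultimately show ?thesis by (simp add: matrix_ring trace_sub algebra_simps)
qed

lemma correlation_matrix_of_relation:
  assumes "majorana w" "trace \<rho> = 1" "twisted_commutator w C \<rho> = 0"
  shows "correlation_matrix w \<rho> = C"
  using trace_commutator_product[OF assms(1,3)] assms(2)
  by (simp add: correlation_matrix_def vec_eq_iff matrix_zero_left)

section \<open>Orthogonal rotation of the Majorana operators\<close>

lemma orthogonal_matrix_entries:
  assumes "orthogonal_matrix (Q :: real^'i^'i)"
  shows "(\<Sum>j\<in>UNIV. Q $ a $ j * Q $ b $ j) = (if a = b then 1 else 0)"
    and "(\<Sum>a\<in>UNIV. Q $ a $ i * Q $ a $ j) = (if i = j then 1 else 0)"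
proof -
  have "(Q ** transpose Q) $ a $ b = mat 1 $ a $ b" "(transpose Q ** Q) $ i $ j = mat 1 $ i $ j"
    using assms by (simp_all add: orthogonal_matrix_def)
  then show "(\<Sum>j\<in>UNIV. Q $ a $ j * Q $ b $ j) = (if a = b then 1 else 0)"
    and "(\<Sum>a\<in>UNIV. Q $ a $ i * Q $ a $ j) = (if i = j then 1 else 0)"
    by (simp_all add: matrix_matrix_mult_def transpose_def mat_def)
qed

lemma majorana_rotated:
  assumes w: "majorana w" and Q: "orthogonal_matrix Q"
  shows "majorana (rotated_majorana w Q)"
proof -
  let ?z = "rotated_majorana w Q"
  have "hermitian (?z a)" for a
    using w by (simp add: hermitian_def majorana_def rotated_majorana_def dagger_sum dagger_smult)
  moreover have "?z a ** ?z b + ?z b ** ?z a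
      = (if a = b then mat 2 else mat 0)" for a b
  proof -
    have 0: "(mat 0 :: complex^'d^'d) = 0" by (simp add: mat_def vec_eq_iff)
    have "?z b ** ?z a
      = (\<Sum>i\<in>UNIV. \<Sum>j\<in>UNIV. complex_of_real (Q $ a $ i * Q $ b $ j) \<cdot>\<^sub>m (w j ** w i))"
      unfolding rotated_majorana_def matrix_sum_alg scale_mat_smult
      by (simp add: scale_mat_sum_right scale_mat_smult mult.commute)
    moreover have "?z a ** ?z b
      = (\<Sum>i\<in>UNIV. \<Sum>j\<in>UNIV. complex_of_real (Q $ a $ i * Q $ b $ j) \<cdot>\<^sub>m (w i ** w j))"
      unfolding rotated_majorana_def matrix_sum_alg scale_mat_smult
      by (subst sum.swap) (simp add: scale_mat_sum_right scale_mat_smult mult.commute)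
    ultimately have "?z a ** ?z b + ?z b ** ?z a
      = (\<Sum>i\<in>UNIV. \<Sum>j\<in>UNIV. complex_of_real (Q $ a $ i * Q $ b $ j) \<cdot>\<^sub>m (w i ** w j + w j ** w i))"
      by (simp add: scale_mat_add_right sum.distrib)
    also have "\<dots> = (\<Sum>i\<in>UNIV. complex_of_real (Q $ a $ i * Q $ b $ i) \<cdot>\<^sub>m mat 2)"
      using w by (simp add: majorana_def 0 if_distrib[of "\<lambda>y. _ \<cdot>\<^sub>m y"] cong: if_cong)
    also have "\<dots> = complex_of_real (\<Sum>i\<in>UNIV. Q $ a $ i * Q $ b $ i) \<cdot>\<^sub>m mat 2"
      by (simp add: scale_mat_sum_left)
    also have "\<dots> = (if a = b then mat 2 else mat 0)"
      by (simp only: orthogonal_matrix_entries[OF Q]) (simp add: 0)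
    finally show ?thesis .
  qed
  ultimately show ?thesis by (simp add: majorana_def)
qed

lemma sum_mult_rotated:
  "(\<Sum>i\<in>UNIV. complex_of_real (Q $ a $ i) \<cdot>\<^sub>m (w i ** X)) = rotated_majorana w Q a ** X"
  "(\<Sum>i\<in>UNIV. complex_of_real (Q $ a $ i) \<cdot>\<^sub>m (X ** w i)) = X ** rotated_majorana w Q a"
  by (simp_all add: rotated_majorana_def matrix_sum_alg)

locale gaussian_modes =
  fixes w :: "'n::finite + 'n \<Rightarrow> complex^'d::finite^'d" and Q :: "real^('n + 'n)^('n + 'n)" and c :: "'n \<Rightarrow> real"
  assumes w: "majorana w" and Q: "orthogonal_matrix Q" and dim: "CARD('d) = 2 ^ CARD('n)"
begin

sublocale modes: majorana_modes "rotated_majorana w Q"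
  by unfold_locales (rule majorana_rotated[OF w Q])

text \<open>The block form with entries \<open>signed c a\<close>, rotated back by \<open>Q\<close>.
  That it is the correlation matrix follows from the relation, without evaluating expectation
  values.\<close>

definition corr :: "complex^('n + 'n)^('n + 'n)"
  where "corr = (\<chi> i j. \<Sum>a\<in>UNIV. complex_of_real (Q $ a $ i) * modes.signed c a * complex_of_real (Q $ modes.partner a $ j))"

lemma gaussian_op_eq: "gaussian_op w Q c = modes.normal_state c"
proof -
  have "gaussian_factor w Q c = modes.fac (\<lambda>k. complex_of_real (1/2)) (\<lambda>k. complex_of_real (c k / 2))"
    by (rule ext) (simp add: gaussian_factor_def modes.fac_def modes.x_def scale_mat_diff_right scale_mat_smult mult.commute)
  then show ?thesis by (simp add: gaussian_op_def modes.normal_state_def mprod_def)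
qed

lemma corr_rotate: "(\<Sum>i\<in>UNIV. complex_of_real (Q $ a $ i) * corr $ i $ j)
    = modes.signed c a * complex_of_real (Q $ modes.partner a $ j)"
proof -
  have "(\<Sum>i\<in>UNIV. complex_of_real (Q $ a $ i) * corr $ i $ j)
      = (\<Sum>i\<in>UNIV. \<Sum>b\<in>UNIV. complex_of_real (Q $ a $ i * Q $ b $ i) * (modes.signed c b * complex_of_real (Q $ modes.partner b $ j)))"
    by (simp add: corr_def sum_distrib_left mult_ac)
  also have "\<dots> = (\<Sum>b\<in>UNIV. complex_of_real (\<Sum>i\<in>UNIV. Q $ a $ i * Q $ b $ i) * (modes.signed c b * complex_of_real (Q $ modes.partner b $ j)))"
    by (subst sum.swap) (simp add: sum_distrib_right)
  also have "\<dots> = modes.signed c a * complex_of_real (Q $ modes.partner a $ j)"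
    by (simp add: orthogonal_matrix_entries[OF Q] if_distrib[of complex_of_real] if_distrib[of "\<lambda>y. y * _"] cong: if_cong)
  finally show ?thesis .
qed

text \<open>Rotating the components by \<open>Q\<close> turns the relation into that of the normal
  form. As \<open>Q\<close> is orthogonal, the two are equivalent.\<close>

lemma rotated_relation:
  "(\<Sum>i\<in>UNIV. complex_of_real (Q $ a $ i) \<cdot>\<^sub>m twisted_commutator w corr X $ i)
    = rotated_majorana w Q a ** X - X ** rotated_majorana w Q a
      + modes.signed c a \<cdot>\<^sub>m (rotated_majorana w Q (modes.partner a) ** X + X ** rotated_majorana w Q (modes.partner a))"
proof -
  have "(\<Sum>i\<in>UNIV. complex_of_real (Q $ a $ i) \<cdot>\<^sub>m (\<Sum>j\<in>UNIV. corr $ i $ j \<cdot>\<^sub>m (w j ** X + X ** w j)))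
      = (\<Sum>i\<in>UNIV. \<Sum>j\<in>UNIV. (complex_of_real (Q $ a $ i) * corr $ i $ j) \<cdot>\<^sub>m (w j ** X + X ** w j))"
    by (simp add: scale_mat_sum_right scale_mat_smult)
  also have "\<dots> = (\<Sum>j\<in>UNIV. (\<Sum>i\<in>UNIV. complex_of_real (Q $ a $ i) * corr $ i $ j) \<cdot>\<^sub>m (w j ** X + X ** w j))"
    by (subst sum.swap) (simp add: scale_mat_sum_left)
  also have "\<dots> = modes.signed c a \<cdot>\<^sub>m (\<Sum>j\<in>UNIV. complex_of_real (Q $ modes.partner a $ j) \<cdot>\<^sub>m (w j ** X + X ** w j))"
    by (simp add: corr_rotate scale_mat_sum_right scale_mat_smult)
  finally show ?thesis
    by (simp add: twisted_commutator_def scale_mat_add_right scale_mat_diff_right sum.distrib sum_subtractf sum_mult_rotated)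
qed

lemma rotate_eq_0:
  assumes "\<And>a. (\<Sum>i\<in>UNIV. complex_of_real (Q $ a $ i) \<cdot>\<^sub>m Y i) = 0"
  shows "Y i = 0"
proof -
  have "0 = (\<Sum>a\<in>UNIV. complex_of_real (Q $ a $ i) \<cdot>\<^sub>m (\<Sum>j\<in>UNIV. complex_of_real (Q $ a $ j) \<cdot>\<^sub>m Y j))"
    by (simp add: assms)
  also have "\<dots> = (\<Sum>a\<in>UNIV. \<Sum>j\<in>UNIV. complex_of_real (Q $ a $ i * Q $ a $ j) \<cdot>\<^sub>m Y j)"
    by (simp add: scale_mat_sum_right scale_mat_smult)
  also have "\<dots> = (\<Sum>j\<in>UNIV. complex_of_real (\<Sum>a\<in>UNIV. Q $ a $ i * Q $ a $ j) \<cdot>\<^sub>m Y j)"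
    by (subst sum.swap) (simp add: scale_mat_sum_left)
  also have "\<dots> = Y i"
    by (simp add: orthogonal_matrix_entries[OF Q] if_distrib[of complex_of_real] if_distrib[of "\<lambda>y. y \<cdot>\<^sub>m _"] cong: if_cong)
  finally show ?thesis by simp
qed

lemma gaussian_relation: "twisted_commutator w corr (gaussian_op w Q c) = 0"
proof -
  have "twisted_commutator w corr (gaussian_op w Q c) $ i = 0" for i
    by (rule rotate_eq_0) (simp add: rotated_relation gaussian_op_eq modes.normal_state_relation)
  then show ?thesis by (simp add: vec_eq_iff)
qed

lemma gaussian_kernel:
  assumes "twisted_commutator w corr X = 0" "trace X = 0"
  shows "X = 0"
  by (rule modes.relation_kernel[OF dim _ assms(2), of c]) (simp add: assms(1) flip: rotated_relation)

lemma trace_gaussian: "trace (gaussian_op w Q c) = 1"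
  by (simp add: gaussian_op_eq modes.normal_state_def modes.trace_fac_product dim power_one_over)

lemma correlation_gaussian: "correlation_matrix w (gaussian_op w Q c) = corr"
  by (rule correlation_matrix_of_relation[OF w trace_gaussian gaussian_relation])

text \<open>The purity \<open>tr (\<rho> \<rho>)\<close> is the product of the
  \<open>(1 + (c k)^2) / 2\<close>, each of which is at most 1. An idempotent state has purity 1, so
  every factor is 1.\<close>

lemma pure_parameters:
  assumes "gaussian_op w Q c ** gaussian_op w Q c = gaussian_op w Q c" "\<And>k. \<bar>c k\<bar> \<le> 1"
  shows "(c k)\<^sup>2 = 1"
proof (rule ccontr)
  assume k: "(c k)\<^sup>2 \<noteq> 1"
  have le: "(c j)\<^sup>2 \<le> 1" for j using assms(2)[of j] by (simp add: abs_square_le_1)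
  define f where "f k = (1 + (c k)\<^sup>2) / 2" for k
  have eq: "complex_of_real (1/2) * complex_of_real (1/2) + complex_of_real (c k / 2) * complex_of_real (c k / 2)
      = complex_of_real (f k / 2)" for k
    by (simp add: f_def power2_eq_square field_simps)
  have "1 = trace (gaussian_op w Q c ** gaussian_op w Q c)" by (simp add: assms(1) trace_gaussian)
  also have "\<dots> = of_nat (CARD('d)) * (\<Prod>k\<in>UNIV. complex_of_real (f k / 2))"
    unfolding gaussian_op_eq modes.normal_state_def modes.fac_product modes.trace_fac_product eq ..
  also have "\<dots> = complex_of_real (2 ^ CARD('n) * (\<Prod>k\<in>UNIV. f k / 2))" by (simp add: dim)
  also have "(\<Prod>k\<in>UNIV. f k / 2) = (\<Prod>k\<in>UNIV. f k) / 2 ^ CARD('n)" by (simp add: prod_dividef)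
  finally have "complex_of_real (2 ^ CARD('n) * ((\<Prod>k\<in>UNIV. f k) / 2 ^ CARD('n))) = 1" by (rule sym)
  then have "(\<Prod>k\<in>UNIV. f k) = 1" by (simp only: of_real_eq_1_iff) (simp del: prod_dividef)
  moreover have "(\<Prod>k\<in>UNIV. f k) = f k * (\<Prod>k\<in>UNIV - {k}. f k)" by (rule prod.remove) auto
  moreover have "(\<Prod>k\<in>UNIV - {k}. f k) \<le> 1" by (intro prod_le_1) (use le in \<open>auto simp: f_def\<close>)
  moreover have "0 \<le> f k" by (simp add: f_def)
  moreover have "f k < 1" using le[of k] k by (simp add: f_def)
  moreover have "0 \<le> (\<Prod>k\<in>UNIV - {k}. f k)" by (intro prod_nonneg) (auto simp: f_def)
  ultimately show False
    using mult_left_le[of "\<Prod>k\<in>UNIV - {k}. f k" "f k"] by linarith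
qed

lemma corr_square:
  assumes "\<And>k. (c k)\<^sup>2 = 1"
  shows "corr ** corr = mat 1"
proof -
  have c: "complex_of_real (c k) * complex_of_real (c k) = 1" for k
    using assms[of k] by (metis of_real_1 of_real_mult power2_eq_square)
  have s: "modes.signed c a * modes.signed c (modes.partner a) = 1" "modes.partner (modes.partner a) = a" for a
    by (auto simp: modes.signed_def modes.partner_def c mult_ac split: sum.split)
  have "(corr ** corr) $ i $ l = mat 1 $ i $ l" for i l
  proof -
    have "(corr ** corr) $ i $ l = (\<Sum>j\<in>UNIV. \<Sum>a\<in>UNIV. complex_of_real (Q $ a $ i) * modes.signed c a
        * (complex_of_real (Q $ modes.partner a $ j) * corr $ j $ l))"
      by (simp add: matrix_matrix_mult_def corr_def[THEN arg_cong[of _ _ "\<lambda>M. M $ i $ _"]] sum_distrib_right mult.assoc)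
    also have "\<dots> = (\<Sum>a\<in>UNIV. complex_of_real (Q $ a $ i) * modes.signed c a
        * (\<Sum>j\<in>UNIV. complex_of_real (Q $ modes.partner a $ j) * corr $ j $ l))"
      by (subst sum.swap) (simp add: sum_distrib_left)
    also have "\<dots> = (\<Sum>a\<in>UNIV. complex_of_real (Q $ a $ i * Q $ a $ l) * (modes.signed c a * modes.signed c (modes.partner a)))"
      unfolding corr_rotate s(2) by (simp add: mult_ac)
    also have "\<dots> = complex_of_real (\<Sum>a\<in>UNIV. Q $ a $ i * Q $ a $ l)" by (simp add: s)
    finally show ?thesis by (simp add: orthogonal_matrix_entries[OF Q] mat_def)
  qed
  then show ?thesis by (simp add: vec_eq_iff)
qed

end

text \<open>The interface to Gaussian states: everything is expressed through the correlation
  matrix, and the parameters \<open>Q\<close> and \<open>c\<close> are forgotten.\<close>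

theorem gaussian_state_properties:
  fixes w :: "'n::finite + 'n \<Rightarrow> complex^'d::finite^'d"
  assumes dim: "CARD('d) = 2 ^ CARD('n)" and w: "majorana w" and \<rho>: "gaussian_state w \<rho>"
    and C: "C = correlation_matrix w \<rho>"
  shows "psd \<rho>" "trace \<rho> = 1" "twisted_commutator w C \<rho> = 0"
    "trace X = 0 \<Longrightarrow> twisted_commutator w C X = 0 \<Longrightarrow> X = 0"
    "pure_state \<rho> \<Longrightarrow> C ** C = mat 1"
proof -
  obtain Q c where Q: "orthogonal_matrix Q" and c: "\<And>k. \<bar>c k\<bar> \<le> 1" and \<rho>: "\<rho> = gaussian_op w Q c"
    using \<rho> unfolding gaussian_state_def by blast
  interpret gaussian_modes w Q c by unfold_locales (fact w Q dim)+
  have C: "C = corr" by (simp add: C \<rho> correlation_gaussian)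
  show "psd \<rho>" by (simp add: \<rho> gaussian_op_eq modes.normal_state_psd c)
  show "trace \<rho> = 1" by (simp add: \<rho> trace_gaussian)
  show "twisted_commutator w C \<rho> = 0" by (simp add: \<rho> C gaussian_relation)
  show "X = 0" if "trace X = 0" "twisted_commutator w C X = 0" using gaussian_kernel that C by blast
  show "C ** C = mat 1" if "pure_state \<rho>"
  proof -
    have "\<rho> ** \<rho> = \<rho>" using that by (auto simp: pure_state_def ketbra_mult)
    then show ?thesis unfolding C \<rho> using corr_square pure_parameters c by blast
  qed
qed

text \<open>Two Gaussian states with the same correlation matrix differ by a traceless solution of
  the same relation.\<close>

lemma state_of_correlation_matrix:
  fixes w :: "'n::finite + 'n \<Rightarrow> complex^'d::finite^'d"
  assumes dim: "CARD('d) = 2 ^ CARD('n)" and w: "majorana w" and \<rho>: "gaussian_state w \<rho>"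
  shows "state_of w (correlation_matrix w \<rho>) = \<rho>"
  unfolding state_of_def
proof (rule the_equality)
  fix \<sigma> assume \<sigma>: "gaussian_state w \<sigma> \<and> correlation_matrix w \<sigma> = correlation_matrix w \<rho>"
  let ?C = "correlation_matrix w \<rho>"
  have "twisted_commutator w ?C (\<sigma> - \<rho>) = twisted_commutator w ?C \<sigma> - twisted_commutator w ?C \<rho>"
    by (simp add: twisted_commutator_def vec_eq_iff matrix_ring scale_mat_add_right scale_mat_diff_right
        sum.distrib sum_subtractf algebra_simps)
  then have "\<sigma> - \<rho> = 0"
    using gaussian_state_properties[OF dim w \<rho> refl] gaussian_state_properties[OF dim w, of \<sigma> ?C] \<sigma>
    by (metis diff_self trace_sub)
  then show "\<sigma> = \<rho>" by simp
qed (use \<rho> in simp)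

section \<open>Superoperators that are diagonal in a matrix unit basis\<close>

definition coord :: "complex^'i^'i \<Rightarrow> complex^'i^'i \<Rightarrow> complex^'i^'i"
  where "coord U X = dagger U ** X ** U"

text \<open>Entrywise multiplication in the basis \<open>U\<close>. In an eigenbasis of
  \<open>C\<close> the operator \<open>one_minus_Ad C\<close>, its pseudo-inverse, the root of the
  latter and the projection onto the kernel all have this form.\<close>

definition multiplier :: "complex^'i^'i \<Rightarrow> ('i \<Rightarrow> 'i \<Rightarrow> real) \<Rightarrow> complex^'i^'i \<Rightarrow> complex^'i^'i"
  where "multiplier U f X = U ** (\<chi> r s. complex_of_real (f r s) * coord U X $ r $ s) ** dagger U"

lemma coord_add: "coord U (X + Y) = coord U X + coord U Y"
  by (simp add: coord_def matrix_ring)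

lemma coord_diff: "coord U (X - Y) = coord U X - coord U Y"
  by (simp add: coord_def matrix_ring)

lemma coord_scale: "coord U (a \<cdot>\<^sub>m X) = a \<cdot>\<^sub>m coord U X"
  by (simp add: coord_def matrix_alg)

lemma coord_dagger: "coord U (dagger X) = dagger (coord U X)"
  by (simp add: coord_def dagger_mult matrix_mul_assoc)

lemma coord_basis_matrix: "coord (basis_matrix b) X $ r $ s = cinner (b r) (X *v b s)"
  unfolding coord_def by (rule unitary_conj_entry)

context
  fixes U :: "complex^'i^'i"
  assumes U: "unitary U"
begin

lemma coord_back: "coord U (U ** X ** dagger U) = X"
proof -
  have "coord U (U ** X ** dagger U) = (dagger U ** U) ** X ** (dagger U ** U)"
    by (simp add: coord_def matrix_mul_assoc)
  then show ?thesis by (simp add: unitaryD[OF U])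
qed

lemma back_coord: "U ** coord U X ** dagger U = X"
proof -
  have "U ** coord U X ** dagger U = (U ** dagger U) ** X ** (U ** dagger U)"
    by (simp add: coord_def matrix_mul_assoc)
  then show ?thesis by (simp add: unitaryD[OF U])
qed

lemma coord_inject: "coord U X = coord U Y \<Longrightarrow> X = Y"
  by (metis back_coord)

lemma coord_mult: "coord U (X ** Y) = coord U X ** coord U Y"
proof -
  have "coord U X ** coord U Y = dagger U ** X ** (U ** dagger U) ** Y ** U"
    by (simp add: coord_def matrix_mul_assoc)
  then show ?thesis by (simp add: unitaryD[OF U] coord_def matrix_mul_assoc)
qed

lemma trace_coord: "trace (coord U X) = trace X"
  using trace_cyclic3[of "dagger U" X U] trace_mul_sym[of X "U ** dagger U"]
  by (simp add: coord_def unitaryD[OF U] flip: matrix_mul_assoc)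

lemma trace_mult_coord: "trace (X ** Y) = (\<Sum>r\<in>UNIV. \<Sum>s\<in>UNIV. coord U X $ r $ s * coord U Y $ s $ r)"
  unfolding trace_mult_entries[symmetric] coord_mult[symmetric] trace_coord ..

lemma hs_inner_coord: "hs_inner X Y = (\<Sum>r\<in>UNIV. \<Sum>s\<in>UNIV. cnj (coord U X $ r $ s) * coord U Y $ r $ s)"
proof -
  have "hs_inner X Y = hs_inner (coord U X) (coord U Y)"
    unfolding hs_inner_def coord_dagger[symmetric] coord_mult[symmetric] trace_coord ..
  then show ?thesis by (simp add: hs_inner_entries)
qed

lemma norm_coord: "norm (coord U X) = norm X"
proof -
  have "hs_inner (coord U X) (coord U X) = hs_inner X X"
    unfolding hs_inner_def coord_dagger[symmetric] coord_mult[symmetric] trace_coord ..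
  then show ?thesis by (simp only: hs_norm_eq[symmetric] hs_norm_def)
qed

lemma coord_multiplier: "coord U (multiplier U f X) $ r $ s = complex_of_real (f r s) * coord U X $ r $ s"
  by (simp add: multiplier_def coord_back)

lemma multiplier_eqI:
  assumes "\<And>r s. coord U Y $ r $ s = complex_of_real (f r s) * coord U X $ r $ s"
  shows "multiplier U f X = Y"
  by (rule coord_inject) (simp add: vec_eq_iff coord_multiplier assms)

lemma multiplier_comp: "multiplier U f \<circ> multiplier U g = multiplier U (\<lambda>r s. f r s * g r s)"
  by (rule ext, rule sym, simp, rule multiplier_eqI) (simp add: coord_multiplier mult.assoc)

lemma multiplier_clinear: "clinear_op (multiplier U f)"
  unfolding clinear_op_def
  by (intro conjI allI multiplier_eqI)
    (simp_all add: coord_add coord_scale coord_multiplier distrib_left scale_mat_entry)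

lemma multiplier_self_adjoint: "self_adjoint_op (multiplier U f)"
  unfolding self_adjoint_op_def
  by (simp add: multiplier_clinear hs_inner_coord coord_multiplier mult_ac)

lemma hs_inner_multiplier_self:
  "hs_inner X (multiplier U f X) = complex_of_real (\<Sum>r\<in>UNIV. \<Sum>s\<in>UNIV. f r s * (cmod (coord U X $ r $ s))\<^sup>2)"
proof -
  have *: "cnj z * (complex_of_real a * z) = complex_of_real (a * (cmod z)\<^sup>2)" for z a
    using cnj_mult_self[of z] by (simp add: mult.left_commute)
  show ?thesis by (simp only: hs_inner_coord coord_multiplier * of_real_sum)
qed

lemma multiplier_psd:
  assumes "\<And>r s. 0 \<le> f r s"
  shows "psd_op (multiplier U f)"
  unfolding psd_op_def hs_inner_multiplier_self
  by (auto simp: multiplier_self_adjoint assms intro!: sum_nonneg)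

end

section \<open>Uniqueness of the pseudo-inverse and of positive roots\<close>

lemma hs_inner_eqI:
  assumes "\<And>Y. hs_inner A Y = hs_inner B Y"
  shows "A = B"
proof -
  have "hs_inner (A - B) (A - B) = 0"
    using assms[of "A - B"] by (simp add: hs_inner_def dagger_diff matrix_diff_rdistrib trace_sub)
  then show ?thesis by (simp add: hs_inner_norm)
qed

text \<open>\<open>T \<circ> S\<close> and \<open>T \<circ> S'\<close> are orthogonal projections
  onto the same range, hence equal. So are \<open>S \<circ> T\<close> and
  \<open>S' \<circ> T\<close>, which have the same kernel. Then
  \<open>S = S \<circ> T \<circ> S\<close> turns into \<open>S'\<close>.\<close>

lemma pinv_op_eqI:
  assumes S: "clinear_op S" "T \<circ> S \<circ> T = T" "S \<circ> T \<circ> S = S" "self_adjoint_op (T \<circ> S)" "self_adjoint_op (S \<circ> T)"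
  shows "pinv_op T = S"
  unfolding pinv_op_def
proof (rule the_equality)
  fix S' assume S': "clinear_op S' \<and> T \<circ> S' \<circ> T = T \<and> S' \<circ> T \<circ> S' = S' \<and>
    self_adjoint_op (T \<circ> S') \<and> self_adjoint_op (S' \<circ> T)"
  have sa: "hs_inner (T (S X)) Y = hs_inner X (T (S Y))" "hs_inner (S (T X)) Y = hs_inner X (S (T Y))"
    "hs_inner (T (S' X)) Y = hs_inner X (T (S' Y))" "hs_inner (S' (T X)) Y = hs_inner X (S' (T Y))" for X Y
    using S(4,5) S' by (simp_all add: self_adjoint_op_def)
  have c: "T (S (T X)) = T X" "S (T (S X)) = S X" "T (S' (T X)) = T X" "S' (T (S' X)) = S' X" for X
    using S(2,3) S' by (metis comp_apply)+
  have TS: "T (S X) = T (S' X)" for X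
    by (rule hs_inner_eqI) (metis sa(1,3) c(1,3))
  have ST: "S (T X) = S' (T X)" for X
    by (rule hs_inner_eqI) (metis sa(2,4) c(1,3))
  show "S' = S"
    by (rule ext) (metis TS ST c(2,4))
qed (use S in blast)

lemma clinear_op_sum:
  assumes "clinear_op S"
  shows "S (\<Sum>i\<in>I. f i) = (\<Sum>i\<in>I. S (f i))"
proof -
  have "S (0 \<cdot>\<^sub>m 0) = 0 \<cdot>\<^sub>m S 0" using assms unfolding clinear_op_def by blast
  then have "S 0 = 0" by simp
  then show ?thesis
    using assms by (induction I rule: infinite_finite_induct) (simp_all add: clinear_op_def)
qed

text \<open>\<open>Z = S Y - \<mu> Y\<close> satisfies \<open>S Z = - \<mu> Z\<close>, which
  positivity excludes for \<open>\<mu> > 0\<close> unless \<open>Z = 0\<close>. So a positive root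
  is determined on every eigenvector of its square.\<close>

lemma psd_op_root_eigen:
  assumes S: "psd_op S" and \<mu>: "0 \<le> \<mu>" and eq: "S (S Y) = complex_of_real (\<mu> * \<mu>) \<cdot>\<^sub>m Y"
  shows "S Y = complex_of_real \<mu> \<cdot>\<^sub>m Y"
proof -
  have lin: "S (A + B) = S A + S B" "S (a \<cdot>\<^sub>m A) = a \<cdot>\<^sub>m S A" for a A B
    using S by (simp_all add: psd_op_def self_adjoint_op_def clinear_op_def)
  have sa: "hs_inner (S A) B = hs_inner A (S B)" for A B
    using S by (simp add: psd_op_def self_adjoint_op_def)
  show ?thesis
  proof (cases "\<mu> = 0")
    case True
    then have "hs_inner (S Y) (S Y) = 0" by (simp add: sa eq) (simp add: hs_inner_def matrix_zero_right)
    then show ?thesis using True by (simp add: hs_inner_norm)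
  next
    case False
    define Z where "Z = S Y + (- complex_of_real \<mu>) \<cdot>\<^sub>m Y"
    have "S Z = (- complex_of_real \<mu>) \<cdot>\<^sub>m Z"
      by (simp only: Z_def lin eq scale_mat_add_right scale_mat_smult) simp
    then have "Re (hs_inner Z (S Z)) = - \<mu> * (norm Z)\<^sup>2"
      by (simp add: hs_inner_def scale_mat_mult_right trace_smult norm_matrix_sq)
    moreover have "0 \<le> Re (hs_inner Z (S Z))" using S by (simp add: psd_op_def)
    ultimately have "\<mu> * (norm Z)\<^sup>2 \<le> 0" by simp
    then have "norm Z = 0" using \<mu> False by (simp add: mult_le_0_iff)
    then show ?thesis by (simp add: Z_def scale_mat_minus_left)
  qed
qed

lemma op_sqrt_multiplier:
  assumes U: "unitary U" and f: "\<And>r s. 0 \<le> f r s"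
  shows "op_sqrt (multiplier U f) = multiplier U (\<lambda>r s. sqrt (f r s))"
  unfolding op_sqrt_def
proof (rule the_equality)
  show "psd_op (multiplier U (\<lambda>r s. sqrt (f r s))) \<and>
      multiplier U (\<lambda>r s. sqrt (f r s)) \<circ> multiplier U (\<lambda>r s. sqrt (f r s)) = multiplier U f"
    by (simp add: multiplier_psd[OF U] multiplier_comp[OF U] f)
next
  fix S assume S: "psd_op S \<and> S \<circ> S = multiplier U f"
  show "S = multiplier U (\<lambda>r s. sqrt (f r s))"
  proof
    fix X
    \<comment> \<open>The matrix-unit components of \<open>X\<close>. Each is zero or an eigenvector
      of the multiplier, so every positive root acts on it by the root of the eigenvalue.\<close>
    define comp where "comp p = multiplier U (\<lambda>r s. if (r, s) = p then 1 else 0) X" for p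
    have coord_comp: "coord U (comp p) $ r $ s = (if (r, s) = p then coord U X $ r $ s else 0)" for p r s
      by (simp add: comp_def coord_multiplier[OF U])
    have coord_sum: "coord U (\<Sum>p\<in>P. Y p) $ r $ s = (\<Sum>p\<in>P. coord U (Y p) $ r $ s)" for P r s
      and Y :: "'a \<times> 'a \<Rightarrow> complex^'a^'a"
      by (simp add: coord_def matrix_sum_left matrix_sum_right)
    have X: "X = (\<Sum>p\<in>UNIV. comp p)"
      by (rule coord_inject[OF U]) (simp add: vec_eq_iff coord_sum coord_comp)
    have "S (comp p) = complex_of_real (sqrt (f (fst p) (snd p))) \<cdot>\<^sub>m comp p" for p
    proof (rule psd_op_root_eigen)
      have "S (S (comp p)) = multiplier U f (comp p)" using S by (metis comp_apply)
      also have "\<dots> = complex_of_real (f (fst p) (snd p)) \<cdot>\<^sub>m comp p"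
        by (rule multiplier_eqI[OF U]) (auto simp: coord_scale scale_mat_entry coord_comp)
      finally show "S (S (comp p)) = complex_of_real (sqrt (f (fst p) (snd p)) * sqrt (f (fst p) (snd p))) \<cdot>\<^sub>m comp p"
        by (simp add: f)
    qed (use S f in auto)
    then have "S X = (\<Sum>p\<in>UNIV. complex_of_real (sqrt (f (fst p) (snd p))) \<cdot>\<^sub>m comp p)"
      using S by (subst X) (simp add: clinear_op_sum psd_op_def self_adjoint_op_def)
    also have "\<dots> = multiplier U (\<lambda>r s. sqrt (f r s)) X"
    proof (rule sym, rule multiplier_eqI[OF U])
      fix r s
      have "coord U (\<Sum>p\<in>UNIV. complex_of_real (sqrt (f (fst p) (snd p))) \<cdot>\<^sub>m comp p) $ r $ s
        = (\<Sum>p\<in>UNIV. if (r, s) = p then complex_of_real (sqrt (f (fst p) (snd p))) * coord U X $ r $ s else 0)"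
        unfolding coord_sum by (intro sum.cong) (auto simp: coord_scale scale_mat_entry coord_comp)
      then show "coord U (\<Sum>p\<in>UNIV. complex_of_real (sqrt (f (fst p) (snd p))) \<cdot>\<^sub>m comp p) $ r $ s
        = complex_of_real (sqrt (f r s)) * coord U X $ r $ s" by simp
    qed
    finally show "S X = multiplier U (\<lambda>r s. sqrt (f r s)) X" .
  qed
qed

definition pinv_weight :: "('i \<Rightarrow> real) \<Rightarrow> 'i \<Rightarrow> 'i \<Rightarrow> real"
  where "pinv_weight c r s = (if c r * c s = 1 then 0 else 1 / (1 - c r * c s))"

text \<open>In the eigenbasis \<open>Ad C\<close> multiplies the entry \<open>(r, s)\<close> by
  \<open>c r * c s\<close>.\<close>

lemma one_minus_Ad_multiplier:
  assumes "orthonormal_eigenbasis C c b"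
  shows "one_minus_Ad C = multiplier (basis_matrix b) (\<lambda>r s. 1 - c r * c s)"
proof
  fix X
  let ?U = "basis_matrix b" and ?D = "diag (\<lambda>r. complex_of_real (c r))"
  have u: "unitary ?U" and C: "C = spectral_fun ?U c"
    using assms by (auto simp: orthonormal_eigenbasis_iff)
  have cC: "coord ?U C = ?D" by (simp add: C spectral_fun_def coord_back[OF u])
  have dC: "dagger C = C" using C spectral_fun_hermitian hermitianD by metis
  have l: "(?D ** A) $ r $ s = complex_of_real (c r) * A $ r $ s"
    and r: "(A ** ?D) $ r $ s = A $ r $ s * complex_of_real (c s)" for A r s
  proof -
    have "?D $ r $ k * A $ k $ s = (if k = r then complex_of_real (c r) * A $ r $ s else 0)"
      "A $ r $ k * ?D $ k $ s = (if k = s then A $ r $ s * complex_of_real (c s) else 0)" for k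
      by (auto simp: diag_def)
    then show "(?D ** A) $ r $ s = complex_of_real (c r) * A $ r $ s"
      "(A ** ?D) $ r $ s = A $ r $ s * complex_of_real (c s)"
      by (simp_all add: matrix_matrix_mult_def)
  qed
  show "one_minus_Ad C X = multiplier ?U (\<lambda>r s. 1 - c r * c s) X"
    by (rule sym, rule multiplier_eqI[OF u])
      (simp add: one_minus_Ad_def Ad_def dC coord_diff coord_mult[OF u] cC l r algebra_simps)
qed

lemma pinv_one_minus_Ad:
  assumes "orthonormal_eigenbasis C c b"
  shows "pinv_op (one_minus_Ad C) = multiplier (basis_matrix b) (pinv_weight c)"
proof -
  have u: "unitary (basis_matrix b)" using assms by (simp add: orthonormal_eigenbasis_iff)
  have w: "(\<lambda>r s. (1 - c r * c s) * pinv_weight c r s * (1 - c r * c s)) = (\<lambda>r s. 1 - c r * c s)"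
    "(\<lambda>r s. pinv_weight c r s * (1 - c r * c s) * pinv_weight c r s) = pinv_weight c"
    by (auto simp: pinv_weight_def fun_eq_iff)
  show ?thesis
    unfolding one_minus_Ad_multiplier[OF assms]
    by (rule pinv_op_eqI) (simp_all add: multiplier_comp[OF u] multiplier_clinear[OF u] multiplier_self_adjoint[OF u] w)
qed

section \<open>Quadratic Majorana operators\<close>

definition quad :: "('i::finite \<Rightarrow> complex^'d^'d) \<Rightarrow> complex^'i^'i \<Rightarrow> complex^'d^'d"
  where "quad w K = (\<Sum>i\<in>UNIV. \<Sum>j\<in>UNIV. (K $ i $ j / 2) \<cdot>\<^sub>m (w i ** w j))"

text \<open>Each product \<open>w j ** w k\<close> leaves a term in \<open>w k\<close> for
  \<open>i = j\<close> and one in \<open>w j\<close> for \<open>i = k\<close>. Antisymmetry of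
  \<open>K\<close> makes the two sums agree, hence the factor 2.\<close>

lemma quad_commutator:
  fixes w :: "'n::finite + 'n \<Rightarrow> complex^'d^'d"
  assumes w: "majorana w" and K: "transpose K = - K"
  shows "w i ** quad w K - quad w K ** w i = (\<Sum>k\<in>UNIV. (2 * K $ i $ k) \<cdot>\<^sub>m w k)"
proof -
  have K': "K $ k $ j = - K $ j $ k" for j k
    using K[THEN arg_cong[of _ _ "\<lambda>A. A $ j $ k"]] by (simp add: transpose_def)
  have 2: "(mat 2 :: complex^'d^'d) = 2 \<cdot>\<^sub>m mat 1" "(mat 0 :: complex^'d^'d) = 0"
    by (simp_all add: mat_def scale_mat_def vec_eq_iff)
  have ac: "w i ** w j = (if i = j then 2 else 0) \<cdot>\<^sub>m mat 1 - w j ** w i" for i j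
  proof -
    have "w i ** w j + w j ** w i = (if i = j then 2 else 0) \<cdot>\<^sub>m mat 1"
      using w 2 unfolding majorana_def by simp
    then show ?thesis by (simp only: eq_diff_eq)
  qed
  have tri: "w i ** (w j ** w k) - w j ** w k ** w i = (if i = j then 2 else 0) \<cdot>\<^sub>m w k - (if i = k then 2 else 0) \<cdot>\<^sub>m w j" for j k
  proof -
    have "w i ** (w j ** w k) = (w i ** w j) ** w k" by (simp add: matrix_mul_assoc)
    also have "\<dots> = (if i = j then 2 else 0) \<cdot>\<^sub>m w k - w j ** (w i ** w k)"
      by (subst ac) (simp add: matrix_alg)
    also have "w j ** (w i ** w k) = (if i = k then 2 else 0) \<cdot>\<^sub>m w j - w j ** w k ** w i"
      by (subst ac) (simp add: matrix_alg)
    finally show ?thesis by simp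
  qed
  have "w i ** quad w K - quad w K ** w i = (\<Sum>j\<in>UNIV. \<Sum>k\<in>UNIV. (K $ j $ k / 2) \<cdot>\<^sub>m (w i ** (w j ** w k) - w j ** w k ** w i))"
    by (simp add: quad_def matrix_sum_alg
        scale_mat_diff_right sum_subtractf)
  also have "\<dots> = (\<Sum>j\<in>UNIV. \<Sum>k\<in>UNIV. (if i = j then K $ j $ k \<cdot>\<^sub>m w k else 0))
      - (\<Sum>j\<in>UNIV. \<Sum>k\<in>UNIV. (if i = k then K $ j $ k \<cdot>\<^sub>m w j else 0))"
    unfolding tri sum_subtractf[symmetric]
    by (intro sum.cong refl) (auto simp: scale_mat_diff_right scale_mat_smult)
  also have "(\<Sum>j\<in>UNIV. \<Sum>k\<in>UNIV. (if i = j then K $ j $ k \<cdot>\<^sub>m w k else 0)) = (\<Sum>k\<in>UNIV. K $ i $ k \<cdot>\<^sub>m w k)"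
    by (subst sum.swap) simp
  also have "(\<Sum>j\<in>UNIV. \<Sum>k\<in>UNIV. (if i = k then K $ j $ k \<cdot>\<^sub>m w j else 0)) = (\<Sum>k\<in>UNIV. - (K $ i $ k \<cdot>\<^sub>m w k))"
  proof (intro sum.cong refl)
    fix j
    have "K $ j $ i \<cdot>\<^sub>m w j = - (K $ i $ j \<cdot>\<^sub>m w j)"
      unfolding K'[of j i] by (rule scale_mat_minus_left)
    then show "(\<Sum>k\<in>UNIV. if i = k then K $ j $ k \<cdot>\<^sub>m w j else 0) = - (K $ i $ j \<cdot>\<^sub>m w j)" by simp
  qed
  finally show ?thesis by (simp only: sum_negf mult_2 scale_mat_add_left sum.distrib diff_minus_eq_add)
qed

text \<open>Let \<open>M = quad w K\<close> and \<open>W i = [w i, M]\<close>. Moving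
  \<open>w i\<close> past \<open>M\<close> produces \<open>{W i, \<rho>}\<close> and
  \<open>[W i, \<rho>]\<close>, besides terms in which \<open>M\<close> multiplies the relation of
  \<open>\<rho>\<close>; these cancel. The anticommutators give \<open>K\<close>. The commutators
  become anticommutators by a second use of the relation and give \<open>- C K C\<close>.\<close>

lemma twisted_commutator_quad:
  fixes w :: "'n::finite + 'n \<Rightarrow> complex^'d^'d"
  assumes w: "majorana w" and K: "transpose K = - K" and \<rho>: "twisted_commutator w C \<rho> = 0"
  shows "twisted_commutator w C (quad w K ** \<rho> + \<rho> ** quad w K)
    = anticommutator_sum w (2 \<cdot>\<^sub>m (K - C ** K ** C)) \<rho>"
proof -
  define M where "M = quad w K"
  define W where "W i = w i ** M - M ** w i" for i
  have W: "W i = (\<Sum>k\<in>UNIV. (2 * K $ i $ k) \<cdot>\<^sub>m w k)" for i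
    unfolding W_def M_def by (rule quad_commutator[OF w K])
  have rel: "w i ** \<rho> - \<rho> ** w i = - (\<Sum>j\<in>UNIV. C $ i $ j \<cdot>\<^sub>m (w j ** \<rho> + \<rho> ** w j))" for i
    using twisted_commutator_component[OF \<rho>] by simp
  have 1: "w i ** (M ** \<rho> + \<rho> ** M) - (M ** \<rho> + \<rho> ** M) ** w i
      = (W i ** \<rho> + \<rho> ** W i) + (M ** (w i ** \<rho> - \<rho> ** w i) + (w i ** \<rho> - \<rho> ** w i) ** M)" for i
    by (simp add: W_def matrix_ring)
  have 2: "w j ** (M ** \<rho> + \<rho> ** M) + (M ** \<rho> + \<rho> ** M) ** w j
      = (W j ** \<rho> - \<rho> ** W j) + (M ** (w j ** \<rho> + \<rho> ** w j) + (w j ** \<rho> + \<rho> ** w j) ** M)" for j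
    by (simp add: W_def matrix_ring)
  have WC: "(\<Sum>j\<in>UNIV. C $ i $ j \<cdot>\<^sub>m (W j ** \<rho> - \<rho> ** W j))
      = - (\<Sum>l\<in>UNIV. (2 * (C ** K ** C) $ i $ l) \<cdot>\<^sub>m (w l ** \<rho> + \<rho> ** w l))" for i
  proof -
    have "(\<Sum>j\<in>UNIV. C $ i $ j \<cdot>\<^sub>m (W j ** \<rho> - \<rho> ** W j))
       = (\<Sum>j\<in>UNIV. \<Sum>k\<in>UNIV. (2 * (C $ i $ j * K $ j $ k)) \<cdot>\<^sub>m (w k ** \<rho> - \<rho> ** w k))"
      by (simp add: W matrix_sum_alg
          scale_mat_sum_right scale_mat_diff_right scale_mat_smult sum_subtractf mult.left_commute)
    also have "\<dots> = (\<Sum>k\<in>UNIV. (2 * (C ** K) $ i $ k) \<cdot>\<^sub>m (w k ** \<rho> - \<rho> ** w k))"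
      by (subst sum.swap) (simp add: matrix_matrix_mult_def sum_distrib_left scale_mat_sum_left)
    also have "\<dots> = - (\<Sum>k\<in>UNIV. \<Sum>l\<in>UNIV. (2 * ((C ** K) $ i $ k * C $ k $ l)) \<cdot>\<^sub>m (w l ** \<rho> + \<rho> ** w l))"
      unfolding rel by (simp add: scale_mat_minus_right scale_mat_sum_right scale_mat_smult sum_negf mult.assoc)
    also have "\<dots> = - (\<Sum>l\<in>UNIV. (2 * (C ** K ** C) $ i $ l) \<cdot>\<^sub>m (w l ** \<rho> + \<rho> ** w l))"
      by (subst sum.swap) (simp add: matrix_matrix_mult_def[of "C ** K"] sum_distrib_left scale_mat_sum_left)
    finally show ?thesis .
  qed
  have WK: "W i ** \<rho> + \<rho> ** W i = (\<Sum>l\<in>UNIV. (2 * K $ i $ l) \<cdot>\<^sub>m (w l ** \<rho> + \<rho> ** w l))" for i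
    by (simp add: W matrix_sum_alg
          scale_mat_add_right sum.distrib)
  have z: "M ** (w i ** \<rho> - \<rho> ** w i) + (w i ** \<rho> - \<rho> ** w i) ** M
      + (\<Sum>j\<in>UNIV. C $ i $ j \<cdot>\<^sub>m (M ** (w j ** \<rho> + \<rho> ** w j) + (w j ** \<rho> + \<rho> ** w j) ** M)) = 0" for i
  proof -
    define A where "A j = w j ** \<rho> + \<rho> ** w j" for j
    show ?thesis
      unfolding rel A_def[symmetric]
      by (simp add: matrix_minus_left matrix_minus_right matrix_sum_alg scale_mat_add_right sum.distrib)
  qed
  have "twisted_commutator w C (M ** \<rho> + \<rho> ** M) $ i = anticommutator_sum w (2 \<cdot>\<^sub>m (K - C ** K ** C)) \<rho> $ i" for i
  proof -
    have "twisted_commutator w C (M ** \<rho> + \<rho> ** M) $ i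
      = (W i ** \<rho> + \<rho> ** W i) + (\<Sum>j\<in>UNIV. C $ i $ j \<cdot>\<^sub>m (W j ** \<rho> - \<rho> ** W j))"
      unfolding twisted_commutator_def vec_lambda_beta 1 2 scale_mat_add_right[of _ "W _ ** _ - _"] sum.distrib
      using z[of i] by (simp add: algebra_simps)
    also have "\<dots> = anticommutator_sum w (2 \<cdot>\<^sub>m (K - C ** K ** C)) \<rho> $ i"
      unfolding WK WC anticommutator_sum_component
      by (simp add: scale_mat_entry right_diff_distrib scale_mat_diff_left sum_subtractf)
    finally show ?thesis .
  qed
  then show ?thesis by (simp add: vec_eq_iff M_def)
qed

lemma quad_hermitian:
  assumes "majorana w" "hermitian K"
  shows "hermitian (quad w K)"
proof -
  have K: "cnj (K $ i $ j) = K $ j $ i" for i j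
    using assms(2) by (metis dagger_entry hermitian_def)
  have "dagger (quad w K) = (\<Sum>i\<in>UNIV. \<Sum>j\<in>UNIV. (K $ j $ i / 2) \<cdot>\<^sub>m (w j ** w i))"
    using assms(1) by (simp add: quad_def dagger_sum dagger_smult dagger_mult majorana_def hermitian_def K)
  also have "\<dots> = quad w K" unfolding quad_def by (rule sum.swap)
  finally show ?thesis by (simp add: hermitian_def)
qed

text \<open>Antisymmetry of \<open>K\<close> replaces \<open>w i ** w j\<close> by half its
  commutator; together with the 1/2 in \<open>quad\<close> this gives the 4.\<close>

lemma trace_quad_mult:
  assumes K: "transpose K = - K"
  shows "trace (quad w K ** X) = (\<Sum>i\<in>UNIV. \<Sum>j\<in>UNIV. K $ i $ j * trace (X ** (w i ** w j - w j ** w i))) / 4"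
proof -
  have K': "K $ k $ j = - K $ j $ k" for j k
    using K[THEN arg_cong[of _ _ "\<lambda>A. A $ j $ k"]] by (simp add: transpose_def)
  have 1: "2 * trace (quad w K ** X) = (\<Sum>i\<in>UNIV. \<Sum>j\<in>UNIV. K $ i $ j * trace (X ** (w i ** w j)))"
    by (simp add: quad_def matrix_sum_left trace_sum scale_mat_mult_left trace_smult
        trace_mul_sym[of _ X] sum_distrib_left)
  also have "\<dots> = (\<Sum>i\<in>UNIV. \<Sum>j\<in>UNIV. - (K $ i $ j * trace (X ** (w j ** w i))))"
    by (subst sum.swap, intro sum.cong refl) (metis K' mult_minus_left)
  finally have "4 * trace (quad w K ** X) = (\<Sum>i\<in>UNIV. \<Sum>j\<in>UNIV. K $ i $ j * trace (X ** (w i ** w j)))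
      + (\<Sum>i\<in>UNIV. \<Sum>j\<in>UNIV. - (K $ i $ j * trace (X ** (w j ** w i))))"
    using 1 by simp
  also have "\<dots> = (\<Sum>i\<in>UNIV. \<Sum>j\<in>UNIV. K $ i $ j * trace (X ** (w i ** w j - w j ** w i)))"
    by (simp add: matrix_diff_ldistrib trace_sub right_diff_distrib sum.distrib sum_subtractf sum_negf)
  finally show ?thesis by (simp add: field_simps)
qed

section \<open>Correlation matrices\<close>

lemma (in small_parameter) ord_sum:
  "(\<And>i. i \<in> I \<Longrightarrow> ord k (f i)) \<Longrightarrow> ord k (\<lambda>x. \<Sum>i\<in>I. f i x)"
  by (induction I rule: infinite_finite_induct) (auto intro: ord_zero ord_add)

lemma norm_matrix_le_sum: "norm (X :: complex^'n^'n) \<le> (\<Sum>i\<in>UNIV. \<Sum>j\<in>UNIV. cmod (X $ i $ j))"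
proof -
  have "norm X \<le> (\<Sum>i\<in>UNIV. norm (X $ i))"
    unfolding norm_vec_def[of X] by (rule L2_set_le_sum) simp
  also have "\<dots> \<le> (\<Sum>i\<in>UNIV. \<Sum>j\<in>UNIV. cmod (X $ i $ j))"
    unfolding norm_vec_def[of "X $ _"] by (intro sum_mono L2_set_le_sum) simp
  finally show ?thesis .
qed

lemma (in small_parameter) ord_matrixI:
  fixes X :: "'a \<Rightarrow> complex^'n^'n"
  assumes "\<And>i j. ord k (\<lambda>x. X x $ i $ j)"
  shows "ord k X"
proof -
  have "ord k (\<lambda>x. cmod (X x $ i $ j))" for i j
    by (rule ord_bound[OF assms[of i j], of 1]) auto
  then have "ord k (\<lambda>x. \<Sum>i\<in>UNIV. \<Sum>j\<in>UNIV. cmod (X x $ i $ j))"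
    by (intro ord_sum)
  then show ?thesis
  proof (rule ord_bound[of _ _ 1])
    have "norm (X x) \<le> 1 * norm (\<Sum>i\<in>UNIV. \<Sum>j\<in>UNIV. cmod (X x $ i $ j))" for x
      using norm_matrix_le_sum[of "X x"] by simp
    then show "\<forall>\<^sub>F x in G. norm (X x) \<le> 1 * norm (\<Sum>i\<in>UNIV. \<Sum>j\<in>UNIV. cmod (X x $ i $ j))"
      by (intro always_eventually) blast
  qed simp
qed

lemma correlation_transpose: "transpose (correlation_matrix w \<rho>) = - correlation_matrix w \<rho>"
proof -
  have "transpose (correlation_matrix w \<rho>) $ i $ j = (- correlation_matrix w \<rho>) $ i $ j" for i j
    using minus_mult_right[of "1/2" "trace (\<rho> ** (w i ** w j - w j ** w i))"]
    by (simp only: correlation_matrix_def transpose_def vec_lambda_beta vector_uminus_component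
        matrix_minus_right[symmetric] trace_minus[symmetric] minus_diff_eq)
  then show ?thesis by (simp only: vec_eq_iff) simp
qed

lemma correlation_hermitian:
  fixes w :: "'n::finite + 'n \<Rightarrow> complex^'d^'d"
  assumes "majorana w" "hermitian \<rho>"
  shows "hermitian (correlation_matrix w \<rho>)"
proof -
  have "cnj (trace (\<rho> ** (w i ** w j - w j ** w i))) = trace (\<rho> ** (w j ** w i - w i ** w j))" for i j
  proof -
    have "cnj (trace (\<rho> ** (w i ** w j - w j ** w i))) = trace ((w j ** w i - w i ** w j) ** \<rho>)"
      using assms by (simp add: dagger_mult dagger_diff majorana_def hermitian_def flip: trace_dagger)
    then show ?thesis by (simp only: trace_mul_sym[of \<rho>])
  qed
  then show ?thesis by (simp add: hermitian_def dagger_def correlation_matrix_def vec_eq_iff)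
qed

section \<open>Second moments of linear combinations of Majorana operators\<close>

lemma second_moment:
  fixes w :: "'n::finite + 'n \<Rightarrow> complex^'d^'d"
  assumes "majorana w" "trace \<rho> = 1"
  shows "trace (\<rho> ** (w i ** w j)) = (if i = j then 1 else 0) + correlation_matrix w \<rho> $ i $ j"
proof -
  have "2 * trace (\<rho> ** (w i ** w j)) = trace (\<rho> ** (w i ** w j + w j ** w i)) + trace (\<rho> ** (w i ** w j - w j ** w i))"
    by (simp add: matrix_add_ldistrib matrix_diff_ldistrib trace_add trace_sub)
  also have "trace (\<rho> ** (w i ** w j - w j ** w i)) = 2 * correlation_matrix w \<rho> $ i $ j"
    by (simp add: correlation_matrix_def)
  finally have "2 * trace (\<rho> ** (w i ** w j)) = 2 * ((if i = j then 1 else 0) + correlation_matrix w \<rho> $ i $ j)"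
    unfolding trace_anticommutator[OF assms(1)] assms(2) by (simp add: distrib_left)
  then show ?thesis by (simp only: mult_cancel_left) simp
qed

text \<open>The conjugated coefficients make second moments match \<open>cinner\<close>, which is
  antilinear in its first argument.\<close>

definition lincomb :: "('i::finite \<Rightarrow> complex^'d^'d) \<Rightarrow> complex^'i \<Rightarrow> complex^'d^'d"
  where "lincomb w v = (\<Sum>i\<in>UNIV. cnj (v $ i) \<cdot>\<^sub>m w i)"

lemma dagger_lincomb: "majorana w \<Longrightarrow> dagger (lincomb w v) = (\<Sum>i\<in>UNIV. v $ i \<cdot>\<^sub>m w i)"
  by (simp add: lincomb_def dagger_sum dagger_smult majorana_def hermitian_def)

lemma cinner_matrix: "cinner u (A *v v) = (\<Sum>i\<in>UNIV. \<Sum>j\<in>UNIV. cnj (u $ i) * v $ j * A $ i $ j)"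
  by (simp add: cinner_def matrix_vector_mult_def sum_distrib_left mult_ac)

text \<open>\<open>1 + C\<close> and \<open>1 - C\<close> are the Gram matrices of second moments in
  the two operator orders. An eigenvector of \<open>C\<close> for -1 or 1 therefore yields an
  operator whose moment with itself vanishes in one of the orders.\<close>

lemma trace_lincomb:
  fixes w :: "'n::finite + 'n \<Rightarrow> complex^'d^'d"
  assumes "majorana w" "trace \<rho> = 1"
  shows "trace (\<rho> ** (lincomb w u ** dagger (lincomb w v))) = cinner u v + cinner u (correlation_matrix w \<rho> *v v)"
    and "trace (\<rho> ** (dagger (lincomb w v) ** lincomb w u)) = cinner u v - cinner u (correlation_matrix w \<rho> *v v)"
proof -
  have d: "(\<Sum>i\<in>UNIV. \<Sum>j\<in>UNIV. cnj (u $ i) * v $ j * (if i = j then 1 else 0)) = cinner u v"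
    by (simp add: cinner_def if_distrib[of "\<lambda>y. _ * y"] cong: if_cong)
  have "trace (\<rho> ** (lincomb w u ** dagger (lincomb w v)))
      = (\<Sum>j\<in>UNIV. \<Sum>i\<in>UNIV. cnj (u $ i) * v $ j * trace (\<rho> ** (w i ** w j)))"
    unfolding dagger_lincomb[OF assms(1)] unfolding lincomb_def
    by (simp add: matrix_sum_alg
        trace_sum trace_smult sum_distrib_left mult_ac)
  also have "\<dots> = (\<Sum>i\<in>UNIV. \<Sum>j\<in>UNIV. cnj (u $ i) * v $ j * trace (\<rho> ** (w i ** w j)))"
    by (rule sum.swap)
  also have "\<dots> = cinner u v + cinner u (correlation_matrix w \<rho> *v v)"
    by (simp only: second_moment[OF assms] distrib_left sum.distrib d cinner_matrix)
  finally show "trace (\<rho> ** (lincomb w u ** dagger (lincomb w v))) = cinner u v + cinner u (correlation_matrix w \<rho> *v v)" .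
  have C: "correlation_matrix w \<rho> $ j $ i = - correlation_matrix w \<rho> $ i $ j" for i j
    using correlation_transpose[of w \<rho>, THEN arg_cong[of _ _ "\<lambda>A. A $ i $ j"]] by (simp add: transpose_def)
  have m: "trace (\<rho> ** (w j ** w i)) = (if i = j then 1 else 0) - correlation_matrix w \<rho> $ i $ j" for i j
    using second_moment[OF assms, of j i] C[of j i] by simp
  have "trace (\<rho> ** (dagger (lincomb w v) ** lincomb w u))
      = (\<Sum>i\<in>UNIV. \<Sum>j\<in>UNIV. cnj (u $ i) * v $ j * trace (\<rho> ** (w j ** w i)))"
    unfolding dagger_lincomb[OF assms(1)] unfolding lincomb_def
    by (simp add: matrix_sum_alg
        trace_sum trace_smult sum_distrib_left mult_ac)
  also have "\<dots> = cinner u v - cinner u (correlation_matrix w \<rho> *v v)"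
    by (simp only: m right_diff_distrib sum_subtractf d cinner_matrix)
  finally show "trace (\<rho> ** (dagger (lincomb w v) ** lincomb w u)) = cinner u v - cinner u (correlation_matrix w \<rho> *v v)" .
qed

text \<open>For the root \<open>T\<close> of \<open>A\<close>, submultiplicativity gives
  \<open>norm (T ** T) \<le> (norm T)\<^sup>2 = tr A\<close>. This bounds all states
  uniformly.\<close>

lemma psd_norm_le_trace:
  assumes "psd A"
  shows "norm A \<le> Re (trace A)"
proof -
  obtain T where T: "psd T" "T ** T = A" using psd_root_and_pinv[OF assms] by blast
  have "norm (T ** T) \<le> (norm T)\<^sup>2" using norm_matrix_mult[of T T] by (simp add: power2_eq_square)
  then show ?thesis using norm_sq_hermitian[OF psd_hermitian[OF T(1)]] T(2) by simp
qed

text \<open>A vanishing moment of \<open>X\<close> in \<open>\<rho>\<close> means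
  \<open>T ** X = 0\<close>, that is, \<open>R ** X = X\<close>. So the moment in the perturbed
  state sees only the kernel block \<open>R ** \<delta> x ** R\<close>.\<close>

lemma (in perturbed_density) annihilated_moment:
  fixes X Y :: "complex^'d^'d"
  assumes X: "trace (\<rho> ** (X ** dagger X)) = 0" and Y: "trace (\<rho> ** (Y ** dagger Y)) = 0"
  shows "ord 2 (\<lambda>x. trace ((\<rho> + \<delta> x) ** (X ** dagger Y)))"
proof -
  have RZ: "R ** Z = Z" if "trace (\<rho> ** (Z ** dagger Z)) = 0" for Z :: "complex^'d^'d"
  proof -
    have "trace (dagger (T ** Z) ** (T ** Z)) = trace (dagger Z ** (\<rho> ** Z))"
      by (simp add: dagger_mult hermT TT[symmetric] matrix_mul_assoc)
    also have "\<dots> = 0" using that trace_mul_sym[of "dagger Z" "\<rho> ** Z"] by (simp add: matrix_mul_assoc)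
    finally have "T ** Z = 0" by (intro norm_eq_0_of_trace) simp
    moreover have "P ** Z = V ** (T ** Z)" by (simp add: matrix_mul_assoc PT)
    ultimately show ?thesis by (simp add: R_def matrix_ring matrix_zero_right)
  qed
  have YR: "dagger Y ** R = dagger Y"
    using RZ[OF Y] hermR by (metis dagger_mult dagger_dagger hermitian_def)
  have "trace ((\<rho> + \<delta> x) ** (X ** dagger Y)) = trace (R ** \<delta> x ** R ** (X ** dagger Y))" for x
  proof -
    have "trace ((\<rho> + \<delta> x) ** (X ** dagger Y)) = trace ((\<rho> + \<delta> x) ** R ** X ** dagger Y ** R)"
      by (metis RZ[OF X] YR matrix_mul_assoc)
    also have "\<dots> = trace (R ** (\<rho> + \<delta> x) ** R ** X ** dagger Y)"
      using trace_mul_sym[of "(\<rho> + \<delta> x) ** R ** X ** dagger Y" R] by (simp add: matrix_mul_assoc)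
    finally show ?thesis by (simp add: matrix_ring R\<rho>)
  qed
  moreover have "ord 2 (\<lambda>x. trace (R ** \<delta> x ** R ** (X ** dagger Y)))"
    by (intro ord_bounded_linear[OF bounded_linear_trace] ord_mult_const_right complement_block_ord2)
  ultimately show ?thesis by simp
qed

lemma eigenbasis_diagonal:
  assumes "orthonormal_eigenbasis C c b"
  shows "cinner (b r) (C *v b s) = (if r = s then complex_of_real (c r) else 0)"
    and "cinner (b r) (b s) = (if r = s then 1 else 0)"
proof -
  have u: "unitary (basis_matrix b)" and C: "C = spectral_fun (basis_matrix b) c"
    using assms by (auto simp: orthonormal_eigenbasis_iff)
  show "cinner (b r) (C *v b s) = (if r = s then complex_of_real (c r) else 0)"
    unfolding coord_basis_matrix[symmetric] C spectral_fun_def coord_back[OF u] by (simp add: diag_def)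
  show "cinner (b r) (b s) = (if r = s then 1 else 0)"
    using assms by (simp add: orthonormal_eigenbasis_def)
qed

section \<open>Dependence of the relation on the state and on the correlation matrix\<close>

lemma twisted_commutator_add_correlation:
  "twisted_commutator w (C + D) X = twisted_commutator w C X + anticommutator_sum w D X"
  by (simp add: twisted_commutator_def anticommutator_sum_def vec_eq_iff scale_mat_add_left sum.distrib)

lemma anticommutator_sum_bilinear: "bilinear (anticommutator_sum w)"
  unfolding bilinear_def
proof (intro conjI allI linearI)
  fix A B X Y r
  show "anticommutator_sum w A (X + Y) = anticommutator_sum w A X + anticommutator_sum w A Y"
    by (simp add: anticommutator_sum_def vec_eq_iff matrix_ring scale_mat_add_right sum.distrib)
  show "anticommutator_sum w (A + B) X = anticommutator_sum w A X + anticommutator_sum w B X"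
    by (simp add: anticommutator_sum_def vec_eq_iff scale_mat_add_left sum.distrib)
  have "r *\<^sub>R anticommutator_sum w A X $ i = (\<Sum>j\<in>UNIV. (complex_of_real r * A $ i $ j) \<cdot>\<^sub>m (w j ** X + X ** w j))" for i
    by (simp only: anticommutator_sum_component scaleR_eq_smult scale_mat_sum_right scale_mat_smult)
  moreover have "anticommutator_sum w A (r *\<^sub>R X) $ i = (\<Sum>j\<in>UNIV. (complex_of_real r * A $ i $ j) \<cdot>\<^sub>m (w j ** X + X ** w j))" for i
    by (simp only: anticommutator_sum_component scaleR_eq_smult scale_mat_mult_left scale_mat_mult_right
        scale_mat_smult mult.commute flip: scale_mat_add_right)
  moreover have "anticommutator_sum w (r *\<^sub>R A) X $ i = (\<Sum>j\<in>UNIV. (complex_of_real r * A $ i $ j) \<cdot>\<^sub>m (w j ** X + X ** w j))" for i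
    by (simp only: anticommutator_sum_component scaleR_eq_smult scale_mat_entry)
  ultimately show "anticommutator_sum w A (r *\<^sub>R X) = r *\<^sub>R anticommutator_sum w A X"
    "anticommutator_sum w (r *\<^sub>R A) X = r *\<^sub>R anticommutator_sum w A X"
    by (simp_all add: vec_eq_iff)
qed

lemma twisted_commutator_linear: "linear (twisted_commutator w C)"
proof -
  have lin: "linear (\<lambda>X. \<chi> i. w i ** X - X ** w i)"
  proof (rule linearI)
    fix X Y r
    show "(\<chi> i. w i ** (X + Y) - (X + Y) ** w i) = (\<chi> i. w i ** X - X ** w i) + (\<chi> i. w i ** Y - Y ** w i)"
      by (simp add: vec_eq_iff matrix_ring)
    have "w i ** (r *\<^sub>R X) - (r *\<^sub>R X) ** w i = r *\<^sub>R (w i ** X - X ** w i)" for i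
      by (simp only: scaleR_eq_smult scale_mat_mult_left scale_mat_mult_right scale_mat_diff_right)
    then show "(\<chi> i. w i ** (r *\<^sub>R X) - (r *\<^sub>R X) ** w i) = r *\<^sub>R (\<chi> i. w i ** X - X ** w i)"
      by (simp add: vec_eq_iff)
  qed
  have "twisted_commutator w C = (\<lambda>X. (\<chi> i. w i ** X - X ** w i) + anticommutator_sum w C X)"
    by (simp add: twisted_commutator_def anticommutator_sum_def fun_eq_iff vec_eq_iff)
  moreover have "linear (anticommutator_sum w C)"
    using anticommutator_sum_bilinear unfolding bilinear_def by blast
  ultimately show ?thesis using linear_compose_add[OF lin] by simp
qed

lemma rank_le_card:
  assumes "hermitian (A :: complex^'d^'d)"
  shows "rank A \<le> CARD('d)"
  unfolding rank_hermitian[OF assms] by (rule dim_subset_UNIV_cart_gen)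

text \<open>The filter and the family \<open>\<gamma>\<close> are left open, so that one expansion
  serves both the neighbourhood of \<open>C\<close> within \<open>variations\<close> and
  parametrized families. The eigenbasis is arbitrary as well, because the metric coefficients are
  claimed for every one.\<close>

locale gaussian_expansion =
  fixes w :: "'n::finite + 'n \<Rightarrow> complex^'d::finite^'d" and \<rho> :: "complex^'d^'d"
    and C :: "complex^('n + 'n)^('n + 'n)" and G :: "'a filter" and \<gamma> :: "'a \<Rightarrow> complex^('n + 'n)^('n + 'n)"
    and c :: "'n + 'n \<Rightarrow> real" and b :: "'n + 'n \<Rightarrow> complex^('n + 'n)"
  assumes dim: "CARD('d) = 2 ^ CARD('n)" and w: "majorana w" and gaussian: "gaussian_state w \<rho>"
    and C: "C = correlation_matrix w \<rho>" and \<gamma>: "\<And>x. \<gamma> x \<in> variations w \<rho>" and \<gamma>_tendsto: "(\<gamma> \<longlongrightarrow> C) G"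
    and eig: "orthonormal_eigenbasis C c b"
begin

definition \<sigma> where "\<sigma> x = state_of w (\<gamma> x)"
definition \<delta> where "\<delta> x = \<sigma> x - \<rho>"
definition \<Delta> where "\<Delta> x = \<gamma> x - C"
text \<open>The orthogonal projection onto the kernel of \<open>1 - Ad\<^sub>C\<close>.\<close>

definition perp where "perp = multiplier (basis_matrix b) (\<lambda>r s. if c r * c s = 1 then 1 else 0)"

lemma small_parameter: "small_parameter G (\<lambda>x. norm (\<Delta> x))"
  using \<gamma>_tendsto by unfold_locales (auto simp: \<Delta>_def LIM_zero_iff tendsto_norm_zero_iff)

sublocale small_parameter G "\<lambda>x. norm (\<Delta> x)"
  by (rule small_parameter)

lemma unitary_b: "unitary (basis_matrix b)"
  using eig by (simp add: orthonormal_eigenbasis_iff)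

lemmas \<rho>_props = gaussian_state_properties[OF dim w gaussian C]

text \<open>If \<open>\<rho>\<close> has full rank, the bound on the rank is the one by the
  dimension; otherwise \<open>variations\<close> keeps the rank constant.\<close>

lemma \<sigma>: "gaussian_state w (\<sigma> x)" "correlation_matrix w (\<sigma> x) = \<gamma> x" "rank (\<sigma> x) \<le> rank \<rho>"
proof -
  obtain \<rho>' where \<rho>': "\<gamma> x = correlation_matrix w \<rho>'" "gaussian_state w \<rho>'"
      "rank \<rho> < CARD('d) \<longrightarrow> rank \<rho>' = rank \<rho>"
    using \<gamma>[of x] unfolding variations_def by blast
  have s: "\<sigma> x = \<rho>'" by (simp add: \<sigma>_def \<rho>' state_of_correlation_matrix[OF dim w])
  show "gaussian_state w (\<sigma> x)" "correlation_matrix w (\<sigma> x) = \<gamma> x" by (simp_all add: s \<rho>')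
  have "hermitian \<rho>'" using gaussian_state_properties(1)[OF dim w \<rho>'(2) refl] by (rule psd_hermitian)
  then show "rank (\<sigma> x) \<le> rank \<rho>"
    using \<rho>'(3) rank_le_card[of \<rho>'] by (cases "rank \<rho> < CARD('d)") (auto simp: s)
qed

lemma \<sigma>_props: "psd (\<sigma> x)" "trace (\<sigma> x) = 1" "twisted_commutator w (\<gamma> x) (\<sigma> x) = 0"
  using gaussian_state_properties[OF dim w \<sigma>(1)[of x], of "\<gamma> x"] \<sigma>(2)[of x] by auto

lemma herm_C: "dagger C = C"
  using correlation_hermitian[OF w psd_hermitian[OF \<rho>_props(1)]] by (simp add: C hermitian_def)

lemma transpose_C: "transpose C = - C"
  by (simp add: C correlation_transpose)

lemma herm_\<Delta>: "dagger (\<Delta> x) = \<Delta> x"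
  using correlation_hermitian[OF w psd_hermitian[OF \<sigma>_props(1)[of x]]] herm_C
  by (simp add: \<Delta>_def dagger_diff \<sigma>(2) hermitian_def)

lemma transpose_\<Delta>: "transpose (\<Delta> x) = - \<Delta> x"
proof -
  have "transpose (\<gamma> x - C) = transpose (\<gamma> x) - transpose C"
    by (simp add: transpose_def vec_eq_iff)
  also have "transpose (\<gamma> x) = - \<gamma> x" using correlation_transpose[of w "\<sigma> x"] by (simp add: \<sigma>(2))
  finally show ?thesis by (simp add: \<Delta>_def transpose_C)
qed

lemma ord_\<Delta>: "ord 1 \<Delta>"
  by (rule ordI[of 1]) auto

text \<open>The twisted commutator is linear and injective on the closed subspace of traceless
  operators, hence bounded below there in finite dimension. Orders can therefore be read off after
  applying it.\<close>

lemma ord_of_twisted: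
  assumes "\<And>x. trace (X x) = 0" "ord k (\<lambda>x. twisted_commutator w C (X x))"
  shows "ord k X"
proof -
  have lin: "linear (trace :: complex^'d^'d \<Rightarrow> complex)"
    using bounded_linear_trace bounded_linear.linear by blast
  let ?S = "{X :: complex^'d^'d. trace X = 0}"
  have "subspace ?S" using linear_subspace_kernel[OF lin] .
  then obtain e where e: "e > 0" "\<And>X. trace X = 0 \<Longrightarrow> e * norm X \<le> norm (twisted_commutator w C X)"
    using injective_imp_isometric[of ?S "twisted_commutator w C"] closed_subspace[of ?S]
      twisted_commutator_linear[of w C] \<rho>_props(4) by (auto simp: linear_conv_bounded_linear)
  show ?thesis
  proof (rule ord_bound[OF assms(2), of "1 / e"])
    show "\<forall>\<^sub>F x in G. norm (X x) \<le> 1 / e * norm (twisted_commutator w C (X x))"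
      using e(1) e(2)[OF assms(1)] by (intro always_eventually) (simp add: field_simps)
  qed (use e in simp)
qed

lemma ord_anticommutator_sum:
  assumes "ord k A" "ord l X"
  shows "ord (k + l) (\<lambda>x. anticommutator_sum w (A x) (X x))"
proof -
  obtain L where L: "L > 0" "\<And>A X. norm (anticommutator_sum w A X) \<le> L * norm A * norm X"
    using bilinear_bounded_pos[OF anticommutator_sum_bilinear] by blast
  obtain K where K: "0 \<le> K" "\<forall>\<^sub>F x in G. norm (A x) \<le> K * norm (\<Delta> x) ^ k" using ordE[OF assms(1)] by blast
  obtain M where M: "0 \<le> M" "\<forall>\<^sub>F x in G. norm (X x) \<le> M * norm (\<Delta> x) ^ l" using ordE[OF assms(2)] by blast
  show ?thesis
  proof (rule ordI[of "L * K * M"])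
    show "\<forall>\<^sub>F x in G. norm (anticommutator_sum w (A x) (X x)) \<le> L * K * M * norm (\<Delta> x) ^ (k + l)"
      using K(2) M(2)
    proof eventually_elim
      case (elim x)
      have "norm (anticommutator_sum w (A x) (X x)) \<le> L * (norm (A x) * norm (X x))"
        using L(2)[of "A x" "X x"] by (simp add: mult.assoc)
      also have "\<dots> \<le> L * ((K * norm (\<Delta> x) ^ k) * (M * norm (\<Delta> x) ^ l))"
        using elim K(1) L(1) by (intro mult_left_mono mult_mono) auto
      finally show ?case by (simp add: power_add mult_ac)
    qed
  qed (use K M L in auto)
qed

lemma twisted_\<delta>: "twisted_commutator w C (\<delta> x) = - anticommutator_sum w (\<Delta> x) (\<sigma> x)"
  using \<sigma>_props(3)[of x] \<rho>_props(3) twisted_commutator_add_correlation[of w C "\<Delta> x" "\<sigma> x"]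
  by (simp add: \<delta>_def linear_diff[OF twisted_commutator_linear] \<Delta>_def eq_neg_iff_add_eq_0)

lemma trace_\<delta>: "trace (\<delta> x) = 0"
  by (simp add: \<delta>_def trace_sub \<sigma>_props \<rho>_props)

text \<open>The right-hand side of \<open>twisted_\<delta>\<close> is linear in
  \<open>\<Delta>\<close> and in the perturbed state, and states have norm at most 1. So
  \<open>\<delta>\<close> is of first order without any continuity known in advance.\<close>

lemma ord_\<delta>: "ord 1 \<delta>"
proof (rule ord_of_twisted[OF trace_\<delta>])
  have "norm (\<sigma> x) \<le> 1" for x
    using psd_norm_le_trace[OF \<sigma>_props(1)[of x]] by (simp add: \<sigma>_props)
  then have "ord 0 \<sigma>" by (intro ordI[of 1]) auto
  from ord_minus[OF ord_anticommutator_sum[OF ord_\<Delta> this]]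
  show "ord 1 (\<lambda>x. twisted_commutator w C (\<delta> x))" by (simp add: twisted_\<delta>)
qed

lemma perturbed_density: "\<exists>T V. perturbed_density G (\<lambda>x. norm (\<Delta> x)) \<rho> T V \<delta>"
proof -
  obtain T V where "psd T" "hermitian V" "T ** T = \<rho>" "T ** V = V ** T" "T ** V ** T = T" "V ** T ** V = V"
    using psd_root_and_pinv[OF \<rho>_props(1)] by blast
  then show ?thesis
    using ord_\<delta> \<sigma>_props(1) \<sigma>(3)
    by (intro exI[of _ T] exI[of _ V]) (unfold_locales, auto simp: \<delta>_def)
qed

text \<open>With \<open>A = lincomb w (b r)\<close>, the numbers \<open>1 + c r\<close> and
  \<open>1 - c r\<close> are the expectation values of the positive operators
  \<open>A ** dagger A\<close> and \<open>dagger A ** A\<close>.\<close>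

lemma eigenvalue_bound: "\<bar>c r\<bar> \<le> 1"
proof -
  let ?A = "lincomb w (b r)"
  have "trace (\<rho> ** (?A ** dagger ?A)) = complex_of_real (1 + c r)"
      "trace (\<rho> ** (dagger ?A ** ?A)) = complex_of_real (1 - c r)"
    by (simp_all add: trace_lincomb[OF w \<rho>_props(2)] eigenbasis_diagonal[OF eig] flip: C)
  moreover have "trace (dagger ?A ** \<rho> ** ?A) = trace (\<rho> ** (?A ** dagger ?A))"
      "trace (dagger (dagger ?A) ** \<rho> ** dagger ?A) = trace (\<rho> ** (dagger ?A ** ?A))"
    using trace_mul_sym[of "dagger ?A" "\<rho> ** ?A"] trace_mul_sym[of ?A "\<rho> ** dagger ?A"]
    by (simp_all add: matrix_mul_assoc)
  ultimately have "0 \<le> 1 + c r" "0 \<le> 1 - c r"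
    using psd_trace[OF psd_conj[OF \<rho>_props(1)], of ?A] psd_trace[OF psd_conj[OF \<rho>_props(1)], of "dagger ?A"]
    by simp_all
  then show ?thesis by simp
qed

lemma eigenvalues_mult_1: "c r * c s = 1 \<Longrightarrow> c r = c s \<and> (c r = 1 \<or> c r = - 1)"
proof -
  assume 1: "c r * c s = 1"
  have "\<bar>c r\<bar> * \<bar>c s\<bar> = 1" using 1 by (simp flip: abs_mult)
  then have "\<bar>c r\<bar> = 1" "\<bar>c s\<bar> = 1"
    using eigenvalue_bound[of r] eigenvalue_bound[of s]
    by (smt (verit) mult_left_le mult_right_le_one_le abs_ge_zero mult_cancel_right1)+
  then show ?thesis using 1 by (auto simp: abs_if split: if_splits)
qed

text \<open>The entries of \<open>\<Delta>\<close> in the kernel of \<open>1 - Ad\<^sub>C\<close> are second moments of the perturbed state in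
  operators that annihilate \<open>\<rho>\<close>.\<close>

lemma ord_perp: "ord 2 (\<lambda>x. perp (\<Delta> x))"
proof -
  obtain T V where "perturbed_density G (\<lambda>x. norm (\<Delta> x)) \<rho> T V \<delta>" using perturbed_density by blast
  then interpret pd: perturbed_density G "\<lambda>x. norm (\<Delta> x)" \<rho> T V \<delta> .
  have \<sigma>\<delta>: "\<rho> + \<delta> x = \<sigma> x" for x by (simp add: \<delta>_def)
  have C\<gamma>: "\<gamma> x = C + \<Delta> x" for x by (simp add: \<Delta>_def)
  note D = eigenbasis_diagonal[OF eig]
  have "ord 2 (\<lambda>x. cinner (b r) (\<Delta> x *v b s))" if rs: "c r * c s = 1" for r s
  proof -
    consider "c r = - 1" "c s = - 1" | "c r = 1" "c s = 1"
      using eigenvalues_mult_1[OF rs] by auto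
    then show ?thesis
    proof cases
      case 1
      have "trace (\<rho> ** (lincomb w (b q) ** dagger (lincomb w (b q)))) = 0" if "c q = - 1" for q
        by (simp add: trace_lincomb[OF w \<rho>_props(2)] D that flip: C)
      from pd.annihilated_moment[OF this this, OF 1]
      show ?thesis
        by (cases "r = s") (simp_all add: \<sigma>\<delta> trace_lincomb[OF w \<sigma>_props(2)] \<sigma>(2) C\<gamma>
            matrix_vector_mult_add_rdistrib cinner_add_right D 1)
    next
      case 2
      \<comment> \<open>For eigenvalue 1 the adjoint of \<open>lincomb w (b q)\<close> annihilates
        \<open>\<rho>\<close>. The moments now come from \<open>1 - C\<close>, with the operators in
        reverse order; hence \<open>ord_minus\<close> and the swapped indices below.\<close>
      have "trace (\<rho> ** (dagger (lincomb w (b q)) ** dagger (dagger (lincomb w (b q))))) = 0" if "c q = 1" for q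
        by (simp add: trace_lincomb[OF w \<rho>_props(2)] D that flip: C)
      from ord_minus[OF pd.annihilated_moment[OF this this, OF 2(2,1)]]
      show ?thesis
        by (cases "r = s") (simp_all add: \<sigma>\<delta> trace_lincomb[OF w \<sigma>_props(2)] \<sigma>(2) C\<gamma>
            matrix_vector_mult_add_rdistrib cinner_add_right D 2)
    qed
  qed
  then have "ord 2 (\<lambda>x. coord (basis_matrix b) (perp (\<Delta> x)))"
    by (intro ord_matrixI)
      (auto simp: perp_def coord_multiplier[OF unitary_b] coord_basis_matrix[of b "\<Delta> _"] intro: ord_zero)
  then show ?thesis by (rule ord_bound[of _ _ 1]) (auto simp: norm_coord[OF unitary_b])
qed

end

section \<open>Solution of the first-order equation\<close>

lemma transpose_diff: "transpose (A - B) = transpose A - transpose (B :: complex^'n^'m)"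
  by (simp add: transpose_def vec_eq_iff)

lemma transpose_scale: "transpose (a \<cdot>\<^sub>m A) = a \<cdot>\<^sub>m transpose A"
  by (simp add: transpose_def vec_eq_iff scale_mat_def)

lemma dagger_transpose: "dagger (transpose A) = transpose (dagger A)"
  by (simp add: transpose_def dagger_def vec_eq_iff)

lemma trace_transpose': "trace (transpose A) = trace (A :: complex^'n^'n)"
  by (simp add: trace_def transpose_def)

lemma norm_transpose: "norm (transpose A) = norm (A :: complex^'n^'n)"
proof -
  have "(norm (transpose A))\<^sup>2 = (norm A)\<^sup>2"
    unfolding norm_matrix_sq_entries transpose_def vec_lambda_beta by (rule sum.swap)
  then show ?thesis by simp
qed

lemma trace_mult_transpose: "trace (A ** transpose B) = (\<Sum>i\<in>UNIV. \<Sum>j\<in>UNIV. A $ i $ j * (B :: complex^'n^'n) $ i $ j)"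
  by (simp add: trace_mult_entries transpose_def)

lemma clinear_op_bounded_linear:
  assumes "clinear_op T"
  shows "bounded_linear T"
  unfolding linear_conv_bounded_linear[symmetric]
  by (rule linearI) (use assms in \<open>simp_all add: clinear_op_def scaleR_eq_smult\<close>)

lemma quad_linear: "linear (quad w)"
proof (rule linearI)
  show "quad w (A + B) = quad w A + quad w B" for A B
    by (simp add: quad_def add_divide_distrib scale_mat_add_left sum.distrib)
  have "((complex_of_real r * a) / 2) \<cdot>\<^sub>m X = r *\<^sub>R ((a / 2) \<cdot>\<^sub>m X)" for r a and X :: "complex^'b^'b"
    by (simp add: scaleR_eq_smult scale_mat_smult)
  then show "quad w (r *\<^sub>R A) = r *\<^sub>R quad w A" for r A
    by (simp only: quad_def scaleR_eq_smult[of r A] scale_mat_entry scaleR_sum_right)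
qed

context gaussian_expansion
begin

abbreviation U where "U \<equiv> basis_matrix b"
abbreviation pinv where "pinv \<equiv> multiplier U (pinv_weight c)"

text \<open>Up to the kernel component of \<open>\<Delta> x\<close>, a solution of
  \<open>X - C X C = - \<Delta> / 2\<close>.\<close>

definition sol where "sol x = (- 1 / 2) \<cdot>\<^sub>m pinv (\<Delta> x)"
text \<open>The antisymmetric part of \<open>sol\<close>. Since \<open>C\<close> is antisymmetric,
  transposition commutes with \<open>X \<mapsto> X - C X C\<close>. So the equation survives, with
  the antisymmetrized kernel component \<open>E\<close> as error.\<close>

definition K where "K x = (1 / 2) \<cdot>\<^sub>m (sol x - transpose (sol x))"
definition E where "E x = (1 / 4) \<cdot>\<^sub>m (perp (\<Delta> x) - transpose (perp (\<Delta> x)))"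
text \<open>Subtracting the expectation value makes \<open>M \<rho> + \<rho> M\<close> traceless, as
  \<open>\<delta>\<close> is.\<close>

definition M where "M x = quad w (K x) - Re (trace (quad w (K x) ** \<rho>)) *\<^sub>R mat 1"
definition D where "D x = M x ** \<rho> + \<rho> ** M x"

text \<open>\<open>1 - Ad\<^sub>C\<close> after its pseudo-inverse is the projection onto the range,
  the complement of \<open>perp\<close>.\<close>

lemma pinv_range: "pinv X - C ** pinv X ** C = X - perp X"
proof -
  have one: "complex_of_real (c r) * complex_of_real (c s) = 1 \<longleftrightarrow> c r * c s = 1" for r s
    by (metis of_real_eq_1_iff of_real_mult)
  have "one_minus_Ad C (pinv X) = X - perp X"
    unfolding one_minus_Ad_multiplier[OF eig]
    by (rule multiplier_eqI[OF unitary_b])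
      (auto simp: coord_diff perp_def coord_multiplier[OF unitary_b] pinv_weight_def one)
  then show ?thesis by (simp add: one_minus_Ad_def Ad_def herm_C)
qed

lemma K_equation: "K x - C ** K x ** C = E x - (1 / 2) \<cdot>\<^sub>m \<Delta> x"
proof -
  have s: "sol x - C ** sol x ** C = (- 1 / 2) \<cdot>\<^sub>m (\<Delta> x - perp (\<Delta> x))"
    unfolding pinv_range[symmetric] sol_def by (simp add: matrix_alg)
  have "transpose (C ** sol x ** C) = C ** transpose (sol x) ** C"
    by (simp add: matrix_transpose_mul transpose_C matrix_ring)
  then have t: "transpose (sol x) - C ** transpose (sol x) ** C = (- 1 / 2) \<cdot>\<^sub>m (- \<Delta> x - transpose (perp (\<Delta> x)))"
    using arg_cong[OF s, of transpose] by (simp add: transpose_diff transpose_scale transpose_\<Delta>)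
  have "K x - C ** K x ** C
      = (1 / 2) \<cdot>\<^sub>m ((sol x - C ** sol x ** C) - (transpose (sol x) - C ** transpose (sol x) ** C))"
    by (simp add: K_def matrix_alg)
  also have "\<dots> = E x - (1 / 2) \<cdot>\<^sub>m \<Delta> x"
  proof -
    have "(1 / 2) * ((- 1 / 2) * (d - p) - (- 1 / 2) * (- d - q)) = (1 / 4) * (p - q) - (1 / 2) * d" for d p q :: complex
      by (simp add: field_simps)
    then show ?thesis
      unfolding s t E_def by (simp only: vec_eq_iff scale_mat_entry vector_minus_component vector_uminus_component) simp
  qed
  finally show ?thesis .
qed

lemma K_transpose: "transpose (K x) = - K x"
  unfolding K_def scale_mat_minus_right[symmetric] minus_diff_eq by (simp add: transpose_scale transpose_diff)

lemma pinv_hermitian: "dagger X = X \<Longrightarrow> dagger (pinv X) = pinv X"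
proof (rule sym, rule multiplier_eqI[OF unitary_b])
  fix r s
  assume X: "dagger X = X"
  have "cnj (coord U X $ s $ r) = coord U X $ r $ s"
    using coord_dagger[of U X] X by (metis dagger_entry)
  then show "coord U (dagger (pinv X)) $ r $ s = complex_of_real (pinv_weight c r s) * coord U X $ r $ s"
    by (simp add: coord_dagger dagger_entry coord_multiplier[OF unitary_b] pinv_weight_def mult.commute)
qed

lemma K_hermitian: "hermitian (K x)"
  using pinv_hermitian[OF herm_\<Delta>[of x]]
  by (simp add: hermitian_def K_def sol_def dagger_smult dagger_diff dagger_transpose)

lemma bounded_linear_multiplier: "bounded_linear (multiplier U f)"
  by (rule clinear_op_bounded_linear[OF multiplier_clinear[OF unitary_b]])

lemma ord_transpose: "ord k X \<Longrightarrow> ord k (\<lambda>x. transpose (X x :: complex^'m^'m))"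
  by (rule ord_bound[of _ X 1]) (auto simp: norm_transpose)

lemma ord_scale:
  fixes X :: "'a \<Rightarrow> complex^'m^'m"
  assumes "ord k X"
  shows "ord k (\<lambda>x. a \<cdot>\<^sub>m X x)"
proof (rule ord_bound[OF assms, of "cmod a"])
  have "norm (a \<cdot>\<^sub>m A) = cmod a * norm A" for A :: "complex^'m^'m"
  proof -
    have "(norm (a \<cdot>\<^sub>m A))\<^sup>2 = (cmod a * norm A)\<^sup>2"
      by (simp add: norm_matrix_sq_entries scale_mat_entry norm_mult power_mult_distrib sum_distrib_left)
    then show ?thesis by (simp add: power2_eq_iff_nonneg)
  qed
  then show "\<forall>\<^sub>F x in G. norm (a \<cdot>\<^sub>m X x) \<le> cmod a * norm (X x)" by simp
qed simp

lemma ord_K: "ord 1 K"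
proof -
  have "ord 1 sol"
    unfolding sol_def by (rule ord_scale[OF ord_bounded_linear[OF bounded_linear_multiplier ord_\<Delta>]])
  from ord_scale[OF ord_diff[OF this ord_transpose[OF this]]] show ?thesis
    unfolding K_def .
qed

lemma ord_E: "ord 2 E"
  unfolding E_def by (rule ord_scale[OF ord_diff[OF ord_perp ord_transpose[OF ord_perp]]])

lemma ord_M: "ord 1 M"
proof -
  have q: "ord 1 (\<lambda>x. quad w (K x))"
    using ord_bounded_linear[OF _ ord_K] quad_linear[of w] by (simp add: linear_conv_bounded_linear)
  have "ord 1 (\<lambda>x. Re (trace (quad w (K x) ** \<rho>)) *\<^sub>R (mat 1 :: complex^'d^'d))"
    by (rule ord_bounded_linear[OF bounded_linear_scaleR_left ord_Re_trace[OF ord_mult_const_right[OF q]]])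
  with q show ?thesis unfolding M_def by (rule ord_diff)
qed

lemma quad_K_hermitian: "hermitian (quad w (K x))"
  by (rule quad_hermitian[OF w K_hermitian])

lemma M_hermitian: "hermitian (M x)"
  using quad_K_hermitian[of x]
  by (simp add: M_def hermitian_def dagger_diff scaleR_eq_smult dagger_smult)

lemma D_eq: "D x = (quad w (K x) ** \<rho> + \<rho> ** quad w (K x)) - (2 * Re (trace (quad w (K x) ** \<rho>))) *\<^sub>R \<rho>"
proof -
  have "(2 * k) *\<^sub>R \<rho> = k *\<^sub>R \<rho> + k *\<^sub>R \<rho>" for k by (simp only: mult_2 scaleR_add_left)
  then show ?thesis by (simp only: D_def M_def) (simp add: scaleR_eq_smult matrix_alg)
qed

lemma trace_D: "trace (D x) = 0"
proof -
  let ?t = "trace (quad w (K x) ** \<rho>)"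
  have "cnj ?t = trace (\<rho> ** quad w (K x))"
    using quad_K_hermitian[of x] psd_hermitian[OF \<rho>_props(1)]
    by (simp add: dagger_mult hermitian_def flip: trace_dagger)
  then have "complex_of_real (Re ?t) = ?t"
    by (simp add: trace_mul_sym[of \<rho>] complex_eq_iff)
  then show ?thesis
    by (simp add: D_eq trace_sub trace_add scaleR_eq_smult trace_smult \<rho>_props(2) trace_mul_sym[of \<rho>])
qed

lemma twisted_D: "twisted_commutator w C (D x) = anticommutator_sum w (2 \<cdot>\<^sub>m (K x - C ** K x ** C)) \<rho>"
  unfolding D_eq linear_diff[OF twisted_commutator_linear] linear_scale[OF twisted_commutator_linear]
    \<rho>_props(3) twisted_commutator_quad[OF w K_transpose \<rho>_props(3)] by simp

text \<open>The twisted commutator sends both \<open>\<delta>\<close> and \<open>D\<close> to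
  \<open>- \<Delta>\<close> paired with \<open>\<rho>\<close>, up to \<open>\<Delta>\<close> paired
  with \<open>\<delta>\<close> and the error \<open>E\<close>. Both of these are of second
  order.\<close>

lemma ord_\<delta>_D: "ord 2 (\<lambda>x. \<delta> x - D x)"
proof (rule ord_of_twisted)
  show "trace (\<delta> x - D x) = 0" for x by (simp add: trace_sub trace_\<delta> trace_D)
  have "twisted_commutator w C (\<delta> x - D x) = - (anticommutator_sum w (\<Delta> x) (\<delta> x) + anticommutator_sum w (2 \<cdot>\<^sub>m E x) \<rho>)" for x
  proof -
    have "2 \<cdot>\<^sub>m (K x - C ** K x ** C) = 2 \<cdot>\<^sub>m E x - \<Delta> x"
      unfolding K_equation by (simp add: scale_mat_diff_right scale_mat_smult)
    moreover have "\<sigma> x = \<rho> + \<delta> x" by (simp add: \<delta>_def)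
    ultimately show ?thesis
      using anticommutator_sum_bilinear[of w]
      by (simp add: linear_diff[OF twisted_commutator_linear] twisted_D twisted_\<delta> bilinear_radd bilinear_lsub)
  qed
  moreover have sum: "ord 2 (\<lambda>x. anticommutator_sum w (\<Delta> x) (\<delta> x) + anticommutator_sum w (2 \<cdot>\<^sub>m E x) \<rho>)"
  proof (rule ord_add)
    show "ord 2 (\<lambda>x. anticommutator_sum w (\<Delta> x) (\<delta> x))"
      using ord_anticommutator_sum[OF ord_\<Delta> ord_\<delta>] by (simp add: numeral_2_eq_2)
    show "ord 2 (\<lambda>x. anticommutator_sum w (2 \<cdot>\<^sub>m E x) \<rho>)"
      using ord_anticommutator_sum[OF ord_scale[OF ord_E, of 2] ord_const[of \<rho>]] by simp
  qed
  ultimately show "ord 2 (\<lambda>x. twisted_commutator w C (\<delta> x - D x))"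
    using ord_minus[OF sum] by (simp only:)
qed

text \<open>Tracing \<open>D\<close> against \<open>M\<close> gives
  \<open>2 tr (M \<rho> M)\<close>. The relation expresses the commutator moments of
  \<open>D\<close>, so the trace is a pairing of \<open>K\<close> with
  \<open>2 E - \<Delta>\<close>. Inserting \<open>K\<close> yields the quadratic form; the term with
  \<open>E\<close> is of third order.\<close>

lemma trace_M\<rho>M: "8 * trace (M x ** \<rho> ** M x) = trace (\<Delta> x ** pinv (\<Delta> x)) - 4 * trace (K x ** transpose (E x))"
proof -
  define A where "A = 2 \<cdot>\<^sub>m (K x - C ** K x ** C)"
  have A: "A = 2 \<cdot>\<^sub>m E x - \<Delta> x"
    unfolding A_def K_equation by (simp add: scale_mat_diff_right scale_mat_smult)
  have "2 * trace (M x ** \<rho> ** M x) = trace (M x ** D x)"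
    using trace_mul_sym[of "M x" "M x ** \<rho>"]
    by (simp add: D_def matrix_add_ldistrib trace_add matrix_mul_assoc)
  \<comment> \<open>The scalar part of \<open>M\<close> drops out because \<open>D\<close> is
    traceless.\<close>
  also have "\<dots> = trace (quad w (K x) ** D x)"
    by (simp add: M_def matrix_alg scaleR_eq_smult trace_sub trace_smult trace_D)
  also have "\<dots> = (\<Sum>i\<in>UNIV. \<Sum>j\<in>UNIV. K x $ i $ j * (- 2 * A $ i $ j)) / 4"
    unfolding trace_quad_mult[OF K_transpose] trace_commutator_product[OF w twisted_D]
      trace_anticommutator_product[OF w] trace_D \<rho>_props(2) A_def by simp
  also have "\<dots> = - trace (K x ** transpose A) / 2"
    by (simp add: trace_mult_transpose sum_negf sum_distrib_left[symmetric] mult.left_commute)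
  finally have "4 * (2 * trace (M x ** \<rho> ** M x)) = 4 * (- trace (K x ** transpose A) / 2)" by (rule arg_cong)
  then have 1: "8 * trace (M x ** \<rho> ** M x) = - 2 * trace (K x ** transpose A)" by simp
  have tA: "transpose A = 2 \<cdot>\<^sub>m transpose (E x) + \<Delta> x"
    by (simp add: A transpose_diff transpose_scale transpose_\<Delta>)
  \<comment> \<open>As \<open>\<Delta>\<close> is antisymmetric, \<open>sol\<close> and minus its
    transpose contribute equally to \<open>tr (K \<Delta>)\<close>.\<close>
  have "trace (transpose (sol x) ** \<Delta> x) = trace (transpose (transpose (\<Delta> x) ** sol x))"
    by (simp add: matrix_transpose_mul)
  also have "\<dots> = - trace (\<Delta> x ** sol x)"
    by (simp add: trace_transpose' transpose_\<Delta> matrix_minus_left trace_minus)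
  finally have "trace (K x ** \<Delta> x) = trace (\<Delta> x ** sol x)"
    by (simp add: K_def matrix_alg trace_sub trace_smult trace_mul_sym[of "sol x"])
  also have "\<dots> = - trace (\<Delta> x ** pinv (\<Delta> x)) / 2"
    by (simp add: sol_def scale_mat_mult_right trace_smult)
  finally show ?thesis
    unfolding 1 tA by (simp add: matrix_alg trace_add trace_smult)
qed

theorem bures_expansion: "ord 3 (\<lambda>x. 8 * bures_sq \<rho> (\<sigma> x) - Re (trace (\<Delta> x ** pinv (\<Delta> x))))"
proof -
  obtain T V where "perturbed_density G (\<lambda>x. norm (\<Delta> x)) \<rho> T V \<delta>" using perturbed_density by blast
  then interpret pd: perturbed_density G "\<lambda>x. norm (\<Delta> x)" \<rho> T V \<delta> .
  have "ord 3 (\<lambda>x. 2 * (1 - fidelity \<rho> (\<rho> + \<delta> x)) - Re (trace (M x ** \<rho> ** M x)))"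
    by (rule pd.fidelity_expansion[OF \<rho>_props(2) _ ord_M M_hermitian])
      (use ord_\<delta>_D in \<open>simp_all add: trace_\<delta> D_def\<close>)
  from ord_bounded_linear[OF bounded_linear_mult_right[of 8] this]
  have 1: "ord 3 (\<lambda>x. 8 * (2 * (1 - fidelity \<rho> (\<rho> + \<delta> x)) - Re (trace (M x ** \<rho> ** M x))))" .
  have "ord 3 (\<lambda>x. Re (trace (K x ** transpose (E x))))"
    by (intro ord_Re_trace ord_mult[OF ord_K ord_transpose[OF ord_E]]) simp
  from ord_bounded_linear[OF bounded_linear_mult_right[of 4] this]
  have 2: "ord 3 (\<lambda>x. 4 * Re (trace (K x ** transpose (E x))))" .
  have "8 * bures_sq \<rho> (\<sigma> x) - Re (trace (\<Delta> x ** pinv (\<Delta> x)))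
      = 8 * (2 * (1 - fidelity \<rho> (\<rho> + \<delta> x)) - Re (trace (M x ** \<rho> ** M x))) - 4 * Re (trace (K x ** transpose (E x)))" for x
    using arg_cong[OF trace_M\<rho>M[of x], of Re] by (simp add: bures_sq_def \<delta>_def algebra_simps)
  then show ?thesis using ord_diff[OF 1 2] by simp
qed

text \<open>For a pure state every product \<open>c r * c s\<close> is 1 or -1, so off the kernel
  the weight is \<open>1 / (1 + 1) = 1/2\<close>.\<close>

lemma pure_pinv:
  assumes "pure_state \<rho>"
  shows "(c r)\<^sup>2 = 1" "pinv X = (1 / 2) \<cdot>\<^sub>m (X - perp X)"
proof -
  have "coord U C = diag (\<lambda>r. complex_of_real (c r))"
    by (simp add: vec_eq_iff coord_basis_matrix eigenbasis_diagonal[OF eig] diag_def)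
  then have "diag (\<lambda>r. complex_of_real (c r) * complex_of_real (c r)) = coord U (C ** C)"
    by (simp add: coord_mult[OF unitary_b] diag_mult)
  also have "\<dots> = mat 1"
    by (simp add: \<rho>_props(5)[OF assms] coord_def unitaryD[OF unitary_b])
  finally have eq: "diag (\<lambda>r. complex_of_real (c r) * complex_of_real (c r)) = mat 1" .
  have "complex_of_real (c r) * complex_of_real (c r) = 1" for r
    using eq[THEN arg_cong[of _ _ "\<lambda>A. A $ r $ r"]] by (simp add: diag_def mat_def)
  then have c2: "c r * c r = 1" for r by (metis of_real_eq_1_iff of_real_mult)
  then show "(c r)\<^sup>2 = 1" by (simp add: power2_eq_square)
  have pm: "c r = 1 \<or> c r = - 1" for r using c2[of r] by (simp add: square_eq_1_iff)
  then have pw: "pinv_weight c r s = (if c r * c s = 1 then 0 else 1 / 2)" for r s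
    using pm[of r] pm[of s] by (elim disjE) (simp_all add: pinv_weight_def)
  show "pinv X = (1 / 2) \<cdot>\<^sub>m (X - perp X)"
    by (rule multiplier_eqI[OF unitary_b])
      (simp add: coord_scale coord_diff scale_mat_entry perp_def coord_multiplier[OF unitary_b] pw)
qed

text \<open>The pseudo-inverse is half the identity minus half of \<open>perp\<close>. The latter
  contributes \<open>tr (\<Delta> perp \<Delta>)\<close>, which \<open>ord_perp\<close> makes of
  third order.\<close>

lemma pure_expansion:
  assumes "pure_state \<rho>"
  shows "ord 3 (\<lambda>x. Re (trace (\<Delta> x ** pinv (\<Delta> x))) - 1 / 2 * (norm (\<Delta> x))\<^sup>2)"
proof -
  have "ord 3 (\<lambda>x. Re (trace (\<Delta> x ** perp (\<Delta> x))))"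
    by (intro ord_Re_trace ord_mult[OF ord_\<Delta> ord_perp]) simp
  from ord_bounded_linear[OF bounded_linear_mult_right[of "- 1 / 2"] this]
  have "ord 3 (\<lambda>x. (- 1 / 2) * Re (trace (\<Delta> x ** perp (\<Delta> x))))" .
  moreover have "Re (trace (\<Delta> x ** pinv (\<Delta> x))) - 1 / 2 * (norm (\<Delta> x))\<^sup>2 = (- 1 / 2) * Re (trace (\<Delta> x ** perp (\<Delta> x)))" for x
    by (simp add: pure_pinv[OF assms] scale_mat_mult_right matrix_diff_ldistrib trace_smult trace_sub
        norm_sq_hermitian hermitian_def herm_\<Delta> diff_divide_distrib)
  ultimately show ?thesis by simp
qed

end

text \<open>\<open>d\<close> is the distance in which the final error is measured, either of
  matrices or of parameters. Since it dominates the small parameter, a third-order error is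
  negligible against its square.\<close>

lemma (in small_parameter) ord_smallo:
  fixes f d :: "'a \<Rightarrow> real"
  assumes f: "ord 3 f" and d: "\<And>x. 0 \<le> d x" "(d \<longlongrightarrow> 0) G" and M: "0 \<le> M" "\<forall>\<^sub>F x in G. \<epsilon> x \<le> M * d x"
  shows "f \<in> o[G](\<lambda>x. (d x)\<^sup>2)"
proof (rule landau_o.smallI)
  fix e :: real assume e: "e > 0"
  obtain K where K: "0 \<le> K" "\<forall>\<^sub>F x in G. norm (f x) \<le> K * \<epsilon> x ^ 3" using ordE[OF f] by blast
  have "((\<lambda>x. K * M ^ 3 * d x) \<longlongrightarrow> K * M ^ 3 * 0) G" by (intro tendsto_intros d)
  then have "\<forall>\<^sub>F x in G. K * M ^ 3 * d x < e" using e by (intro order_tendstoD(2)[of _ 0]) auto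
  then show "\<forall>\<^sub>F x in G. norm (f x) \<le> e * norm ((d x)\<^sup>2)"
    using K(2) M(2)
  proof eventually_elim
    case (elim x)
    have "norm (f x) \<le> K * (M * d x) ^ 3"
      using elim(2) K(1) power_mono[OF elim(3) eps_nonneg, of 3] by (meson mult_left_mono order_trans)
    also have "\<dots> = (K * M ^ 3 * d x) * (d x)\<^sup>2" by (simp add: power_mult_distrib power3_eq_cube power2_eq_square)
    also have "\<dots> \<le> e * (d x)\<^sup>2" using elim(1) by (intro mult_right_mono) auto
    finally show ?case by simp
  qed
qed

lemma metric_coeff_eq:
  assumes "orthonormal_eigenbasis C c b"
  shows "metric_coeff c b A B = trace (A ** multiplier (basis_matrix b) (pinv_weight c) B)"
proof -
  have u: "unitary (basis_matrix b)" using assms by (simp add: orthonormal_eigenbasis_iff)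
  let ?f = "\<lambda>r s. if c r * c s \<noteq> 1 then cinner (b r) (A *v b s) * cinner (b s) (B *v b r) / complex_of_real (1 - c r * c s) else 0"
  have "metric_coeff c b A B = (\<Sum>p\<in>UNIV. ?f (fst p) (snd p))"
  proof -
    have S: "{(r, s). c r * c s \<noteq> 1} = {p \<in> UNIV. c (fst p) * c (snd p) \<noteq> 1}" by auto
    show ?thesis
      unfolding metric_coeff_def S case_prod_beta by (rule sum.inter_filter) simp
  qed
  also have "\<dots> = (\<Sum>r\<in>UNIV. \<Sum>s\<in>UNIV. ?f r s)"
    unfolding sum.cartesian_product by (simp add: case_prod_beta)
  also have "\<dots> = trace (A ** multiplier (basis_matrix b) (pinv_weight c) B)"
    unfolding trace_mult_coord[OF u] coord_multiplier[OF u] unfolding coord_basis_matrix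
    by (intro sum.cong refl) (simp add: pinv_weight_def mult.commute)
  finally show ?thesis .
qed

section \<open>Variations along a parametrized family\<close>

lemma bounded_linear_dagger: "bounded_linear (dagger :: complex^'n^'n \<Rightarrow> complex^'n^'n)"
  unfolding linear_conv_bounded_linear[symmetric]
  by (rule linearI) (simp_all add: dagger_add scaleR_eq_smult dagger_smult)

text \<open>Turns second-order smallness into a vanishing derivative. Uniqueness of derivatives then
  yields linear constraints on the tangent vectors of a family.\<close>

lemma has_derivative_zeroI:
  fixes f :: "'a::real_normed_vector \<Rightarrow> 'b::real_normed_vector"
  assumes "f l = 0" "0 \<le> B" "\<forall>\<^sub>F x in at l. norm (f x) \<le> B * (norm (x - l))\<^sup>2"
  shows "(f has_derivative (\<lambda>_. 0)) (at l)"
  unfolding has_derivative_at_alt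
proof (intro conjI allI impI)
  fix e :: real assume e: "0 < e"
  obtain d where d: "d > 0" "\<And>x. x \<noteq> l \<Longrightarrow> dist x l < d \<Longrightarrow> norm (f x) \<le> B * (norm (x - l))\<^sup>2"
    using assms(3) unfolding eventually_at by blast
  show "\<exists>d>0. \<forall>y. norm (y - l) < d \<longrightarrow> norm (f y - f l - 0) \<le> e * norm (y - l)"
  proof (intro exI[of _ "min d (e / (B + 1))"] conjI allI impI)
    show "0 < min d (e / (B + 1))" using d(1) e assms(2) by simp
    fix y assume y: "norm (y - l) < min d (e / (B + 1))"
    show "norm (f y - f l - 0) \<le> e * norm (y - l)"
    proof (cases "y = l")
      case False
      have "norm (y - l) * (B + 1) < e" using y assms(2) by (simp add: pos_less_divide_eq)
      then have "B * norm (y - l) \<le> e" by (simp add: algebra_simps) (smt (verit) norm_ge_zero)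
      then have "B * norm (y - l) * norm (y - l) \<le> e * norm (y - l)" by (rule mult_right_mono) simp
      moreover have "norm (f y) \<le> B * (norm (y - l))\<^sup>2" using d(2)[of y] y False by (simp add: dist_norm)
      ultimately show ?thesis by (simp add: assms(1) power2_eq_square mult.assoc)
    qed (simp add: assms(1))
  qed
qed simp

locale gaussian_curve =
  fixes w :: "'n::finite + 'n \<Rightarrow> complex^'d::finite^'d" and \<rho> :: "complex^'d^'d"
    and C :: "complex^('n + 'n)^('n + 'n)" and c :: "'n + 'n \<Rightarrow> real" and b :: "'n + 'n \<Rightarrow> complex^('n + 'n)"
    and Cf :: "real^'p::finite \<Rightarrow> complex^('n + 'n)^('n + 'n)" and l h
  assumes dim': "CARD('d) = 2 ^ CARD('n)" and w': "majorana w" and gaussian': "gaussian_state w \<rho>"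
    and C': "C = correlation_matrix w \<rho>" and Cl: "Cf l = C"
    and var: "\<forall>\<^sub>F x in nhds l. Cf x \<in> variations w \<rho>"
    and deriv: "(Cf has_derivative h) (at l)" and eig': "orthonormal_eigenbasis C c b"
begin

text \<open>\<open>gaussian_expansion\<close> asks for membership in \<open>variations\<close> at
  every point, while \<open>Cf\<close> has it near \<open>l\<close> only. The default value
  \<open>C\<close> is itself a variation.\<close>

definition \<gamma> where "\<gamma> x = (if Cf x \<in> variations w \<rho> then Cf x else C)"

lemma \<gamma>_eq: "\<forall>\<^sub>F x in at l. \<gamma> x = Cf x"
proof -
  have "\<forall>\<^sub>F x in at l. Cf x \<in> variations w \<rho>"
    using var unfolding eventually_at_filter by (rule eventually_mono) simp
  then show ?thesis by (rule eventually_mono) (simp add: \<gamma>_def)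
qed

sublocale gaussian_expansion w \<rho> C "at l" \<gamma> c b
proof
  have "C \<in> variations w \<rho>" using gaussian' unfolding C' variations_def by blast
  then show "\<gamma> x \<in> variations w \<rho>" for x by (simp add: \<gamma>_def)
  have "(Cf \<longlongrightarrow> C) (at l)"
    using has_derivative_continuous[OF deriv] by (simp add: continuous_at Cl)
  then show "(\<gamma> \<longlongrightarrow> C) (at l)"
    by (rule Lim_transform_eventually) (use \<gamma>_eq in eventually_elim, simp)
qed (fact dim' w' gaussian' C' eig')+

lemma h_linear: "bounded_linear h"
  using deriv by (rule has_derivative_bounded_linear)

lemma \<gamma>_hermitian: "dagger (\<gamma> x) = \<gamma> x"
  using herm_\<Delta>[of x] herm_C by (simp add: \<Delta>_def dagger_diff)

text \<open>\<open>Cf x - dagger (Cf x)\<close> vanishes near \<open>l\<close>, and therefore so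
  does its derivative.\<close>

lemma h_hermitian: "dagger (h v) = h v"
proof -
  let ?L = "\<lambda>X :: complex^('n + 'n)^('n + 'n). X - dagger X"
  have "bounded_linear ?L"
    by (intro bounded_linear_sub bounded_linear_ident bounded_linear_dagger)
  then have 1: "((\<lambda>x. ?L (Cf x)) has_derivative (\<lambda>v. ?L (h v))) (at l)"
    using deriv by (rule bounded_linear.has_derivative)
  have "?L (Cf l) = 0" by (simp add: Cl herm_C)
  moreover have "\<forall>\<^sub>F x in at l. norm (?L (Cf x)) \<le> 0 * (norm (x - l))\<^sup>2"
    using \<gamma>_eq
  proof eventually_elim
    case (elim x)
    then show ?case using \<gamma>_hermitian[of x] by simp
  qed
  ultimately have "((\<lambda>x. ?L (Cf x)) has_derivative (\<lambda>_. 0)) (at l)"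
    by (rule has_derivative_zeroI[OF _ order_refl])
  from has_derivative_unique[OF 1 this] have "?L (h v) = 0" by (simp add: fun_eq_iff)
  then show ?thesis by simp
qed

lemma remainder_bound:
  assumes "0 < e"
  shows "\<forall>\<^sub>F x in at l. norm (\<Delta> x - h (x - l)) \<le> e * norm (x - l)"
proof -
  obtain d where "d > 0" "\<And>y. norm (y - l) < d \<Longrightarrow> norm (Cf y - Cf l - h (y - l)) \<le> e * norm (y - l)"
    using deriv assms unfolding has_derivative_at_alt by blast
  then have "\<forall>\<^sub>F x in at l. norm (Cf x - C - h (x - l)) \<le> e * norm (x - l)"
    unfolding eventually_at Cl by (auto simp: dist_norm)
  then show ?thesis
    using \<gamma>_eq by eventually_elim (simp add: \<Delta>_def)
qed

lemma h_bound: obtains H where "0 \<le> H" "\<And>v. norm (h v) \<le> H * norm v"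
  using bounded_linear.nonneg_bounded[OF h_linear] by (metis mult.commute)

lemma \<Delta>_bound: "\<exists>B\<ge>0. \<forall>\<^sub>F x in at l. norm (\<Delta> x) \<le> B * norm (x - l)"
proof -
  obtain H where H: "0 \<le> H" "\<And>v. norm (h v) \<le> H * norm v" using h_bound by blast
  have "\<forall>\<^sub>F x in at l. norm (\<Delta> x) \<le> (H + 1) * norm (x - l)"
    using remainder_bound[of 1, OF zero_less_one]
  proof eventually_elim
    case (elim x)
    show ?case
      using norm_triangle_sub[of "\<Delta> x" "h (x - l)"] elim H(2)[of "x - l"] by (simp add: distrib_right)
  qed
  then show ?thesis using H(1) by (intro exI[of _ "H + 1"]) simp
qed

lemma distance_tendsto: "((\<lambda>x. norm (x - l)) \<longlongrightarrow> 0) (at l)"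
  by (intro tendsto_norm_zero LIM_zero tendsto_ident_at)

text \<open>\<open>perp (Cf x - C)\<close> is of second order in \<open>x - l\<close> by
  \<open>ord_perp\<close>. So tangent vectors lie in the range of
  \<open>1 - Ad\<^sub>C\<close>.\<close>

lemma h_tangential: "perp (h v) = 0"
proof -
  have bl: "bounded_linear perp"
    unfolding perp_def by (rule bounded_linear_multiplier)
  have "((\<lambda>x. Cf x - C) has_derivative h) (at l)"
    using has_derivative_diff[OF deriv has_derivative_const[of C]] by simp
  then have 1: "((\<lambda>x. perp (Cf x - C)) has_derivative (\<lambda>v. perp (h v))) (at l)"
    by (rule bounded_linear.has_derivative[OF bl])
  obtain B where B: "0 \<le> B" "\<forall>\<^sub>F x in at l. norm (\<Delta> x) \<le> B * norm (x - l)" using \<Delta>_bound by blast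
  obtain K where K: "0 \<le> K" "\<forall>\<^sub>F x in at l. norm (perp (\<Delta> x)) \<le> K * norm (\<Delta> x) ^ 2"
    using ordE[OF ord_perp] by blast
  have "\<forall>\<^sub>F x in at l. norm (perp (Cf x - C)) \<le> K * B\<^sup>2 * (norm (x - l))\<^sup>2"
    using B(2) K(2) \<gamma>_eq
  proof eventually_elim
    case (elim x)
    have "norm (perp (\<Delta> x)) \<le> K * (B * norm (x - l))\<^sup>2"
      using elim(2) K(1) power_mono[OF elim(1), of 2] by (meson mult_left_mono norm_ge_zero order_trans)
    then show ?case using elim(3) by (simp add: \<Delta>_def power_mult_distrib mult.assoc)
  qed
  then have "((\<lambda>x. perp (Cf x - C)) has_derivative (\<lambda>_. 0)) (at l)"
    using B(1) K(1)
    by (intro has_derivative_zeroI[where B = "K * B\<^sup>2"]) (auto simp: Cl linear_0[OF bounded_linear.linear[OF bl]])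
  from has_derivative_unique[OF 1 this] show ?thesis by (simp add: fun_eq_iff)
qed

text \<open>In a bounded bilinear form, replacing \<open>\<Delta>\<close> by its linearization costs
  the product of an \<open>o(norm (x - l))\<close> remainder and an \<open>O(norm (x - l))\<close>
  factor.\<close>

lemma quadratic_form_expansion:
  "(\<lambda>x. Re (trace (\<Delta> x ** pinv (\<Delta> x))) - Re (trace (h (x - l) ** pinv (h (x - l)))))
    \<in> o[at l](\<lambda>x. (norm (x - l))\<^sup>2)"
proof (rule landau_o.smallI)
  fix e :: real assume e: "0 < e"
  obtain H where H: "0 \<le> H" "\<And>v. norm (h v) \<le> H * norm v" using h_bound by blast
  obtain B where B: "0 \<le> B" "\<forall>\<^sub>F x in at l. norm (\<Delta> x) \<le> B * norm (x - l)" using \<Delta>_bound by blast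
  obtain L where L: "0 \<le> L" "\<And>X. norm (pinv X) \<le> norm X * L"
    using bounded_linear.nonneg_bounded[OF bounded_linear_multiplier] by blast
  have q: "\<bar>Re (trace (X ** pinv Y))\<bar> \<le> L * norm X * norm Y" for X Y
  proof -
    have "norm X * norm (pinv Y) \<le> norm X * (norm Y * L)" by (intro mult_left_mono L) simp
    then show ?thesis using abs_Re_trace_le[of X "pinv Y"] by (simp add: mult_ac)
  qed
  \<comment> \<open>Chosen so that \<open>L * (B + H) * e' \<le> e\<close>; the added 1 covers a
    vanishing constant.\<close>
  define e' where "e' = e / (L * (B + H) + 1)"
  have pos: "0 < L * (B + H) + 1" using L(1) B(1) H(1) by (simp add: add_nonneg_pos)
  then have e': "0 < e'" using e by (simp add: e'_def)
  show "\<forall>\<^sub>F x in at l. norm (Re (trace (\<Delta> x ** pinv (\<Delta> x))) - Re (trace (h (x - l) ** pinv (h (x - l)))))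
      \<le> e * norm ((norm (x - l))\<^sup>2)"
    using remainder_bound[OF e'] B(2)
  proof eventually_elim
    case (elim x)
    let ?r = "\<Delta> x - h (x - l)" and ?n = "norm (x - l)"
    have "pinv ?r = pinv (\<Delta> x) - pinv (h (x - l))"
      by (rule linear_diff[OF bounded_linear.linear[OF bounded_linear_multiplier]])
    then have "Re (trace (\<Delta> x ** pinv (\<Delta> x))) - Re (trace (h (x - l) ** pinv (h (x - l))))
        = Re (trace (?r ** pinv (\<Delta> x))) + Re (trace (h (x - l) ** pinv ?r))"
      by (simp add: matrix_ring trace_sub)
    also have "\<bar>\<dots>\<bar> \<le> L * norm ?r * norm (\<Delta> x) + L * norm (h (x - l)) * norm ?r"
      using q[of ?r "\<Delta> x"] q[of "h (x - l)" ?r] by linarith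
    also have "\<dots> = L * (norm ?r * (norm (\<Delta> x) + norm (h (x - l))))" by (simp add: algebra_simps)
    also have "\<dots> \<le> L * ((e' * ?n) * (B * ?n + H * ?n))"
      using elim H(2)[of "x - l"] L(1) e' by (intro mult_left_mono mult_mono add_mono) auto
    also have "\<dots> = (L * (B + H)) * e' * ?n\<^sup>2" by (simp add: power2_eq_square algebra_simps)
    also have "\<dots> \<le> e * ?n\<^sup>2"
    proof (rule mult_right_mono)
      have "(L * (B + H)) * e' \<le> (L * (B + H) + 1) * e'" using e' by (intro mult_right_mono) auto
      also have "\<dots> = e" using pos by (simp add: e'_def)
      finally show "(L * (B + H)) * e' \<le> e" .
    qed simp
    finally show ?case by simp
  qed
qed

lemma curve_expansion:
  "(\<lambda>x. 8 * bures_sq \<rho> (state_of w (Cf x)) - Re (trace (h (x - l) ** pinv (h (x - l)))))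
    \<in> o[at l](\<lambda>x. (norm (x - l))\<^sup>2)"
proof -
  obtain B where B: "0 \<le> B" "\<forall>\<^sub>F x in at l. norm (\<Delta> x) \<le> B * norm (x - l)" using \<Delta>_bound by blast
  have "(\<lambda>x. 8 * bures_sq \<rho> (\<sigma> x) - Re (trace (\<Delta> x ** pinv (\<Delta> x)))) \<in> o[at l](\<lambda>x. (norm (x - l))\<^sup>2)"
    by (rule ord_smallo[OF bures_expansion _ distance_tendsto B]) simp
  from sum_in_smallo(1)[OF this quadratic_form_expansion]
  have "(\<lambda>x. 8 * bures_sq \<rho> (\<sigma> x) - Re (trace (h (x - l) ** pinv (h (x - l))))) \<in> o[at l](\<lambda>x. (norm (x - l))\<^sup>2)"
    unfolding diff_add_eq add_diff_eq add_diff_cancel_right' .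
  moreover have ev: "\<forall>\<^sub>F x in at l. 8 * bures_sq \<rho> (\<sigma> x) - Re (trace (h (x - l) ** pinv (h (x - l))))
      = 8 * bures_sq \<rho> (state_of w (Cf x)) - Re (trace (h (x - l) ** pinv (h (x - l))))"
    using \<gamma>_eq by eventually_elim (simp add: \<sigma>_def)
  ultimately show ?thesis unfolding landau_o.small.in_cong[OF ev] by blast
qed

section \<open>The metric tensor\<close>

lemma pinv_form_symmetric: "trace (X ** pinv Y) = trace (Y ** pinv X)" if "dagger X = X" "dagger Y = Y"
proof -
  have "hs_inner (pinv X) Y = hs_inner X (pinv Y)"
    using multiplier_self_adjoint[OF unitary_b] by (simp add: self_adjoint_op_def)
  then show ?thesis
    using that by (simp add: hs_inner_def pinv_hermitian trace_mul_sym[of "pinv X"])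
qed

lemma pinv_form_real: "complex_of_real (Re (trace (X ** pinv Y))) = trace (X ** pinv Y)" if "dagger X = X" "dagger Y = Y"
proof -
  have "cnj (trace (X ** pinv Y)) = trace (pinv Y ** X)"
    using that by (simp add: dagger_mult pinv_hermitian flip: trace_dagger)
  also have "\<dots> = trace (X ** pinv Y)" by (rule trace_mul_sym)
  finally show ?thesis by (simp add: complex_eq_iff)
qed

text \<open>The real part loses nothing: tangent vectors are hermitian, and
  \<open>pinv_form_real\<close> makes the trace real.\<close>

definition g :: "real^'p^'p"
  where "g = (\<chi> \<mu> \<nu>. Re (trace (h (axis \<mu> 1) ** pinv (h (axis \<nu> 1)))))"

lemma g_symmetric: "transpose g = g"
  using pinv_form_symmetric[OF h_hermitian h_hermitian] by (simp add: g_def transpose_def vec_eq_iff)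

lemma g_metric_coeff: "complex_of_real (g $ \<mu> $ \<nu>) = metric_coeff c b (h (axis \<mu> 1)) (h (axis \<nu> 1))"
  unfolding metric_coeff_eq[OF eig'] using pinv_form_real[OF h_hermitian h_hermitian] by (simp add: g_def)

lemma g_form: "trace (h v ** pinv (h v)) = complex_of_real (\<Sum>\<mu>\<in>UNIV. \<Sum>\<nu>\<in>UNIV. g $ \<mu> $ \<nu> * v $ \<mu> * v $ \<nu>)"
proof -
  note lin = bounded_linear.linear[OF h_linear] bounded_linear.linear[OF bounded_linear_multiplier[of "pinv_weight c"]]
  have "v = (\<Sum>\<mu>\<in>UNIV. v $ \<mu> *\<^sub>R axis \<mu> 1)"
    using basis_expansion[of v] by (simp add: scalar_mult_eq_scaleR)
  then have "h v = h (\<Sum>\<mu>\<in>UNIV. v $ \<mu> *\<^sub>R axis \<mu> 1)" by (rule arg_cong)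
  then have hv: "h v = (\<Sum>\<mu>\<in>UNIV. v $ \<mu> *\<^sub>R h (axis \<mu> 1))"
    by (simp only: linear_sum[OF lin(1)] linear_scale[OF lin(1)])
  have "trace (h v ** pinv (h v)) = (\<Sum>\<mu>\<in>UNIV. \<Sum>\<nu>\<in>UNIV. complex_of_real (v $ \<mu> * v $ \<nu>) * trace (h (axis \<mu> 1) ** pinv (h (axis \<nu> 1))))"
    unfolding hv linear_sum[OF lin(2)] linear_scale[OF lin(2)]
    by (simp add: scaleR_eq_smult matrix_sum_alg
        trace_sum trace_smult sum_distrib_left mult.assoc) (subst sum.swap, simp add: mult.left_commute)
  also have "\<dots> = complex_of_real (\<Sum>\<mu>\<in>UNIV. \<Sum>\<nu>\<in>UNIV. g $ \<mu> $ \<nu> * v $ \<mu> * v $ \<nu>)"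
  proof -
    have "trace (h (axis \<mu> 1) ** pinv (h (axis \<nu> 1))) = complex_of_real (g $ \<mu> $ \<nu>)" for \<mu> \<nu>
      by (simp add: g_def pinv_form_real[OF h_hermitian h_hermitian])
    then show ?thesis by (simp add: mult_ac)
  qed
  finally show ?thesis .
qed

end

section \<open>The Bures metric of Gaussian states\<close>

theorem mainTheorem1:
  fixes w :: "'n::finite + 'n \<Rightarrow> complex^'d::finite^'d"
    and \<rho> :: "complex^'d^'d"
    and C :: "complex^('n + 'n)^('n + 'n)"
  assumes dim: "CARD('d) = 2 ^ CARD('n)"
    and majorana: "majorana w"
    and gaussian: "gaussian_state w \<rho>"
    and C: "C = correlation_matrix w \<rho>"
  shows
    "(\<lambda>C'. 8 * bures_sq \<rho> (state_of w C')
          - Re (trace ((C' - C) ** pinv_op (one_minus_Ad C) (C' - C))))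
        \<in> o[at C within variations w \<rho>](\<lambda>C'. (hs_norm (C' - C))\<^sup>2)
     \<and> (\<forall>dC. imaginary_antisymmetric dC \<longrightarrow>
          trace (dC ** pinv_op (one_minus_Ad C) dC)
            = complex_of_real ((hs_norm (op_sqrt (pinv_op (one_minus_Ad C)) dC))\<^sup>2))
     \<and> (pure_state \<rho> \<longrightarrow>
          spectrum C = {1, - 1} \<and>
          (\<lambda>C'. 8 * bures_sq \<rho> (state_of w C') - 1/2 * (hs_norm (C' - C))\<^sup>2)
            \<in> o[at C within variations w \<rho>](\<lambda>C'. (hs_norm (C' - C))\<^sup>2))
     \<and> (\<forall>(Cf :: real^'p::finite \<Rightarrow> complex^('n + 'n)^('n + 'n)) Cf' l c b.
          Cf l = C \<and> (\<forall>\<^sub>F x in nhds l. Cf x \<in> variations w \<rho>) \<and>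
          (Cf has_derivative Cf') (at l) \<and> orthonormal_eigenbasis C c b \<longrightarrow>
          (\<exists>g :: real^'p^'p.
             transpose g = g \<and>
             (\<forall>\<mu> \<nu>. complex_of_real (g $ \<mu> $ \<nu>)
                = metric_coeff c b (Cf' (axis \<mu> 1)) (Cf' (axis \<nu> 1))) \<and>
             (\<forall>dl. trace (Cf' dl ** pinv_op (one_minus_Ad C) (Cf' dl))
                = complex_of_real (\<Sum>\<mu>\<in>UNIV. \<Sum>\<nu>\<in>UNIV. g $ \<mu> $ \<nu> * dl $ \<mu> * dl $ \<nu>)) \<and>
             (\<lambda>x. 8 * bures_sq \<rho> (state_of w (Cf x))
                  - (\<Sum>\<mu>\<in>UNIV. \<Sum>\<nu>\<in>UNIV. g $ \<mu> $ \<nu> * (x - l) $ \<mu> * (x - l) $ \<nu>))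
               \<in> o[at l](\<lambda>x. (norm (x - l))\<^sup>2) \<and>
             (pure_state \<rho> \<longrightarrow>
                (\<forall>dl. trace (Cf' dl ** pinv_op (one_minus_Ad C) (Cf' dl))
                   = complex_of_real (1/2 * (hs_norm (Cf' dl))\<^sup>2)))))"
    (is "?metric \<and> ?norm \<and> ?pure \<and> ?curves")
proof -
  have "hermitian \<rho>"
    using gaussian_state_properties(1)[OF dim majorana gaussian refl] by (rule psd_hermitian)
  then obtain c b where eig: "orthonormal_eigenbasis C c b"
    using spectral_theorem correlation_hermitian[OF majorana] C by blast
  let ?V = "variations w \<rho>"
  \<comment> \<open>The expansion takes a family inside \<open>variations\<close>; the filter
    \<open>at C within ?V\<close> never sees the points that are redefined here.\<close>
  define \<gamma> where "\<gamma> X = (if X \<in> ?V then X else C)" for X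
  have ev: "\<forall>\<^sub>F X in at C within ?V. \<gamma> X = X"
    by (simp add: eventually_at_filter \<gamma>_def)
  interpret I: gaussian_expansion w \<rho> C "at C within ?V" \<gamma> c b
  proof
    have "C \<in> ?V" using gaussian unfolding C variations_def by blast
    then show "\<gamma> x \<in> ?V" for x by (simp add: \<gamma>_def)
    show "(\<gamma> \<longlongrightarrow> C) (at C within ?V)"
      by (rule Lim_transform_eventually[OF tendsto_ident_at]) (use ev in eventually_elim, simp)
  qed (fact dim majorana gaussian C eig)+
  have pinv: "pinv_op (one_minus_Ad C) = I.pinv"
    by (rule pinv_one_minus_Ad[OF eig])
  have dist: "((\<lambda>X. norm (X - C)) \<longlongrightarrow> 0) (at C within ?V)"
    by (intro tendsto_norm_zero LIM_zero tendsto_ident_at)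
  have \<Delta>: "\<forall>\<^sub>F X in at C within ?V. norm (I.\<Delta> X) \<le> 1 * norm (X - C)"
    using ev by eventually_elim (simp add: I.\<Delta>_def)
  have smallo: "f \<in> o[at C within ?V](\<lambda>X. (hs_norm (X - C))\<^sup>2)"
    if "I.ord 3 f'" "\<forall>\<^sub>F X in at C within ?V. f' X = f X" for f f' :: "_ \<Rightarrow> real"
  proof -
    have "f' \<in> o[at C within ?V](\<lambda>X. (norm (X - C))\<^sup>2)"
      by (rule I.ord_smallo[OF that(1) _ dist _ \<Delta>]) simp_all
    then show ?thesis unfolding hs_norm_eq landau_o.small.in_cong[OF that(2)] .
  qed
  have ?metric
    by (rule smallo[OF I.bures_expansion])
      (use ev in eventually_elim, simp add: I.\<sigma>_def I.\<Delta>_def pinv)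
  moreover have ?norm
  proof (intro allI impI)
    fix dC :: "complex^('n + 'n)^('n + 'n)" assume dC: "imaginary_antisymmetric dC"
    have "cnj (dC $ j $ i) = dC $ i $ j" for i j
    proof -
      have "dC $ j $ i = - dC $ i $ j"
        using dC[unfolded imaginary_antisymmetric_def, THEN conjunct1, THEN arg_cong[of _ _ "\<lambda>A. A $ i $ j"]]
        by (simp add: transpose_def)
      then show ?thesis using dC by (simp add: imaginary_antisymmetric_def complex_eq_iff)
    qed
    then have h: "dagger dC = dC" by (simp add: dagger_def vec_eq_iff)
    have pos: "0 \<le> pinv_weight c r s" for r s
    proof -
      have "\<bar>c r * c s\<bar> \<le> 1"
        using mult_mono[OF I.eigenvalue_bound[of r] I.eigenvalue_bound[of s]] by (simp add: abs_mult)
      then have "c r * c s \<le> 1" by linarith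
      then show ?thesis by (simp add: pinv_weight_def)
    qed
    define S where "S = multiplier I.U (\<lambda>r s. sqrt (pinv_weight c r s))"
    have SS: "S \<circ> S = I.pinv" by (simp add: S_def multiplier_comp[OF I.unitary_b] pos)
    have "trace (dC ** I.pinv dC) = hs_inner dC (S (S dC))"
      using fun_cong[OF SS, of dC] by (simp add: hs_inner_def h)
    also have "\<dots> = hs_inner (S dC) (S dC)"
      using multiplier_self_adjoint[OF I.unitary_b] by (simp add: S_def self_adjoint_op_def)
    finally show "trace (dC ** pinv_op (one_minus_Ad C) dC)
        = complex_of_real ((hs_norm (op_sqrt (pinv_op (one_minus_Ad C)) dC))\<^sup>2)"
      by (simp add: pinv op_sqrt_multiplier[OF I.unitary_b pos] hs_inner_norm hs_norm_eq S_def)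
  qed
  moreover have ?pure
  proof (intro impI conjI)
    assume pure: "pure_state \<rho>"
    show "(\<lambda>C'. 8 * bures_sq \<rho> (state_of w C') - 1/2 * (hs_norm (C' - C))\<^sup>2) \<in> o[at C within ?V](\<lambda>C'. (hs_norm (C' - C))\<^sup>2)"
      by (rule smallo[OF I.ord_add[OF I.bures_expansion I.pure_expansion[OF pure]]])
        (use ev in eventually_elim, simp add: I.\<sigma>_def I.\<Delta>_def hs_norm_eq)
    have CC: "C ** C = mat 1" by (rule gaussian_state_properties(5)[OF dim majorana gaussian C pure])
    have CCv: "C *v (C *v v) = v" for v by (simp add: matrix_vector_mul_assoc CC)
    show "spectrum C = {1, - 1}"
    proof
      show "spectrum C \<subseteq> {1, - 1}"
      proof
        fix z assume "z \<in> spectrum C"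
        then obtain v where v: "v \<noteq> 0" "C *v v = z *s v" by (auto simp: spectrum_def)
        have "v = (z * z) *s v" using CCv[of v] by (simp add: v(2) vec.scale)
        then have "(z * z - 1) *s v = 0" by (simp add: vec.scale_left_diff_distrib)
        then have "z * z = 1" using v(1) by (simp only: vec.scale_eq_0_iff) simp
        then show "z \<in> {1, - 1}" by (simp add: square_eq_1_iff)
      qed
      \<comment> \<open>\<open>C\<close> is purely imaginary, so the entrywise conjugate of an
        eigenvector for a real eigenvalue \<open>z\<close> is one for \<open>- z\<close>.\<close>
      have neg: "- z \<in> spectrum C" if z: "z \<in> spectrum C" "z \<in> \<real>" for z
      proof -
        obtain v where v: "v \<noteq> 0" "C *v v = z *s v" using z by (auto simp: spectrum_def)
        let ?u = "\<chi> i. cnj (v $ i)"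
        have "cnj (C $ i $ j) = - C $ i $ j" for i j
          using I.herm_C[THEN arg_cong[of _ _ "\<lambda>A. A $ j $ i"]] I.transpose_C[THEN arg_cong[of _ _ "\<lambda>A. A $ j $ i"]]
          by (simp add: dagger_def transpose_def)
        then have "(C *v ?u) $ i = - cnj ((C *v v) $ i)" for i
          by (simp add: matrix_vector_mult_def sum_negf[symmetric])
        then have "C *v ?u = (- z) *s ?u"
          using z(2) by (simp add: v(2) vec_eq_iff Reals_cnj_iff)
        moreover have "?u \<noteq> 0" using v(1) by (auto simp: vec_eq_iff)
        ultimately show ?thesis unfolding spectrum_def by blast
      qed
      define v :: "complex^('n + 'n)" where "v = axis (Inl undefined) 1"
      have "v \<noteq> 0" by (simp add: v_def axis_eq_0_iff)
      \<comment> \<open>As \<open>C ** C\<close> is the identity, \<open>v + C *v v\<close> is an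
        eigenvector for 1 unless it vanishes, and then \<open>v\<close> is one for -1.\<close>
      have "1 \<in> spectrum C \<or> - 1 \<in> spectrum C"
      proof (cases "C *v v = - v")
        case True
        then have "C *v v = (- 1) *s v" by simp
        then show ?thesis using \<open>v \<noteq> 0\<close> unfolding spectrum_def by blast
      next
        case False
        then have "v + C *v v \<noteq> 0" by (metis add_eq_0_iff)
        moreover have "C *v (v + C *v v) = 1 *s (v + C *v v)"
          by (simp add: matrix_vector_right_distrib CCv)
        ultimately show ?thesis unfolding spectrum_def by blast
      qed
      then show "{1, - 1} \<subseteq> spectrum C" using neg[of 1] neg[of "- 1"] by auto
    qed
  qed
  moreover have ?curves
  proof (intro allI impI, goal_cases)
    case Cf: (1 Cf Cf' l c b)
    interpret curve: gaussian_curve w \<rho> C c b Cf l Cf'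
    proof -
      have "Cf l = C" "\<forall>\<^sub>F x in nhds l. Cf x \<in> ?V" "(Cf has_derivative Cf') (at l)"
        "orthonormal_eigenbasis C c b" using Cf by blast+
      then show "gaussian_curve w \<rho> C c b Cf l Cf'"
        using dim majorana gaussian C by unfold_locales
    qed
    have pinv: "pinv_op (one_minus_Ad C) = curve.pinv"
      by (rule pinv_one_minus_Ad) (use Cf in blast)
    have g: "Re (trace (Cf' v ** curve.pinv (Cf' v))) = (\<Sum>\<mu>\<in>UNIV. \<Sum>\<nu>\<in>UNIV. curve.g $ \<mu> $ \<nu> * v $ \<mu> * v $ \<nu>)" for v
      by (simp only: curve.g_form Re_complex_of_real)
    \<comment> \<open>Tangent vectors have no kernel component by \<open>h_tangential\<close>. So
      for them the formula for pure states is exact and not only valid up to higher order.\<close>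
    have pure: "trace (Cf' v ** curve.pinv (Cf' v)) = complex_of_real (1/2 * (hs_norm (Cf' v))\<^sup>2)" if "pure_state \<rho>" for v
    proof -
      have "trace (Cf' v ** curve.pinv (Cf' v)) = 1/2 * hs_inner (Cf' v) (Cf' v)"
        by (simp add: curve.pure_pinv(2)[OF that] curve.h_tangential scale_mat_mult_right trace_smult
            hs_inner_def curve.h_hermitian)
      then show ?thesis by (simp add: hs_inner_norm hs_norm_eq)
    qed
    show ?case
      unfolding pinv
      by (intro exI[of _ curve.g] conjI allI impI curve.g_symmetric curve.g_metric_coeff curve.g_form
          curve.curve_expansion[unfolded g] pure)
  qed
  ultimately show ?thesis by (intro conjI)
qed

end
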